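(* Assume the setting below, with $\beta\ge0$, $(D,\beta)\neq(0,0)$, and suppose there are $C,a>0$ with $|\psi(x)|\le Ce^{-a|x|}$ for all $x\in\mathbb R$. Then for $\lambda\in\mathbb C\setminus\sigma_{\mathrm{ess}}(\mathcal L)$, $$\lambda\in\sigma_{\mathrm{pt}}(\mathcal L)\iff {\det}_2(\mathcal I+\mathcal K(\lambda))=0.$$
   Context: Setting. Real parameters $D,\beta,\delta,\alpha,\epsilon,\gamma,\mu,\nu$; $\mathbf B=\begin{bmatrix}\beta&-D/2\\ D/2&\beta\end{bmatrix}$, $\mathbf N_0=\begin{bmatrix}\delta&-\alpha\\ \alpha&\delta\end{bmatrix}$, $\mathbf N_1=\begin{bmatrix}\epsilon&-\gamma\\ \gamma&\epsilon\end{bmatrix}$, $\mathbf N_2=\begin{bmatrix}\mu&-\nu\\ \nu&\mu\end{bmatrix}$. $\psi:\mathbb R\to\mathbb C$ is a stationary pulse of the cubic–quintic complex Ginzburg–Landau equation $i\Psi_t+\frac D2\Psi_{xx}+\gamma|\Psi|^2\Psi+\nu|\Psi|^4\Psi=i\delta\Psi+i\epsilon|\Psi|^2\Psi+i\beta\Psi_{xx}+i\mu|\Psi|^4\Psi$ ($\Psi=e^{-i\alpha t}\psi(x)$), $\boldsymbol\psi=[\operatorname{Re}\psi\ \operatorname{Im}\psi]^T$, $|\boldsymbol\psi|=\|\boldsymbol\psi(x)\|_2$. $\mathbf M(x)=\mathbf N_1|\boldsymbol\psi|^2+\mathbf N_2|\boldsymbol\psi|^4+(2\mathbf N_1+4\mathbf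 N_2|\boldsymbol\psi|^2)\boldsymbol\psi\boldsymbol\psi^T$, $\mathcal L=\mathbf B\partial_x^2+\mathbf N_0+\mathbf M(x)$ on $H^2(\mathbb R,\mathbb C^2)\subset L^2(\mathbb R,\mathbb C^2)$; $\sigma_{\mathrm{pt}}(\mathcal L)=\{\lambda:\ker(\mathcal L-\lambda)\neq\{0\}\}$; $\sigma_{\mathrm{ess}}(\mathcal L)=\{(\delta\pm i\alpha)-s^2(\beta\pm iD/2):s\in\mathbb R\}$. For $\lambda\notin\sigma_{\mathrm{ess}}(\mathcal L)$: $\mathbf A_\infty(\lambda)=\begin{bmatrix}\mathbf 0&\mathbf I\\ \mathbf B^{-1}(\lambda\mathbf I-\mathbf N_0)&\mathbf 0\end{bmatrix}$, $\mathbf Q(\lambda)$ the spectral projection onto its stable subspace; with polar decomposition $\mathbf M=\mathbf V|\mathbf M|$, $\mathbf R_\ell=\begin{bmatrix}\mathbf 0&\mathbf 0\\ -\mathbf B^{-1}\mathbf V|\mathbf M|^{1/2}&\mathbf 0\end{bmatrix}$, $\mathbf R_r=\begin{bmatrix}|\mathbf M|^{1/2}&\mathbf 0\\ \mathbf 0&\mathbf 0\end{bmatrix}$. $\mathcal K(\lambda)$ is the integral operator on $L^2(\mathbb R,\mathbb C^4)$ with kernel $\mathbf K(x,y;\lambda)=-\mathbf R_r(x)\mathbf Qe^{\mathbf A_\infty(x-y)}\mathbf Q\mathbf R_\ell(y)$ for $x\ge y$ and $\mathbf R_r(x)(\mathbf I-\mathbf Q)e^{\mathbf A_\infty(x-y)}(\mathbf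 I-\mathbf Q)\mathbf R_\ell(y)$ for $x<y$; under the decay hypothesis it is Hilbert–Schmidt, and ${\det}_2$ denotes the 2-modified Fredholm determinant. *)

theory Defs
  imports "HOL-Analysis.Analysis"
begin

section \<open>Real 2x2 matrices of the setting\<close>

text \<open>rc a b is the real 2x2 matrix [[a, -b], [b, a]].\<close>
definition rc :: "real \<Rightarrow> real \<Rightarrow> real^2^2" where
  "rc a b = (\<chi> i j. if i = j then a else if i = 1 then - b else b)"

text \<open>Complexification of a real matrix.\<close>
definition cplx :: "real^'n^'m \<Rightarrow> complex^'n^'m" where
  "cplx A = (\<chi> i j. complex_of_real (A $ i $ j))"

definition psivec :: "(real \<Rightarrow> complex) \<Rightarrow> real \<Rightarrow> real^2" where
  "psivec \<psi> x = (\<chi> i. if i = 1 then Re (\<psi> x) else Im (\<psi> x))"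

definition outer :: "real^2 \<Rightarrow> real^2^2" where
  "outer v = (\<chi> i j. v $ i * v $ j)"

text \<open>M(x) = N1 |psi|^2 + N2 |psi|^4 + (2 N1 + 4 N2 |psi|^2) psi psi^T.\<close>
definition Mmat :: "real \<Rightarrow> real \<Rightarrow> real \<Rightarrow> real \<Rightarrow> (real \<Rightarrow> complex) \<Rightarrow> real \<Rightarrow> real^2^2" where
  "Mmat \<epsilon> \<gamma> \<mu> \<nu> \<psi> x =
     (norm (psivec \<psi> x))^2 *\<^sub>R rc \<epsilon> \<gamma> + (norm (psivec \<psi> x))^4 *\<^sub>R rc \<mu> \<nu>
     + (2 *\<^sub>R rc \<epsilon> \<gamma> + (4 * (norm (psivec \<psi> x))^2) *\<^sub>R rc \<mu> \<nu>) ** outer (psivec \<psi> x)"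

section \<open>Stationary pulse\<close>

definition stationary_pulse ::
  "real \<Rightarrow> real \<Rightarrow> real \<Rightarrow> real \<Rightarrow> real \<Rightarrow> real \<Rightarrow> real \<Rightarrow> real \<Rightarrow> (real \<Rightarrow> complex) \<Rightarrow> bool" where
  "stationary_pulse D \<beta> \<delta> \<alpha> \<epsilon> \<gamma> \<mu> \<nu> \<psi> \<longleftrightarrow>
     (\<exists>\<psi>1 \<psi>2. \<forall>x.
        (\<psi> has_vector_derivative \<psi>1 x) (at x) \<and>
        (\<psi>1 has_vector_derivative \<psi>2 x) (at x) \<and>
        complex_of_real \<alpha> * \<psi> x + complex_of_real (D/2) * \<psi>2 x
          + complex_of_real \<gamma> * (cmod (\<psi> x))^2 * \<psi> x + complex_of_real \<nu> * (cmod (\<psi> x))^4 * \<psi> x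
        = \<i> * complex_of_real \<delta> * \<psi> x + \<i> * complex_of_real \<epsilon> * (cmod (\<psi> x))^2 * \<psi> x
          + \<i> * complex_of_real \<beta> * \<psi>2 x + \<i> * complex_of_real \<mu> * (cmod (\<psi> x))^4 * \<psi> x)"

section \<open>H^2, point spectrum, essential spectrum\<close>

definition square_integrable :: "(real \<Rightarrow> 'a::euclidean_space) \<Rightarrow> bool" where
  "square_integrable u \<longleftrightarrow> u \<in> borel_measurable lborel \<and> integrable lborel (\<lambda>x. (norm (u x))^2)"

text \<open>u in H^2(R): u, u1, u2 in L^2 with u, u1 absolutely continuous,
  u' = u1 and u1' = u2 (weak derivatives), i.e. (the continuous representative)\<close>
definition H2_with :: "(real \<Rightarrow> complex^2) \<Rightarrow> (real \<Rightarrow> complex^2) \<Rightarrow> (real \<Rightarrow> complex^2) \<Rightarrow> bool" where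
  "H2_with u u1 u2 \<longleftrightarrow> square_integrable u \<and> square_integrable u1 \<and> square_integrable u2 \<and>
     (\<forall>a b. set_integrable lborel {a..b} u1 \<and> set_integrable lborel {a..b} u2) \<and>
     (\<forall>x. u x = u 0 + interval_lebesgue_integral lborel (ereal 0) (ereal x) u1) \<and>
     (\<forall>x. u1 x = u1 0 + interval_lebesgue_integral lborel (ereal 0) (ereal x) u2)"

text \<open>Point spectrum of L = B d^2/dx^2 + N0 + M(x) on H^2(R,C^2) in L^2(R,C^2).\<close>
definition point_spectrum ::
  "real \<Rightarrow> real \<Rightarrow> real \<Rightarrow> real \<Rightarrow> real \<Rightarrow> real \<Rightarrow> real \<Rightarrow> real \<Rightarrow> (real \<Rightarrow> complex) \<Rightarrow> complex set" where
  "point_spectrum D \<beta> \<delta> \<alpha> \<epsilon> \<gamma> \<mu> \<nu> \<psi> =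
     {lam. \<exists>u u1 u2. H2_with u u1 u2 \<and> \<not> (AE x in lborel. u x = 0) \<and>
        (AE x in lborel. cplx (rc \<beta> (D/2)) *v u2 x + cplx (rc \<delta> \<alpha> + Mmat \<epsilon> \<gamma> \<mu> \<nu> \<psi> x) *v u x
                          = lam *s u x)}"

definition ess_spectrum :: "real \<Rightarrow> real \<Rightarrow> real \<Rightarrow> real \<Rightarrow> complex set" where
  "ess_spectrum D \<beta> \<delta> \<alpha> =
     {Complex \<delta> \<alpha> - complex_of_real (s^2) * Complex \<beta> (D/2) | s. True} \<union>
     {Complex \<delta> (-\<alpha>) - complex_of_real (s^2) * Complex \<beta> (-D/2) | s. True}"

section \<open>The 4x4 first-order system\<close>

text \<open>C^4 = C^2 x C^2 is indexed by the type 2 + 2: Inl i is the i-th component of u,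
  Inr i the i-th component of u'.\<close>
type_synonym idx4 = "2 + 2"

definition blockm :: "complex^2^2 \<Rightarrow> complex^2^2 \<Rightarrow> complex^2^2 \<Rightarrow> complex^2^2 \<Rightarrow> complex^idx4^idx4" where
  "blockm P11 P12 P21 P22 = (\<chi> r c. case (r, c) of
      (Inl i, Inl j) \<Rightarrow> P11 $ i $ j | (Inl i, Inr j) \<Rightarrow> P12 $ i $ j
    | (Inr i, Inl j) \<Rightarrow> P21 $ i $ j | (Inr i, Inr j) \<Rightarrow> P22 $ i $ j)"

definition Ainf :: "real \<Rightarrow> real \<Rightarrow> real \<Rightarrow> real \<Rightarrow> complex \<Rightarrow> complex^idx4^idx4" where
  "Ainf D \<beta> \<delta> \<alpha> lam = blockm 0 (mat 1) (cplx (matrix_inv (rc \<beta> (D/2))) ** (mat lam - cplx (rc \<delta> \<alpha>))) 0"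

definition mpow :: "'a::comm_ring_1^'n^'n \<Rightarrow> nat \<Rightarrow> 'a^'n^'n" where
  "mpow A k = (((**) A) ^^ k) (mat 1)"

text \<open>Matrix exponential (power series).\<close>
definition mexp :: "complex^'n^'n \<Rightarrow> complex^'n^'n" where
  "mexp A = (\<Sum>k. (1 / fact k) *\<^sub>R mpow A k)"

text \<open>Generalized eigenspace of A for the eigenvalue z.\<close>
definition gen_eigenspace :: "complex^'n^'n \<Rightarrow> complex \<Rightarrow> (complex^'n) set" where
  "gen_eigenspace A z = {v. mpow (A - mat z) CARD('n) *v v = 0}"

definition stable_subspace :: "complex^'n^'n \<Rightarrow> (complex^'n) set" where
  "stable_subspace A = span (\<Union>{gen_eigenspace A z | z. Re z < 0})"

definition unstable_subspace :: "complex^'n^'n \<Rightarrow> (complex^'n) set" where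
  "unstable_subspace A = span (\<Union>{gen_eigenspace A z | z. Re z > 0})"

text \<open>Spectral projection onto the stable subspace (along the unstable one).\<close>
definition stable_proj :: "complex^'n^'n \<Rightarrow> complex^'n^'n" where
  "stable_proj A = (THE P. P ** P = P \<and> range ((*v) P) = stable_subspace A
                          \<and> {v. P *v v = 0} = unstable_subspace A)"

section \<open>Polar decomposition and the weights R_l, R_r\<close>

definition psd_sqrt :: "real^'n^'n \<Rightarrow> real^'n^'n" where
  "psd_sqrt P = (THE S. transpose S = S \<and> (\<forall>v. 0 \<le> v \<bullet> (S *v v)) \<and> S ** S = P)"

text \<open>|M| = (M^T M)^(1/2).\<close>
definition absm :: "real^'n^'n \<Rightarrow> real^'n^'n" where
  "absm M = psd_sqrt (transpose M ** M)"

text \<open>Partial isometry V of a polar decomposition M = V |M| (chosen orthogonal;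
  the product V |M|^(1/2) does not depend on the choice).\<close>
definition polarV :: "real^'n^'n \<Rightarrow> real^'n^'n" where
  "polarV M = (SOME V. orthogonal_matrix V \<and> M = V ** absm M)"

definition Rl :: "real \<Rightarrow> real \<Rightarrow> real \<Rightarrow> real \<Rightarrow> real \<Rightarrow> real \<Rightarrow> (real \<Rightarrow> complex) \<Rightarrow> real \<Rightarrow> complex^idx4^idx4" where
  "Rl D \<beta> \<epsilon> \<gamma> \<mu> \<nu> \<psi> y =
     (let M = Mmat \<epsilon> \<gamma> \<mu> \<nu> \<psi> y in
      blockm 0 0 (- cplx (matrix_inv (rc \<beta> (D/2)) ** polarV M ** psd_sqrt (absm M))) 0)"

definition Rr :: "real \<Rightarrow> real \<Rightarrow> real \<Rightarrow> real \<Rightarrow> (real \<Rightarrow> complex) \<Rightarrow> real \<Rightarrow> complex^idx4^idx4" where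
  "Rr \<epsilon> \<gamma> \<mu> \<nu> \<psi> x = blockm (cplx (psd_sqrt (absm (Mmat \<epsilon> \<gamma> \<mu> \<nu> \<psi> x)))) 0 0 0"

definition Kker ::
  "real \<Rightarrow> real \<Rightarrow> real \<Rightarrow> real \<Rightarrow> real \<Rightarrow> real \<Rightarrow> real \<Rightarrow> real \<Rightarrow> (real \<Rightarrow> complex) \<Rightarrow> complex
    \<Rightarrow> real \<Rightarrow> real \<Rightarrow> complex^idx4^idx4" where
  "Kker D \<beta> \<delta> \<alpha> \<epsilon> \<gamma> \<mu> \<nu> \<psi> lam x y =
     (let A = Ainf D \<beta> \<delta> \<alpha> lam; Q = stable_proj A; E = mexp ((x - y) *\<^sub>R A) in
      if y \<le> x then - (Rr \<epsilon> \<gamma> \<mu> \<nu> \<psi> x ** Q ** E ** Q ** Rl D \<beta> \<epsilon> \<gamma> \<mu> \<nu> \<psi> y)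
      else Rr \<epsilon> \<gamma> \<mu> \<nu> \<psi> x ** (mat 1 - Q) ** E ** (mat 1 - Q) ** Rl D \<beta> \<epsilon> \<gamma> \<mu> \<nu> \<psi> y)"

section \<open>2-modified Fredholm determinant of an integral operator with matrix kernel\<close>

definition detn :: "nat \<Rightarrow> (nat \<Rightarrow> nat \<Rightarrow> complex) \<Rightarrow> complex" where
  "detn n f = (\<Sum>p | p permutes {..<n}. of_int (sign p) * (\<Prod>i<n. f i (p i)))"

text \<open>Hilbert--Carleman / Plemelj--Smithies series for det_2(I + K), K the integral
  operator on L^2(R, C^'m) with kernel k, viewed as a scalar kernel on R x 'm.\<close>
definition det2_kernel :: "(real \<Rightarrow> real \<Rightarrow> complex^'m^'m) \<Rightarrow> complex" where
  "det2_kernel k = (\<Sum>n. (1 / fact n) *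
     (\<integral>x. (\<Sum>a\<in>PiE {..<n} (\<lambda>_. UNIV).
              detn n (\<lambda>i j. if i = j then 0 else k (x i) (x j) $ a i $ a j))
        \<partial>(PiM {..<n} (\<lambda>_. lborel))))"

end

theory Submission
  imports "Jordan_Normal_Form.Schur_Decomposition" Defs
begin

text \<open>
  Conjugating by the weights turns the eigenvalue problem for \<open>\<L>\<close> into the equation \<open>w + K w = 0\<close>
  (Birman--Schwinger), so the theorem is a Fredholm alternative for \<open>K\<close>.

  Fredholm's argument applies directly to the Hilbert--Carleman series: for a bounded kernel \<open>k\<close> on a
  finite measure space, let \<open>a\<^sub>n\<close> be its coefficients and \<open>b\<^sub>n(s,t)\<close> those of the first minor (with
  every diagonal entry except the one of the distinguished point replaced by \<open>0\<close>). Expansion along a row gives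
  \<open>b\<^sub>n = a\<^sub>n k - k b\<^sub>n\<^sub>-\<^sub>1\<close> and \<open>n a\<^sub>n = tr (b\<^sub>n\<^sub>-\<^sub>1 - a\<^sub>n\<^sub>-\<^sub>1 k)\<close>, and Hadamard's inequality makes all series converge.
  If \<open>-1\<close> is an eigenvalue, the resolvent identity forces \<open>D(1) = \<Sum> a\<^sub>n = 0\<close>. Conversely, if \<open>D(1) = 0\<close> and \<open>-1\<close>
  is not an eigenvalue, then inductively all Taylor coefficients at \<open>1\<close> of \<open>D\<close> and of the first minor vanish,
  contradicting \<open>D(0) = 1\<close>. The matrix kernel is brought into this setting by regarding it as a scalar kernel on
  (index) \<open>\<times>\<close> \<open>\<real>\<close> and absorbing its exponential decay into the measure.

  All matrices except \<open>M\<close> commute with rotations, so in the coordinates \<open>u\<^sub>1 \<plusminus> \<i> u\<^sub>2\<close> the kernel of \<open>K\<close> consists of the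
  scalar Green functions \<open>exp (-r \<bar>x - y\<bar>) / (2 r)\<close> between the weights, where \<open>r\<^sup>2\<close> runs through the eigenvalues of
  \<open>B\<^sup>-\<^sup>1 (\<lambda> - N\<^sub>0)\<close> and \<open>Re r > 0\<close> outside the essential spectrum.
\<close>

section \<open>Hadamard's inequality\<close>

text \<open>The determinant is available only through its coefficients, so the analysis of D(z) near
  z = 1 is done on sequences: the j-th Taylor coefficient is the coefficient series weighted by n
  choose j, and n choose j <= 2^n is paid for by a spare factor 2^n in the convergence bound. If all
  Taylor coefficients vanish, truncated alternating sums of them reproduce D(0) = 1 up to a small
  tail. Statements at every point matter because the trace integrates a minor along the diagonal,
  which almost everywhere statements on the product do not see; the integral equation itself
  upgrades almost everywhere to everywhere.

  With M = T S, S = |M|^(1/2), T = V |M|^(1/2) and R the resolvent of the constant coefficient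
  operator, K acts as -S R T, and w = S u, u = R T w translate between the two eigenvalue problems.
  V is selected by choice at each point, so the measurability of T in x has to come from a closed
  formula in the entries of M; this is why square roots and polar factors of 2x2 matrices are
  computed explicitly.\<close>

lemma hadamard_mat:
  fixes A :: "complex Matrix.mat"
  assumes A: "A \<in> carrier_mat n n" and bnd: "\<And>i j. i < n \<Longrightarrow> j < n \<Longrightarrow> cmod (A $$ (i,j)) \<le> 1"
  shows "(cmod (Determinant.det A))\<^sup>2 \<le> real n ^ n"
proof (cases "n = 0")
  case True
  then show ?thesis using A by (simp add: Determinant.det_def)
next
  case False
  \<comment> \<open>The Gram matrix \<open>G = A * H\<close>, with \<open>H\<close> the adjoint of
    \<open>A\<close>, has determinant |det A|^2, trace at most n^2 and nonnegative eigenvalues. A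
    Schur form \<open>B\<close> of \<open>G\<close> turns determinant and trace into product and sum
    of the eigenvalues, to which the inequality of arithmetic and geometric means applies.\<close>
  define H where "H = Matrix.mat n n (\<lambda>(i,j). cnj (A $$ (j,i)))"
  have H: "H \<in> carrier_mat n n" by (simp add: H_def)
  define G where "G = A * H"
  have G: "G \<in> carrier_mat n n" using A H by (simp add: G_def)
  have Gij: "G $$ (i,j) = (\<Sum>k<n. A $$ (i,k) * cnj (A $$ (j,k)))" if "i < n" "j < n" for i j
    using that A H by (simp add: G_def H_def scalar_prod_def lessThan_atLeast0)
  have "Determinant.det H = cnj (Determinant.det (transpose_mat A))"
    using A H by (simp add: det_def'[of _ n] H_def sign_def)
  hence detG: "Determinant.det G = complex_of_real ((cmod (Determinant.det A))\<^sup>2)"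
    using A H by (simp add: G_def Determinant.det_mult[OF A H] Determinant.det_transpose[OF A] complex_norm_square del: of_real_power)
  obtain as where as: "char_poly G = (\<Prod> a \<leftarrow> as. [:- a, 1:])"
    using char_poly_factorized[OF G] by blast
  obtain B where B: "B \<in> carrier_mat n n" "upper_triangular B" "similar_mat G B"
    using schur_decomposition_exists[OF G as] by blast
  have detB: "Determinant.det G = (\<Prod>i<n. B $$ (i,i))"
    using det_similar[OF B(3)] Determinant.det_upper_triangular[OF B(2,1)] B(1)
    by (simp add: prod_list_diag_prod lessThan_atLeast0)
  obtain P Q where PQ: "similar_mat_wit G B P Q" using B(3) unfolding similar_mat_def by blast
  note w = similar_mat_witD2[OF G PQ]
  have trace: "(\<Sum>i<n. B $$ (i,i)) = (\<Sum>i<n. G $$ (i,i))"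
  proof -
    \<comment> \<open>Cyclicity of the trace for G = P B Q with Q P = 1, written out in
      entries.\<close>
    define R where "R = P * B"
    have R: "R \<in> carrier_mat n n" "G = R * Q" using w by (auto simp: R_def)
    have "(\<Sum>i<n. G $$ (i,i)) = (\<Sum>i<n. \<Sum>k<n. R $$ (i,k) * Q $$ (k,i))"
      unfolding R(2) using w R(1) by (intro sum.cong refl) (simp add: scalar_prod_def lessThan_atLeast0)
    also have "\<dots> = (\<Sum>i<n. \<Sum>k<n. \<Sum>l<n. P $$ (i,l) * B $$ (l,k) * Q $$ (k,i))"
      unfolding R_def using w by (intro sum.cong refl) (simp add: scalar_prod_def lessThan_atLeast0 sum_distrib_right)
    also have "\<dots> = (\<Sum>k<n. \<Sum>l<n. \<Sum>i<n. P $$ (i,l) * B $$ (l,k) * Q $$ (k,i))"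
      by (rule trans[OF sum.swap], rule sum.cong[OF refl], rule sum.swap)
    also have "\<dots> = (\<Sum>k<n. \<Sum>l<n. B $$ (l,k) * (Q * P) $$ (k,l))"
      using w(5-7) by (intro sum.cong refl) (simp add: scalar_prod_def lessThan_atLeast0 sum_distrib_left ac_simps)
    also have "\<dots> = (\<Sum>k<n. \<Sum>l<n. if k = l then B $$ (l,k) else 0)"
      unfolding w(2) by (intro sum.cong refl) auto
    also have "\<dots> = (\<Sum>i<n. B $$ (i,i))" by simp
    finally show ?thesis by simp
  qed
  have pos: "\<exists>r\<ge>0. B $$ (i,i) = complex_of_real r" if i: "i < n" for i
  proof -
    have "B $$ (i,i) \<in> set (diag_mat B)" using i B(1) by (auto simp: diag_mat_def)
    hence "poly (char_poly G) (B $$ (i,i)) = 0"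
      unfolding char_poly_similar[OF B(3)] char_poly_upper_triangular[OF B(1,2)]
      by (auto simp: poly_prod_list prod_list_zero_iff)
    then obtain v where v: "eigenvector G v (B $$ (i,i))"
      using eigenvalue_root_char_poly[OF G] unfolding eigenvalue_def by blast
    define lam where "lam = B $$ (i,i)"
    have vc: "v \<in> carrier_vec n" "v \<noteq> 0\<^sub>v n" "G *\<^sub>v v = lam \<cdot>\<^sub>v v"
      using v G unfolding eigenvector_def lam_def by auto
    have row: "(\<Sum>j<n. G $$ (i,j) * vec_index v j) = lam * vec_index v i" if "i < n" for i
    proof -
      have "vec_index (G *\<^sub>v v) i = vec_index (lam \<cdot>\<^sub>v v) i" by (simp only: vc(3))
      thus ?thesis using that G vc(1) by (simp add: scalar_prod_def lessThan_atLeast0)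
    qed
    define S where "S = (\<Sum>i<n. (cmod (vec_index v i))\<^sup>2)"
    define T where "T = (\<Sum>k<n. (cmod (\<Sum>j<n. cnj (A $$ (j,k)) * vec_index v j))\<^sup>2)"
    \<comment> \<open>Pairing the eigenvector equation with \<open>v\<close> gives lam * |v|^2 =
      |A^* v|^2; \<open>S\<close> and \<open>T\<close> are these two squared norms.\<close>
    have "lam * complex_of_real S = (\<Sum>i<n. cnj (vec_index v i) * (lam * vec_index v i))"
      by (simp add: S_def sum_distrib_left complex_norm_square ac_simps del: of_real_power)
    also have "\<dots> = (\<Sum>i<n. \<Sum>j<n. \<Sum>k<n. cnj (vec_index v i) * A $$ (i,k) * cnj (A $$ (j,k)) * vec_index v j)"
      by (intro sum.cong refl, subst row[symmetric], simp)
        (auto simp: Gij sum_distrib_left sum_distrib_right mult.assoc intro!: sum.cong)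
    also have "\<dots> = (\<Sum>k<n. \<Sum>i<n. \<Sum>j<n. cnj (vec_index v i) * A $$ (i,k) * cnj (A $$ (j,k)) * vec_index v j)"
      by (rule trans[OF sum.cong[OF refl sum.swap] sum.swap])
    also have "\<dots> = complex_of_real T"
      unfolding T_def of_real_sum complex_norm_square cnj_sum
      by (rule sum.cong[OF refl]) (simp add: sum_product ac_simps, rule sum.swap)
    finally have eq: "lam * complex_of_real S = complex_of_real T" .
    have "S > 0"
    proof -
      obtain l where l: "l < n" "vec_index v l \<noteq> 0" using vc eq_vecI[of v "0\<^sub>v n"] by fastforce
      have "0 < (cmod (vec_index v l))\<^sup>2" using l by simp
      also have "\<dots> \<le> S" unfolding S_def using l by (intro member_le_sum) auto
      finally show ?thesis .
    qed
    hence "lam = complex_of_real (T / S)" using eq by (simp add: field_simps)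
    moreover have "T / S \<ge> 0" using \<open>S > 0\<close> by (auto simp: T_def intro!: divide_nonneg_pos sum_nonneg)
    ultimately show ?thesis unfolding lam_def by blast
  qed
  then obtain r where r: "\<And>i. i < n \<Longrightarrow> r i \<ge> 0" "\<And>i. i < n \<Longrightarrow> B $$ (i,i) = complex_of_real (r i)"
    by metis
  have "complex_of_real (\<Sum>i<n. r i) = (\<Sum>i<n. G $$ (i,i))"
    using trace r(2) by simp
  also have "\<dots> = complex_of_real (\<Sum>i<n. \<Sum>k<n. (cmod (A $$ (i,k)))\<^sup>2)"
    by (simp add: Gij complex_norm_square del: of_real_power)
  finally have "(\<Sum>i<n. r i) = (\<Sum>i<n. \<Sum>k<n. (cmod (A $$ (i,k)))\<^sup>2)" unfolding of_real_eq_iff .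
  also have "\<dots> \<le> (\<Sum>i<n. \<Sum>k<n. 1)"
    using bnd by (intro sum_mono) (simp add: power_le_one)
  finally have sumr: "(\<Sum>i<n. r i) \<le> real n * real n" by simp
  have "complex_of_real ((cmod (Determinant.det A))\<^sup>2) = complex_of_real (\<Prod>i<n. r i)"
    using detG detB r(2) by simp
  hence "(cmod (Determinant.det A))\<^sup>2 = (\<Prod>i<n. r i)" unfolding of_real_eq_iff .
  also have "\<dots> = real n ^ n * (\<Prod>i<n. r i / n)"
    using False by (simp add: prod_dividef)
  \<comment> \<open>The mean inequality in exponential form: x <= exp (x - 1) at x = r i / n, and
    the exponents add up to at most 0.\<close>
  also have "(\<Prod>i<n. r i / n) \<le> (\<Prod>i<n. exp (r i / n - 1))"
    using r(1) exp_ge_add_one_self by (intro prod_mono) (auto, smt (verit) exp_ge_add_one_self)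
  also have "\<dots> = exp ((\<Sum>i<n. r i) / n - n)"
    by (simp add: exp_sum[symmetric] sum_subtractf sum_divide_distrib)
  also have "\<dots> \<le> 1" using sumr False by (simp add: field_simps)
  finally show ?thesis by (simp add: mult_left_mono)
qed

lemma hadamard_detn:
  assumes "\<And>i j. i < n \<Longrightarrow> j < n \<Longrightarrow> cmod (f i j) \<le> 1"
  shows "cmod (detn n f) \<le> sqrt (real n ^ n)"
proof -
  let ?A = "Matrix.mat n n (\<lambda>(i,j). f i j)"
  have "Determinant.det ?A = detn n f"
    by (subst det_def'[of _ n])
       (auto simp: detn_def lessThan_atLeast0 sign_def permutes_in_image intro!: sum.cong prod.cong)
  moreover have "(cmod (Determinant.det ?A))\<^sup>2 \<le> real n ^ n"
    by (rule hadamard_mat) (use assms in auto)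
  ultimately show ?thesis by (simp add: real_le_rsqrt)
qed

no_notation Matrix.vec_index (infixl \<open>$\<close> 100)
no_notation Matrix.scalar_prod (infix \<open>\<bullet>\<close> 70)

section \<open>Fredholm theory of a bounded kernel on a finite measure space\<close>

definition detS :: "nat set \<Rightarrow> (nat \<Rightarrow> nat \<Rightarrow> complex) \<Rightarrow> complex" where
  "detS J f = (\<Sum>p | p permutes J. of_int (sign p) * (\<Prod>i\<in>J. f i (p i)))"

lemma detS_cong:
  assumes "\<And>i j. i \<in> J \<Longrightarrow> j \<in> J \<Longrightarrow> f i j = g i j"
  shows "detS J f = detS J g"
  unfolding detS_def using assms
  by (intro sum.cong refl arg_cong2[where f="(*)"] prod.cong) (auto simp: permutes_in_image)

text \<open>Expansion along row \<open>i\<close>. The cofactor of column \<open>j\<close> has the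
  rows \<open>J\<close> and lacks the column \<open>j\<close>; renaming its row \<open>j\<close> to
  \<open>i\<close> makes it again a determinant over one index set, whose distinguished index
  \<open>i\<close> carries row \<open>j\<close> and column \<open>i\<close>. The renaming is a
  transposition and produces the minus sign. Arbitrary finite index sets keep the remaining indices
  from being renumbered.\<close>

lemma detS_insert:
  assumes J: "finite J" "i \<notin> J"
  shows "detS (insert i J) f = f i i * detS J f
    - (\<Sum>j\<in>J. f i j * detS (insert i (J - {j})) (\<lambda>l m. f (if l = i then j else l) m))"
proof -
  define F where "F p = of_int (sign p) * (\<Prod>l\<in>insert i J. f l (p l))" for p
  have id: "(\<Sum>q | q permutes J. F (Transposition.transpose i i \<circ> q)) = f i i * detS J f"
    unfolding detS_def sum_distrib_left F_def using J
    by (intro sum.cong) (auto simp: permutes_not_in)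
  have tr: "(\<Sum>q | q permutes J. F (Transposition.transpose i j \<circ> q))
     = - (f i j * detS (insert i (J - {j})) (\<lambda>l m. f (if l = i then j else l) m))" if j: "j \<in> J" for j
  proof -
    define t where "t = Transposition.transpose i j"
    have ij: "i \<noteq> j" using j J by auto
    have tt: "t (t x) = x" for x by (simp add: t_def)
    have bt: "bij t" by (simp add: t_def)
    define K where "K = insert i (J - {j})"
    define g where "g l m = f (if l = i then j else l) m" for l m
    have bij: "bij_betw t J K"
      by (rule bij_betwI[of _ _ _ t]) (auto simp: t_def K_def j J Transposition.transpose_def)
    \<comment> \<open>Conjugation with \<open>t\<close> preserves the sign and matches the
      permutations of \<open>J\<close> with those of \<open>K\<close>, so the cofactor becomes a sum
      over permutations of \<open>J\<close>.\<close>
    have conj: "t \<circ> q \<circ> t permutes (t ` S)" if "q permutes S" for q S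
    proof -
      have "bij (t \<circ> q \<circ> t)" using that bt by (simp add: permutes_bij bij_comp)
      moreover have "(t \<circ> q \<circ> t) x = x" if "x \<notin> t ` S" for x
      proof -
        have "t x \<notin> S" using that tt by (metis imageI)
        thus ?thesis using \<open>q permutes S\<close> tt by (simp add: permutes_not_in)
      qed
      ultimately show ?thesis unfolding permutes_def bij_iff by blast
    qed
    have im: "t ` J = K" "t ` K = J" using bij tt by (auto simp: bij_betw_def image_image)
    have "detS K g = (\<Sum>q | q permutes J. of_int (sign (t \<circ> q \<circ> t)) * (\<Prod>l\<in>K. g l ((t \<circ> q \<circ> t) l)))"
      unfolding detS_def
      by (rule sum.reindex_bij_witness[where i="\<lambda>q. t \<circ> q \<circ> t" and j="\<lambda>q. t \<circ> q \<circ> t"])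
         (use conj[of _ J] conj[of _ K] im in \<open>auto simp: fun_eq_iff tt o_def\<close>)
    also have "\<dots> = (\<Sum>q | q permutes J. of_int (sign q) * (\<Prod>l\<in>J. f l (t (q l))))"
    proof (intro sum.cong refl arg_cong2[where f="(*)"])
      fix q assume q: "q \<in> {q. q permutes J}"
      have p: "permutation q" using q J by (auto intro: permutes_imp_permutation)
      have pt: "permutation t" unfolding t_def by (rule permutation_swap_id)
      show "complex_of_int (sign (t \<circ> q \<circ> t)) = of_int (sign q)"
        using p pt ij by (simp add: sign_compose permutation_compose) (simp add: t_def sign_swap_id)
      have "(\<Prod>l\<in>K. g l ((t \<circ> q \<circ> t) l)) = (\<Prod>l\<in>J. g (t l) (t (q (t (t l)))))"
        by (subst prod.reindex_bij_betw[OF bij, symmetric]) simp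
      also have "\<dots> = (\<Prod>l\<in>J. f l (t (q l)))"
        using J(2) by (intro prod.cong refl) (auto simp: tt g_def t_def Transposition.transpose_def)
      finally show "(\<Prod>l\<in>K. g l ((t \<circ> q \<circ> t) l)) = (\<Prod>l\<in>J. f l (t (q l)))" .
    qed
    finally have *: "detS K g = (\<Sum>q | q permutes J. of_int (sign q) * (\<Prod>l\<in>J. f l (t (q l))))" .
    have "(\<Sum>q | q permutes J. F (t \<circ> q)) = - (f i j * detS K g)"
      unfolding * sum_distrib_left sum_negf[symmetric]
    proof (intro sum.cong refl)
      fix q assume q: "q \<in> {q. q permutes J}"
      have p: "permutation q" using q J by (auto intro: permutes_imp_permutation)
      have pt: "permutation t" unfolding t_def by (rule permutation_swap_id)
      have s: "sign (t \<circ> q) = - sign q"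
        using p pt ij by (simp add: sign_compose) (simp add: t_def sign_swap_id)
      have "q i = i" using q J by (simp add: permutes_not_in)
      thus "F (t \<circ> q) = - (f i j * (of_int (sign q) * (\<Prod>l\<in>J. f l (t (q l)))))"
        unfolding F_def s using J by (simp add: t_def)
    qed
    thus ?thesis unfolding t_def K_def g_def .
  qed
  have "detS (insert i J) f = (\<Sum>b\<in>insert i J. \<Sum>q | q permutes J. F (Transposition.transpose i b \<circ> q))"
    unfolding detS_def F_def by (rule sum_over_permutations_insert[OF J])
  also have "\<dots> = f i i * detS J f + (\<Sum>j\<in>J. \<Sum>q | q permutes J. F (Transposition.transpose i j \<circ> q))"
    using J by (simp only: sum.insert id not_False_eq_True)
  also have "(\<Sum>j\<in>J. \<Sum>q | q permutes J. F (Transposition.transpose i j \<circ> q)) =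
     - (\<Sum>j\<in>J. f i j * detS (insert i (J - {j})) (\<lambda>l m. f (if l = i then j else l) m))"
    by (simp add: tr sum_negf)
  finally show ?thesis by simp
qed

lemma detS_lessThan: "detS {..<n} f = detn n f"
  unfolding detS_def detn_def ..

text \<open>Counting permutations is enough for integrability. It would not do for the series: with
  n! in place of Hadamard's n^(n/2), convergence would follow only for small total mass.\<close>

lemma norm_detS_le:
  assumes J: "finite J" and f: "\<And>i j. i \<in> J \<Longrightarrow> j \<in> J \<Longrightarrow> cmod (f i j) \<le> 1"
  shows "cmod (detS J f) \<le> fact (card J)"
proof -
  have "cmod (detS J f) \<le> (\<Sum>p | p permutes J. 1)"
    unfolding detS_def using f
    by (intro sum_norm_le)
       (auto simp: norm_mult sign_def prod_norm[symmetric] permutes_in_image intro!: prod_le_1)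
  also have "\<dots> = fact (card J)" using card_permutations[OF refl J] by simp
  finally show ?thesis .
qed

lemma borel_measurable_detS:
  assumes "\<And>i j. i \<in> J \<Longrightarrow> j \<in> J \<Longrightarrow> (\<lambda>w. f w i j) \<in> borel_measurable N"
  shows "(\<lambda>w. detS J (f w)) \<in> borel_measurable N"
  unfolding detS_def using assms
  by (intro borel_measurable_sum borel_measurable_times borel_measurable_prod borel_measurable_const)
     (auto simp: permutes_in_image)

lemma norm_mult_le_of_le_1:
  fixes a b :: complex
  assumes "cmod a \<le> 1" "cmod b \<le> C"
  shows "cmod (a * b) \<le> C"
  using mult_mono[OF assms] by (simp add: norm_mult)

lemma (in finite_measure) norm_integral_le_const:
  fixes f :: "'a \<Rightarrow> complex"
  assumes "\<And>x. cmod (f x) \<le> C"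
  shows "cmod (integral\<^sup>L M f) \<le> C * measure M (space M)"
proof (cases "integrable M f")
  case True
  have "cmod (integral\<^sup>L M f) \<le> (\<integral>x. cmod (f x) \<partial>M)" by (rule integral_norm_bound)
  also have "\<dots> \<le> (\<integral>x. C \<partial>M)" using True assms by (intro integral_mono) auto
  finally show ?thesis by (simp add: mult.commute)
next
  case False
  have "C \<ge> 0" using assms norm_ge_zero order_trans by blast
  thus ?thesis using False by (simp add: not_integrable_integral_eq)
qed

lemma suc_le_pow_2: "Suc n \<le> 2 ^ n"
  by (induction n) auto

text \<open>The bound 1 is a normalisation: the size and decay of a concrete kernel are moved into
  the measure.\<close>

locale bounded_kernel = finite_measure M for M :: "'x measure" +
  fixes k :: "'x \<Rightarrow> 'x \<Rightarrow> complex"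
  assumes space_M: "space M = UNIV"
    and k_measurable: "case_prod k \<in> borel_measurable (M \<Otimes>\<^sub>M M)"
    and k_le: "cmod (k s t) \<le> 1"
begin

sublocale P: product_sigma_finite "\<lambda>_::nat. M" by standard

lemma measurable_k [measurable (raw)]:
  assumes "f \<in> N \<rightarrow>\<^sub>M M" "g \<in> N \<rightarrow>\<^sub>M M"
  shows "(\<lambda>w. k (f w) (g w)) \<in> borel_measurable N"
  using measurable_compose[OF measurable_Pair[OF assms] k_measurable] by simp

section \<open>Kernel determinants with vanishing diagonal and their row expansions\<close>

definition hollow_det :: "nat set \<Rightarrow> (nat \<Rightarrow> 'x) \<Rightarrow> complex" where
  "hollow_det J x = detS J (\<lambda>l m. if l = m then 0 else k (x l) (x m))"

text \<open>Integrand of the first minor. The root \<open>i\<close> is read at \<open>s\<close> as a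
  row and at \<open>t\<close> as a column, and its diagonal entry \<open>k s t\<close> is the only
  one kept.\<close>

definition rooted_det :: "nat \<Rightarrow> nat set \<Rightarrow> 'x \<Rightarrow> 'x \<Rightarrow> (nat \<Rightarrow> 'x) \<Rightarrow> complex" where
  "rooted_det i J s t x = detS (insert i J)
     (\<lambda>l m. if l = m \<and> l \<noteq> i then 0 else k (if l = i then s else x l) (if m = i then t else x m))"

definition hollow_int :: "nat set \<Rightarrow> complex" where
  "hollow_int J = (\<integral>x. hollow_det J x \<partial>(Pi\<^sub>M J (\<lambda>_. M)))"

definition rooted_int :: "nat \<Rightarrow> nat set \<Rightarrow> 'x \<Rightarrow> 'x \<Rightarrow> complex" where
  "rooted_int i J s t = (\<integral>x. rooted_det i J s t x \<partial>(Pi\<^sub>M J (\<lambda>_. M)))"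

text \<open>The cofactor of column \<open>j\<close> in the root row is again rooted, now with row
  point \<open>x j\<close> and unchanged column point \<open>t\<close>; hence the expansion closes
  up into a recursion.\<close>

lemma rooted_det_expand:
  assumes J: "finite J" "i \<notin> J"
  shows "rooted_det i J s t x = k s t * hollow_det J x - (\<Sum>j\<in>J. k s (x j) * rooted_det i (J - {j}) (x j) t x)"
proof -
  let ?f = "\<lambda>l m. if l = m \<and> l \<noteq> i then 0 else k (if l = i then s else x l) (if m = i then t else x m)"
  have 1: "detS J ?f = hollow_det J x" unfolding hollow_det_def by (rule detS_cong) (use J in auto)
  have 2: "detS (insert i (J - {j})) (\<lambda>l m. ?f (if l = i then j else l) m) = rooted_det i (J - {j}) (x j) t x"
    if "j \<in> J" for j
    unfolding rooted_det_def
  proof (rule detS_cong)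
    fix l m assume "l \<in> insert i (J - {j})" "m \<in> insert i (J - {j})"
    thus "?f (if l = i then j else l) m =
       (if l = m \<and> l \<noteq> i then 0 else k (if l = i then x j else x l) (if m = i then t else x m))"
      using J that by (cases "l = i") auto
  qed
  have "rooted_det i J s t x = ?f i i * detS J ?f
    - (\<Sum>j\<in>J. ?f i j * detS (insert i (J - {j})) (\<lambda>l m. ?f (if l = i then j else l) m))"
    unfolding rooted_det_def by (rule detS_insert[OF J])
  also have "\<dots> = k s t * hollow_det J x - (\<Sum>j\<in>J. k s (x j) * rooted_det i (J - {j}) (x j) t x)"
    unfolding 1 using J by (intro arg_cong2[where f="(-)"] sum.cong refl, simp, subst 2) auto
  finally show ?thesis .
qed

text \<open>Putting \<open>s\<close> at index \<open>i\<close> gives the same matrix as the rooted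
  one at (s, s), except that the diagonal entry \<open>k s s\<close> is now 0. The two expansions
  along row \<open>i\<close> therefore differ by exactly that term.\<close>

lemma hollow_det_insert:
  assumes J: "finite J" "i \<notin> J"
  shows "hollow_det (insert i J) (x(i := s)) = rooted_det i J s s x - k s s * hollow_det J x"
proof -
  let ?x = "x(i := s)"
  let ?f = "\<lambda>l m. if l = m then 0 else k (?x l) (?x m)"
  have 1: "detS J ?f = hollow_det J x" unfolding hollow_det_def by (rule detS_cong) (use J in auto)
  have 2: "detS (insert i (J - {j})) (\<lambda>l m. ?f (if l = i then j else l) m) = rooted_det i (J - {j}) (x j) s x"
    if "j \<in> J" for j
    unfolding rooted_det_def
  proof (rule detS_cong)
    fix l m assume "l \<in> insert i (J - {j})" "m \<in> insert i (J - {j})"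
    thus "?f (if l = i then j else l) m =
       (if l = m \<and> l \<noteq> i then 0 else k (if l = i then x j else x l) (if m = i then s else x m))"
      using J that by (cases "l = i") auto
  qed
  have "hollow_det (insert i J) ?x = ?f i i * detS J ?f
    - (\<Sum>j\<in>J. ?f i j * detS (insert i (J - {j})) (\<lambda>l m. ?f (if l = i then j else l) m))"
    unfolding hollow_det_def by (rule detS_insert[OF J])
  also have "\<dots> = - (\<Sum>j\<in>J. k s (x j) * rooted_det i (J - {j}) (x j) s x)"
  proof -
    have "?f i j * detS (insert i (J - {j})) (\<lambda>l m. ?f (if l = i then j else l) m)
        = k s (x j) * rooted_det i (J - {j}) (x j) s x" if "j \<in> J" for j
      unfolding 2[OF that] using J that by auto
    thus ?thesis by simp
  qed
  finally show ?thesis using rooted_det_expand[OF J, of s s x] by simp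
qed

lemma rooted_det_cong:
  assumes "\<And>j. j \<in> J \<Longrightarrow> x j = y j"
  shows "rooted_det i J s t x = rooted_det i J s t y"
  unfolding rooted_det_def using assms by (intro detS_cong) auto

lemma k_const [measurable]: "k s \<in> borel_measurable M" "(\<lambda>s. k s t) \<in> borel_measurable M"
proof -
  have "(\<lambda>t. k s t) \<in> borel_measurable M"
    by (rule measurable_k) (auto simp: space_M)
  thus "k s \<in> borel_measurable M" .
  show "(\<lambda>s. k s t) \<in> borel_measurable M"
    by (rule measurable_k) (auto simp: space_M)
qed

lemma rooted_det_measurable:
  assumes "f \<in> N \<rightarrow>\<^sub>M M" "g \<in> N \<rightarrow>\<^sub>M M" "h \<in> N \<rightarrow>\<^sub>M Pi\<^sub>M J (\<lambda>_. M)"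
  shows "(\<lambda>w. rooted_det i J (f w) (g w) (h w)) \<in> borel_measurable N"
proof -
  have h: "(\<lambda>w. h w l) \<in> N \<rightarrow>\<^sub>M M" if "l \<in> J" for l
    using measurable_compose[OF assms(3) measurable_component_singleton[OF that]] .
  show ?thesis
    unfolding rooted_det_def
  proof (rule borel_measurable_detS)
    fix l m assume lm: "l \<in> insert i J" "m \<in> insert i J"
    have "(\<lambda>w. if l = i then f w else h w l) \<in> N \<rightarrow>\<^sub>M M" using assms(1) h lm by (cases "l = i") auto
    moreover have "(\<lambda>w. if m = i then g w else h w m) \<in> N \<rightarrow>\<^sub>M M" using assms(2) h lm by (cases "m = i") auto
    ultimately show "(\<lambda>w. if l = m \<and> l \<noteq> i then 0 else k (if l = i then f w else h w l) (if m = i then g w else h w m))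
        \<in> borel_measurable N"
      by (cases "l = m \<and> l \<noteq> i") (auto intro: measurable_k)
  qed
qed

lemma hollow_det_measurable: "hollow_det J \<in> borel_measurable (Pi\<^sub>M J (\<lambda>_. M))"
proof -
  have "(\<lambda>x. hollow_det J x) \<in> borel_measurable (Pi\<^sub>M J (\<lambda>_. M))"
    unfolding hollow_det_def
  proof (rule borel_measurable_detS)
    fix l m assume "l \<in> J" "m \<in> J"
    thus "(\<lambda>x. if l = m then 0 else k (x l) (x m)) \<in> borel_measurable (Pi\<^sub>M J (\<lambda>_. M))"
      by (cases "l = m") (auto intro!: measurable_k measurable_component_singleton)
  qed
  thus ?thesis .
qed

section \<open>Integrals over product spaces and their recursions\<close>

lemma const_PiM: 
  fixes J :: "nat set"
  assumes "finite J"
  shows "integrable (Pi\<^sub>M J (\<lambda>_. M)) (\<lambda>x. c::real)" 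
    "(\<integral>x. c \<partial>(Pi\<^sub>M J (\<lambda>_. M))) = c * measure M UNIV ^ card J"
proof -
  have 1: "integrable (Pi\<^sub>M J (\<lambda>_. M)) (\<lambda>x. \<Prod>i\<in>J. 1::real)"
    by (rule P.product_integrable_prod[OF assms]) simp
  thus "integrable (Pi\<^sub>M J (\<lambda>_. M)) (\<lambda>x. c::real)"
    using integrable_mult_right[of c _ "\<lambda>x. 1::real"] by simp
  have "(\<integral>x. (\<Prod>i\<in>J. (1::real)) \<partial>(Pi\<^sub>M J (\<lambda>_. M))) = (\<Prod>i\<in>J. integral\<^sup>L M (\<lambda>_. 1::real))"
    by (rule P.product_integral_prod[OF assms]) simp
  hence "(\<integral>x. (1::real) \<partial>(Pi\<^sub>M J (\<lambda>_. M))) = measure M UNIV ^ card J" by (simp add: space_M)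
  thus "(\<integral>x. c \<partial>(Pi\<^sub>M J (\<lambda>_. M))) = c * measure M UNIV ^ card J"
    using integral_mult_right_zero[of _ c "\<lambda>x. 1::real"] by simp
qed

lemma finite_measure_PiM: "finite J \<Longrightarrow> finite_measure (Pi\<^sub>M J (\<lambda>_::nat. M))"
  using const_PiM(1)[of J 1] by (auto intro!: finite_measureI simp: integrable_iff_bounded)

lemma hollow_det_le: "finite J \<Longrightarrow> cmod (hollow_det J x) \<le> fact (card J)"
  unfolding hollow_det_def by (rule norm_detS_le) (use k_le in auto)

lemma rooted_det_le: "finite J \<Longrightarrow> i \<notin> J \<Longrightarrow> cmod (rooted_det i J s t x) \<le> fact (Suc (card J))"
  unfolding rooted_det_def by (rule order_trans[OF norm_detS_le]) (use k_le in \<open>auto\<close>)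

lemma hollow_det_integrable: "finite J \<Longrightarrow> integrable (Pi\<^sub>M J (\<lambda>_. M)) (hollow_det J)"
  by (rule finite_measure.integrable_const_bound[OF finite_measure_PiM, where B="fact (card J)"])
     (auto simp: hollow_det_le hollow_det_measurable)

lemma integrable_bounded: 
  fixes f :: "'x \<Rightarrow> complex"
  assumes "f \<in> borel_measurable M" "\<And>x. cmod (f x) \<le> C"
  shows "integrable M f"
  using assms by (intro integrable_const_bound[where B=C]) auto

text \<open>One Fubini statement for two uses: \<open>f = k s\<close> with constant \<open>g\<close>
  gives a composition of kernels, \<open>f = 1\<close> with the identity for \<open>g\<close> gives
  a trace.\<close>

lemma rooted_det_swap:
  assumes J: "finite J" "i \<notin> J" and fM: "f \<in> borel_measurable M" "\<And>y. cmod (f y) \<le> 1" and g: "g \<in> M \<rightarrow>\<^sub>M M"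
  shows "(\<integral>x. (\<integral>y. f y * rooted_det i J y (g y) x \<partial>M) \<partial>(Pi\<^sub>M J (\<lambda>_. M)))
       = (\<integral>y. f y * rooted_int i J y (g y) \<partial>M)"
proof -
  interpret Q: finite_measure "Pi\<^sub>M J (\<lambda>_::nat. M)" by (rule finite_measure_PiM[OF J(1)])
  interpret PQ: pair_sigma_finite M "Pi\<^sub>M J (\<lambda>_::nat. M)" ..
  have fin: "finite_measure (M \<Otimes>\<^sub>M Pi\<^sub>M J (\<lambda>_::nat. M))"
    by (rule finite_measure_pair_measure) unfold_locales
  have m: "(\<lambda>w. f (fst w) * rooted_det i J (fst w) (g (fst w)) (snd w)) \<in> borel_measurable (M \<Otimes>\<^sub>M Pi\<^sub>M J (\<lambda>_::nat. M))"
    using fM(1) g by (intro borel_measurable_times rooted_det_measurable) (auto)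
  have "integrable (M \<Otimes>\<^sub>M Pi\<^sub>M J (\<lambda>_::nat. M)) (\<lambda>w. f (fst w) * rooted_det i J (fst w) (g (fst w)) (snd w))"
    by (rule finite_measure.integrable_const_bound[OF fin, where B="fact (Suc (card J))"])
       (use m norm_mult_le_of_le_1[OF fM(2) rooted_det_le[OF J]] in auto)
  hence "integrable (M \<Otimes>\<^sub>M Pi\<^sub>M J (\<lambda>_::nat. M)) (\<lambda>(y, x). f y * rooted_det i J y (g y) x)"
    by (simp add: case_prod_unfold)
  from PQ.Fubini_integral[OF this] show ?thesis by (simp add: rooted_int_def)
qed

lemma rooted_int_measurable:
  fixes J :: "nat set"
  assumes J: "finite J" and fg: "f \<in> N \<rightarrow>\<^sub>M M" "g \<in> N \<rightarrow>\<^sub>M M"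
  shows "(\<lambda>w. rooted_int i J (f w) (g w)) \<in> borel_measurable N"
proof -
  interpret Q: finite_measure "Pi\<^sub>M J (\<lambda>_::nat. M)" by (rule finite_measure_PiM[OF J])
  have "(\<lambda>w. rooted_det i J (f (fst w)) (g (fst w)) (snd w)) \<in> borel_measurable (N \<Otimes>\<^sub>M (Pi\<^sub>M J (\<lambda>_::nat. M)))"
    using fg by (intro rooted_det_measurable) auto
  thus ?thesis unfolding rooted_int_def
    by (intro Q.borel_measurable_lebesgue_integral) (simp add: case_prod_unfold)
qed

lemma norm_PiM_integral_le:
  fixes J :: "nat set"
  assumes "finite J" "\<And>x. cmod (f x) \<le> C"
  shows "cmod (\<integral>x. f x \<partial>(Pi\<^sub>M J (\<lambda>_. M))) \<le> C * measure M UNIV ^ card J"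
  using finite_measure.norm_integral_le_const[OF finite_measure_PiM[OF assms(1)] assms(2)]
    const_PiM(2)[OF assms(1), of 1] by simp

lemma rooted_int_le: "finite J \<Longrightarrow> i \<notin> J \<Longrightarrow> cmod (rooted_int i J s t) \<le> fact (Suc (card J)) * measure M UNIV ^ card J"
  unfolding rooted_int_def by (rule norm_PiM_integral_le[OF _ rooted_det_le])

text \<open>In the summand for \<open>j\<close>, the variable \<open>x j\<close> occurs only in
  \<open>k s (x j)\<close> and as row point of the smaller minor, so integrating it out composes
  \<open>k\<close> with that minor.\<close>

lemma rooted_int_rec:
  assumes J: "finite J" "i \<notin> J"
  shows "rooted_int i J s t = k s t * hollow_int J - (\<Sum>j\<in>J. \<integral>r. k s r * rooted_int i (J - {j}) r t \<partial>M)"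
proof -
  have each: "integrable (Pi\<^sub>M J (\<lambda>_. M)) (\<lambda>x. k s (x j) * rooted_det i (J - {j}) (x j) t x) \<and>
     (\<integral>x. k s (x j) * rooted_det i (J - {j}) (x j) t x \<partial>(Pi\<^sub>M J (\<lambda>_. M))) = (\<integral>r. k s r * rooted_int i (J - {j}) r t \<partial>M)"
    if j: "j \<in> J" for j
  proof -
    define K where "K = J - {j}"
    have K: "finite K" "j \<notin> K" "i \<notin> K" "i \<noteq> j" "insert j K = J" using J j by (auto simp: K_def)
    have comp: "(\<lambda>x. x j) \<in> Pi\<^sub>M J (\<lambda>_. M) \<rightarrow>\<^sub>M M" using j by (rule measurable_component_singleton)
    \<comment> \<open>The smaller minor reads \<open>x\<close> only on \<open>K\<close>; restricting
      the argument leaves its value unchanged and makes it measurable as a function on the product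
      over \<open>K\<close>.\<close>
    have "(\<lambda>x. restrict x K) \<in> Pi\<^sub>M J (\<lambda>_. M) \<rightarrow>\<^sub>M Pi\<^sub>M K (\<lambda>_. M)"
      by (rule measurable_restrict_subset) (auto simp: K_def)
    hence "(\<lambda>x. rooted_det i K (x j) t (restrict x K)) \<in> borel_measurable (Pi\<^sub>M J (\<lambda>_. M))"
      using comp space_M by (intro rooted_det_measurable) auto
    moreover have "rooted_det i K (x j) t (restrict x K) = rooted_det i K (x j) t x" for x by (rule rooted_det_cong) auto
    ultimately have m: "(\<lambda>x. k s (x j) * rooted_det i K (x j) t x) \<in> borel_measurable (Pi\<^sub>M J (\<lambda>_. M))"
      using measurable_compose[OF comp k_const(1)] by (intro borel_measurable_times) auto
    have int: "integrable (Pi\<^sub>M J (\<lambda>_. M)) (\<lambda>x. k s (x j) * rooted_det i K (x j) t x)"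
      by (rule finite_measure.integrable_const_bound[OF finite_measure_PiM, where B="fact (Suc (card K))"])
         (use J m norm_mult_le_of_le_1[OF k_le rooted_det_le[OF K(1,3)]] in auto)
    have "(\<integral>x. k s (x j) * rooted_det i K (x j) t x \<partial>(Pi\<^sub>M J (\<lambda>_. M))) =
       (\<integral>x. (\<integral>y. k s y * rooted_det i K y t (x(j := y)) \<partial>M) \<partial>(Pi\<^sub>M K (\<lambda>_. M)))"
      using P.product_integral_insert[OF K(1,2), unfolded K(5), OF int] by simp
    also have "\<dots> = (\<integral>x. (\<integral>y. k s y * rooted_det i K y t x \<partial>M) \<partial>(Pi\<^sub>M K (\<lambda>_. M)))"
      by (intro Bochner_Integration.integral_cong refl arg_cong2[where f="(*)"] rooted_det_cong) (use K in auto)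
    also have "\<dots> = (\<integral>r. k s r * rooted_int i K r t \<partial>M)"
      by (rule rooted_det_swap[OF K(1,3)]) (use k_le space_M in auto)
    finally show ?thesis using int by (simp add: K_def)
  qed
  have "rooted_int i J s t = (\<integral>x. k s t * hollow_det J x - (\<Sum>j\<in>J. k s (x j) * rooted_det i (J - {j}) (x j) t x) \<partial>(Pi\<^sub>M J (\<lambda>_. M)))"
    unfolding rooted_int_def rooted_det_expand[OF J] ..
  also have "\<dots> = k s t * hollow_int J - (\<Sum>j\<in>J. \<integral>r. k s r * rooted_int i (J - {j}) r t \<partial>M)"
    using each hollow_det_integrable[OF J(1)] by (simp add: hollow_int_def)
  finally show ?thesis .
qed

lemma hollow_int_rec:
  assumes J: "finite J" "i \<notin> J"
  shows "hollow_int (insert i J) = (\<integral>s. rooted_int i J s s - k s s * hollow_int J \<partial>M)"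
proof -
  interpret Q: finite_measure "Pi\<^sub>M J (\<lambda>_::nat. M)" by (rule finite_measure_PiM[OF J(1)])
  have Rint: "integrable M (\<lambda>y. rooted_det i J y y x)" if "x \<in> space (Pi\<^sub>M J (\<lambda>_. M))" for x
    by (rule integrable_bounded[OF rooted_det_measurable rooted_det_le[OF J]]) (use that in auto)
  have kint: "integrable M (\<lambda>y. k y y)" by (rule integrable_bounded[OF _ k_le]) simp
  have "hollow_int (insert i J) = (\<integral>x. (\<integral>s. rooted_det i J s s x - k s s * hollow_det J x \<partial>M) \<partial>(Pi\<^sub>M J (\<lambda>_. M)))"
    unfolding hollow_int_def using P.product_integral_insert[OF J hollow_det_integrable] J hollow_det_insert by simp
  also have "\<dots> = (\<integral>x. (\<integral>s. rooted_det i J s s x \<partial>M) - (\<integral>s. k s s \<partial>M) * hollow_det J x \<partial>(Pi\<^sub>M J (\<lambda>_. M)))"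
    by (intro Bochner_Integration.integral_cong refl) (simp add: Rint kint)
  also have "\<dots> = (\<integral>x. (\<integral>s. rooted_det i J s s x \<partial>M) \<partial>(Pi\<^sub>M J (\<lambda>_. M))) - (\<integral>s. k s s \<partial>M) * hollow_int J"
  proof -
    have m: "(\<lambda>w. rooted_det i J (snd w) (snd w) (fst w)) \<in> borel_measurable (Pi\<^sub>M J (\<lambda>_::nat. M) \<Otimes>\<^sub>M M)"
      by (intro rooted_det_measurable) auto
    have "(\<lambda>x. \<integral>s. rooted_det i J s s x \<partial>M) \<in> borel_measurable (Pi\<^sub>M J (\<lambda>_. M))"
      by (rule borel_measurable_lebesgue_integral) (use m in \<open>simp add: case_prod_unfold\<close>)
    moreover have "cmod (\<integral>s. rooted_det i J s s x \<partial>M) \<le> fact (Suc (card J)) * measure M UNIV" for x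
      using norm_integral_le_const[OF rooted_det_le[OF J]] by (simp add: space_M)
    ultimately have "integrable (Pi\<^sub>M J (\<lambda>_. M)) (\<lambda>x. \<integral>s. rooted_det i J s s x \<partial>M)"
      by (intro Q.integrable_const_bound) auto
    thus ?thesis using hollow_det_integrable[OF J(1)] by (simp add: hollow_int_def)
  qed
  also have "(\<integral>x. (\<integral>s. rooted_det i J s s x \<partial>M) \<partial>(Pi\<^sub>M J (\<lambda>_. M))) = (\<integral>s. rooted_int i J s s \<partial>M)"
    using rooted_det_swap[OF J, of "\<lambda>_. 1" "\<lambda>y. y"] by simp
  also have "(\<integral>s. rooted_int i J s s \<partial>M) - (\<integral>s. k s s \<partial>M) * hollow_int J = (\<integral>s. rooted_int i J s s - k s s * hollow_int J \<partial>M)"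
  proof -
    have "integrable M (\<lambda>s. rooted_int i J s s)"
      by (rule integrable_bounded[OF rooted_int_measurable rooted_int_le[OF J]]) (use J in auto)
    thus ?thesis using kint by simp
  qed
  finally show ?thesis .
qed


text \<open>The names of integration variables do not matter. Both recursions involve only smaller
  index sets, so induction on the cardinality shows this without transporting product measures along
  a bijection.\<close>

lemma rooted_hollow_int_card:
  assumes "finite J" "finite J'" "card J = n" "card J' = n" "i \<notin> J" "i' \<notin> J'"
  shows "hollow_int J = hollow_int J' \<and> rooted_int i J = rooted_int i' J'"
  using assms
proof (induction n arbitrary: J J' i i')
  case 0
  hence [simp]: "J = {}" "J' = {}" by auto
  have "rooted_int i {} = rooted_int i' {}" 
    using rooted_int_rec[of "{}" i] rooted_int_rec[of "{}" i'] by (intro ext) simp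
  thus ?case by simp
next
  case (Suc n)
  obtain j K where K: "J = insert j K" "j \<notin> K" "card K = n" "finite K"
    using Suc.prems(1,3) by (metis card_Suc_eq_finite)
  obtain j' K' where K': "J' = insert j' K'" "j' \<notin> K'" "card K' = n" "finite K'"
    using Suc.prems(2,4) by (metis card_Suc_eq_finite)
  have IH: "hollow_int K = hollow_int K'" "rooted_int j K = rooted_int j' K'" using Suc.IH[of K K' j j'] K K' by auto
  have hollow_int: "hollow_int J = hollow_int J'" unfolding K(1) K'(1) hollow_int_rec[OF K(4,2)] hollow_int_rec[OF K'(4,2)] IH ..
  have "rooted_int i J s t = rooted_int i' J' s t" for s t
  proof -
    have 1: "rooted_int i (J - {l}) = rooted_int i K" if "l \<in> J" for l
      using Suc.IH[of "J - {l}" K i i] that Suc.prems K by auto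
    have 2: "rooted_int i' (J' - {l}) = rooted_int i K" if "l \<in> J'" for l
      using Suc.IH[of "J' - {l}" K i' i] that Suc.prems K by auto
    show ?thesis
      using Suc.prems by (simp add: rooted_int_rec 1 2 hollow_int)
  qed
  thus ?case using hollow_int by blast
qed

section \<open>Coefficients of the determinant and of the first minor\<close>

definition det_coeff :: "nat \<Rightarrow> complex" where
  "det_coeff n = hollow_int {..<n} / fact n"

definition minor_coeff :: "nat \<Rightarrow> 'x \<Rightarrow> 'x \<Rightarrow> complex" where
  "minor_coeff n s t = rooted_int n {..<n} s t / fact n"

text \<open>Hadamard's bound for a minor of size n + 1, times the mass of the n-fold product, over
  n!. The determinants of size n obey it as well, so one majorant serves both series.\<close>

definition coeff_bound :: "nat \<Rightarrow> real" where
  "coeff_bound n = measure M UNIV ^ n * sqrt (real (Suc n) ^ Suc n) / fact n"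

lemma det_coeff_0: "det_coeff 0 = 1"
proof -
  have "hollow_det {} = (\<lambda>x. 1)" unfolding hollow_det_def by (auto simp: detS_def)
  moreover have "(\<integral>x. (1::complex) \<partial>(Pi\<^sub>M {} (\<lambda>_::nat. M))) = 1"
    by (simp add: PiM_empty)
  ultimately show ?thesis unfolding det_coeff_def hollow_int_def by simp
qed

lemma minor_coeff_0: "minor_coeff 0 s t = k s t"
  using rooted_int_rec[of "{}" 0 s t] det_coeff_0 by (simp add: minor_coeff_def det_coeff_def)

text \<open>In this statement \<open>minor_series\<close> is a variable and stands for an arbitrary
  source measure.\<close>

lemma minor_coeff_measurable:
  "f \<in> minor_series \<rightarrow>\<^sub>M M \<Longrightarrow> g \<in> minor_series \<rightarrow>\<^sub>M M \<Longrightarrow> (\<lambda>w. minor_coeff n (f w) (g w)) \<in> borel_measurable minor_series"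
  unfolding minor_coeff_def by (intro borel_measurable_divide rooted_int_measurable) auto

lemma cmod_minor_coeff_le: "cmod (minor_coeff n s t) \<le> coeff_bound n"
proof -
  have "cmod (rooted_det n {..<n} s t x) \<le> sqrt (real (Suc n) ^ Suc n)" for x
    unfolding rooted_det_def lessThan_Suc[symmetric] detS_lessThan
    by (rule hadamard_detn) (simp add: k_le)
  from norm_PiM_integral_le[OF _ this, of "{..<n}"]
  show ?thesis unfolding minor_coeff_def rooted_int_def coeff_bound_def by (simp add: norm_divide divide_right_mono mult.commute)
qed

lemma cmod_det_coeff_le: "cmod (det_coeff n) \<le> coeff_bound n"
proof -
  have "real n ^ n \<le> real (Suc n) ^ n" by (intro power_mono) auto
  also have "\<dots> \<le> real (Suc n) ^ Suc n" by (intro power_increasing) auto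
  finally have le: "sqrt (real n ^ n) \<le> sqrt (real (Suc n) ^ Suc n)" by simp
  have "cmod (hollow_det {..<n} x) \<le> sqrt (real n ^ n)" for x
    unfolding hollow_det_def detS_lessThan
    by (rule hadamard_detn) (simp add: k_le)
  from norm_PiM_integral_le[OF _ order_trans[OF this le], of "{..<n}"]
  show ?thesis unfolding det_coeff_def hollow_int_def coeff_bound_def by (simp add: norm_divide divide_right_mono mult.commute)
qed

lemma coeff_bound_nonneg: "coeff_bound n \<ge> 0"
  by (simp add: coeff_bound_def)

text \<open>The factor 2^n leaves room for weights as large as the binomial coefficients n choose
  j.\<close>

lemma summable_coeff_bound: "summable (\<lambda>n. 2 ^ n * coeff_bound n)"
proof -
  define m where "m = measure M UNIV"
  define x where "x n = exp 1 * ((32 * m\<^sup>2 * exp 1) ^ n / fact n)" for n :: nat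
  have x0: "x n \<ge> 0" for n by (simp add: x_def)
  \<comment> \<open>Squaring removes the root in Hadamard's bound: the square is at most x n *
    (1/4)^n, and a product of nonnegative numbers is at most the square of their sum. The 32 in
    \<open>x\<close> is 4 * 2 * 4: from squaring 2^n, from n + 1 <= 2^n, and to make up for the
    factor 1/4 split off.\<close>
  have le: "2 ^ n * coeff_bound n \<le> x n + (1/4) ^ n" for n
  proof (rule power2_le_imp_le)
    \<comment> \<open>N^N / N! is a single term of the exponential series at N = n + 1, hence at
      most exp N; this takes the place of Stirling's formula.\<close>
    have "(\<Sum>k\<in>{Suc n}. real (Suc n) ^ k /\<^sub>R fact k) \<le> exp (real (Suc n))"
      unfolding exp_def by (rule sum_le_suminf[OF summable_exp_generic]) auto
    hence "real (Suc n) ^ Suc n \<le> exp (real (Suc n)) * fact (Suc n)"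
      by (simp add: field_simps del: fact_Suc power_Suc of_nat_Suc)
    also have "exp (real (Suc n)) = exp 1 * exp 1 ^ n" by (simp flip: exp_of_nat_mult exp_add)
    also have "fact (Suc n) \<le> (2 ^ n * fact n :: real)"
      using of_nat_mono[OF suc_le_pow_2, where 'a=real, of n] by (simp add: mult_right_mono)
    finally have det_series: "real (Suc n) ^ Suc n \<le> exp 1 * exp 1 ^ n * (2 ^ n * fact n)" by (simp add: mult_left_mono)
    define X where "X = real (Suc n) ^ Suc n"
    define S where "S = sqrt X"
    have S: "S * S = X" unfolding S_def X_def by simp
    have cbS: "coeff_bound n = m ^ n * S / fact n" by (simp only: coeff_bound_def m_def S_def X_def)
    have "(2 ^ n * coeff_bound n)\<^sup>2 = (2 ^ n * 2 ^ n) * (m ^ n * m ^ n) * X / (fact n * fact n)"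
      by (simp add: power2_eq_square cbS S[symmetric])
    also have "\<dots> = 4 ^ n * m ^ (2 * n) * X / (fact n * fact n)"
      by (simp only: power_mult power_mult_distrib[symmetric] power2_eq_square, simp)
    also have "\<dots> \<le> 4 ^ n * m ^ (2 * n) * (exp 1 * exp 1 ^ n * (2 ^ n * fact n)) / (fact n * fact n)"
      unfolding X_def by (intro divide_right_mono mult_left_mono det_series) (auto simp: m_def)
    also have "\<dots> = exp 1 * (4 ^ n * m ^ (2 * n) * exp 1 ^ n * 2 ^ n) / fact n"
      by simp
    also have "4 ^ n * m ^ (2 * n) * exp 1 ^ n * 2 ^ n = (32 * m\<^sup>2 * exp 1) ^ n * (1/4) ^ n"
      by (simp only: power_mult power_mult_distrib[symmetric], simp add: mult_ac)
    also have "exp 1 * ((32 * m\<^sup>2 * exp 1) ^ n * (1/4) ^ n) / fact n = x n * (1/4) ^ n"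
      by (simp add: x_def)
    also have "\<dots> \<le> (x n + (1/4) ^ n)\<^sup>2"
      using x0[of n] by (simp add: power2_sum)
    finally show "(2 ^ n * coeff_bound n)\<^sup>2 \<le> (x n + (1/4) ^ n)\<^sup>2" .
    show "0 \<le> x n + (1/4) ^ n" using x0 by simp
  qed
  have "summable x"
    unfolding x_def using summable_exp by (intro summable_mult) (simp add: divide_inverse mult.commute)
  hence "summable (\<lambda>n. x n + (1/4) ^ n)" by (intro summable_add summable_geometric) auto
  thus ?thesis
    by (rule summable_comparison_test'[where N=0]) (use le coeff_bound_nonneg in auto)
qed

text \<open>By invariance under renaming the n + 1 summands of \<open>rooted_int_rec\<close>
  coincide, and their number cancels against (n + 1)!.\<close>

lemma minor_coeff_Suc: "minor_coeff (Suc n) s t = det_coeff (Suc n) * k s t - (\<integral>r. k s r * minor_coeff n r t \<partial>M)"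
proof -
  have "rooted_int (Suc n) ({..<Suc n} - {j}) = rooted_int n {..<n}" if "j < Suc n" for j
    using rooted_hollow_int_card[of "{..<Suc n} - {j}" "{..<n}" n "Suc n" n] that by auto
  hence "rooted_int (Suc n) {..<Suc n} s t = k s t * hollow_int {..<Suc n} - of_nat (Suc n) * (\<integral>r. k s r * rooted_int n {..<n} r t \<partial>M)"
    using rooted_int_rec[of "{..<Suc n}" "Suc n" s t] by simp
  moreover have "(\<integral>r. k s r * minor_coeff n r t \<partial>M) = (\<integral>r. k s r * rooted_int n {..<n} r t \<partial>M) / fact n"
    by (simp add: minor_coeff_def)
  ultimately show ?thesis
    unfolding minor_coeff_def det_coeff_def fact_Suc by (simp add: field_simps del: of_nat_Suc)
qed

text \<open>Coefficientwise form of D'(z) = tr (N(z) - D(z) k), where N(z) is the generating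
  function of the minors. The correction by \<open>k\<close> is the trace of the omitted
  diagonal.\<close>

lemma det_coeff_Suc: "of_nat (Suc n) * det_coeff (Suc n) = (\<integral>s. minor_coeff n s s - k s s * det_coeff n \<partial>M)"
proof -
  have "det_coeff (Suc n) * of_nat (Suc n) * fact n = hollow_int (insert n {..<n})"
    unfolding det_coeff_def fact_Suc lessThan_Suc by (simp add: field_simps del: of_nat_Suc)
  also have "\<dots> = (\<integral>s. rooted_int n {..<n} s s - k s s * hollow_int {..<n} \<partial>M)" by (rule hollow_int_rec) auto
  also have "\<dots> = (\<integral>s. fact n * (minor_coeff n s s - k s s * det_coeff n) \<partial>M)"
    by (intro Bochner_Integration.integral_cong) (auto simp: minor_coeff_def det_coeff_def field_simps)
  finally show ?thesis by (simp add: mult.commute del: of_nat_Suc)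
qed

lemma k_minor_coeff_integrable: "integrable M (\<lambda>r. k s r * minor_coeff n r t)"
  by (rule integrable_bounded[where C="coeff_bound n"])
     (auto intro!: borel_measurable_times k_const minor_coeff_measurable norm_mult_le_of_le_1 k_le cmod_minor_coeff_le simp: space_M)

text \<open>By \<open>minor_coeff_Suc\<close> every minor coefficient is a polynomial in
  \<open>k\<close> under composition of kernels, hence commutes with \<open>k\<close>; the induction
  step is associativity of composition, that is, Fubini.\<close>

lemma minor_coeff_comm: "(\<integral>r. k s r * minor_coeff n r t \<partial>M) = (\<integral>r. minor_coeff n s r * k r t \<partial>M)"
proof (induction n arbitrary: s t)
  case 0
  show ?case by (simp add: minor_coeff_0)
next
  case (Suc n)
  interpret MM: pair_sigma_finite M M ..
  have kk: "integrable M (\<lambda>r. k s r * k r t)"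
    using k_minor_coeff_integrable[of s 0 t] by (simp add: minor_coeff_0)
  have fin: "finite_measure (M \<Otimes>\<^sub>M M)" by (rule finite_measure_pair_measure) unfold_locales
  have m: "(\<lambda>w. k s (fst w) * (minor_coeff n (fst w) (snd w) * k (snd w) t)) \<in> borel_measurable (M \<Otimes>\<^sub>M M)"
    by (intro borel_measurable_times measurable_k minor_coeff_measurable) (auto simp: space_M)
  have le: "cmod (k s q * (minor_coeff n q r * k r t)) \<le> coeff_bound n" for q r
    using norm_mult_le_of_le_1[OF k_le[of s q] norm_mult_le_of_le_1[OF k_le[of r t] cmod_minor_coeff_le[of n q r]]]
    by (simp add: ac_simps)
  have int: "integrable (M \<Otimes>\<^sub>M M) (\<lambda>(q, r). k s q * (minor_coeff n q r * k r t))"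
    by (rule finite_measure.integrable_const_bound[OF fin, where B="coeff_bound n"])
       (use m le in \<open>auto simp: case_prod_unfold\<close>)
  have in1: "integrable M (\<lambda>q. k s q * (\<integral>r. minor_coeff n q r * k r t \<partial>M))"
    using MM.integrable_fst[OF int] by simp
  have in2: "integrable M (\<lambda>r. (\<integral>q. k s q * minor_coeff n q r \<partial>M) * k r t)"
    using MM.integrable_snd[OF int] by (simp add: mult.assoc[symmetric])
  have "(\<integral>r. k s r * minor_coeff (Suc n) r t \<partial>M) = (\<integral>r. det_coeff (Suc n) * (k s r * k r t) - k s r * (\<integral>q. minor_coeff n r q * k q t \<partial>M) \<partial>M)"
    unfolding minor_coeff_Suc Suc by (simp add: algebra_simps)
  also have "\<dots> = det_coeff (Suc n) * (\<integral>r. k s r * k r t \<partial>M) - (\<integral>q. k s q * (\<integral>r. minor_coeff n q r * k r t \<partial>M) \<partial>M)"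
    using kk in1 by simp
  also have "(\<integral>q. k s q * (\<integral>r. minor_coeff n q r * k r t \<partial>M) \<partial>M) = (\<integral>q. (\<integral>r. k s q * (minor_coeff n q r * k r t) \<partial>M) \<partial>M)"
    by simp
  also have "\<dots> = (\<integral>r. (\<integral>q. k s q * (minor_coeff n q r * k r t) \<partial>M) \<partial>M)"
    by (rule MM.Fubini_integral[OF int, symmetric])
  also have "\<dots> = (\<integral>r. (\<integral>q. k s q * minor_coeff n q r \<partial>M) * k r t \<partial>M)"
    by (simp add: mult.assoc[symmetric])
  also have "det_coeff (Suc n) * (\<integral>r. k s r * k r t \<partial>M) - (\<integral>r. (\<integral>q. k s q * minor_coeff n q r \<partial>M) * k r t \<partial>M)
      = (\<integral>r. det_coeff (Suc n) * (k s r * k r t) - (\<integral>q. k s q * minor_coeff n q r \<partial>M) * k r t \<partial>M)"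
    using kk in2 by simp
  also have "\<dots> = (\<integral>r. minor_coeff (Suc n) s r * k r t \<partial>M)"
    unfolding minor_coeff_Suc by (simp add: algebra_simps)
  finally show ?case .
qed

section \<open>Coefficient series with weights\<close>

definition minor_series :: "(nat \<Rightarrow> real) \<Rightarrow> 'x \<Rightarrow> 'x \<Rightarrow> complex" where
  "minor_series c s t = (\<Sum>n. of_real (c n) * minor_coeff n s t)"

definition det_series :: "(nat \<Rightarrow> real) \<Rightarrow> complex" where
  "det_series c = (\<Sum>n. of_real (c n) * det_coeff n)"

text \<open>The largest growth that \<open>summable_coeff_bound\<close> absorbs; binomial weights
  satisfy it.\<close>

definition admissible :: "(nat \<Rightarrow> real) \<Rightarrow> bool" where
  "admissible c \<longleftrightarrow> (\<exists>C. \<forall>n. \<bar>c n\<bar> \<le> C * 2 ^ n)"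

lemma summable_admissible:
  assumes "admissible c"
  shows "summable (\<lambda>n. \<bar>c n\<bar> * coeff_bound n)"
proof -
  obtain C where C: "\<And>n. \<bar>c n\<bar> \<le> C * 2 ^ n" using assms unfolding admissible_def by blast
  have "summable (\<lambda>n. C * (2 ^ n * coeff_bound n))" by (rule summable_mult[OF summable_coeff_bound])
  thus ?thesis
    by (rule summable_comparison_test'[where N=0])
       (use C coeff_bound_nonneg in \<open>auto simp: abs_mult mult.assoc[symmetric] intro!: mult_right_mono\<close>)
qed

lemma norm_coeff_le: "cmod (of_real (c n) * minor_coeff n s t) \<le> \<bar>c n\<bar> * coeff_bound n"
  "cmod (of_real (c n) * det_coeff n) \<le> \<bar>c n\<bar> * coeff_bound n"
  by (auto simp: norm_mult intro!: mult_left_mono cmod_minor_coeff_le cmod_det_coeff_le)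

lemma summable_minor_coeff: "admissible c \<Longrightarrow> summable (\<lambda>n. cmod (of_real (c n) * minor_coeff n s t))"
  by (rule summable_comparison_test'[OF summable_admissible, where N=0]) (use norm_coeff_le in auto)

lemma summable_det_coeff: "admissible c \<Longrightarrow> summable (\<lambda>n. cmod (of_real (c n) * det_coeff n))"
  by (rule summable_comparison_test'[OF summable_admissible, where N=0]) (use norm_coeff_le in auto)

lemma minor_series_le: "admissible c \<Longrightarrow> cmod (minor_series c s t) \<le> (\<Sum>n. \<bar>c n\<bar> * coeff_bound n)"
  unfolding minor_series_def
  by (rule order_trans[OF summable_norm[OF summable_minor_coeff] suminf_le[OF norm_coeff_le(1) summable_minor_coeff summable_admissible]])

lemma minor_series_measurable:
  "f \<in> S \<rightarrow>\<^sub>M M \<Longrightarrow> g \<in> S \<rightarrow>\<^sub>M M \<Longrightarrow> (\<lambda>w. minor_series c (f w) (g w)) \<in> borel_measurable S"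
  unfolding minor_series_def by (intro borel_measurable_suminf borel_measurable_times minor_coeff_measurable) auto

text \<open>Termwise integration in a form that covers composition with \<open>k\<close> from the
  left, composition from the right, and the trace, by different choices of \<open>f\<close>,
  \<open>g\<close> and \<open>h\<close>.\<close>

lemma integral_suminf_admissible:
  assumes c: "admissible c" and f: "f \<in> borel_measurable M" "\<And>r. cmod (f r) \<le> 1"
    and g: "g \<in> M \<rightarrow>\<^sub>M M" "h \<in> M \<rightarrow>\<^sub>M M"
  shows "(\<integral>r. f r * minor_series c (g r) (h r) \<partial>M) = (\<Sum>n. of_real (c n) * (\<integral>r. f r * minor_coeff n (g r) (h r) \<partial>M))"
    and "summable (\<lambda>n. of_real (c n) * (\<integral>r. f r * minor_coeff n (g r) (h r) \<partial>M))"
proof -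
  let ?F = "\<lambda>n r. f r * (of_real (c n) * minor_coeff n (g r) (h r))"
  have le: "cmod (?F n r) \<le> \<bar>c n\<bar> * coeff_bound n" for n r
    by (rule norm_mult_le_of_le_1[OF f(2) norm_coeff_le(1)])
  have int: "integrable M (?F n)" for n
    by (rule integrable_bounded[OF _ le]) (intro borel_measurable_times f minor_coeff_measurable g borel_measurable_const)
  have sm: "summable (\<lambda>n. cmod (?F n r))" for r
    by (rule summable_comparison_test'[OF summable_admissible[OF c], where N=0]) (use le in auto)
  have sm2: "summable (\<lambda>n. \<integral>r. cmod (?F n r) \<partial>M)"
  proof (rule summable_comparison_test'[OF summable_mult2[OF summable_admissible[OF c]], where N=0])
    fix n
    have "(\<integral>r. cmod (?F n r) \<partial>M) \<le> (\<integral>r. \<bar>c n\<bar> * coeff_bound n \<partial>M)"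
      using int le by (intro integral_mono) auto
    thus "norm (\<integral>r. cmod (?F n r) \<partial>M) \<le> \<bar>c n\<bar> * coeff_bound n * measure M UNIV"
      by (simp add: space_M mult.commute)
  qed
  have eq: "integral\<^sup>L M (?F n) = of_real (c n) * (\<integral>r. f r * minor_coeff n (g r) (h r) \<partial>M)" for n
    by (subst integral_mult_right_zero[symmetric]) (simp add: mult.left_commute)
  have "(\<integral>r. f r * minor_series c (g r) (h r) \<partial>M) = (\<integral>r. (\<Sum>n. ?F n r) \<partial>M)"
    unfolding minor_series_def using summable_norm_cancel[OF summable_minor_coeff[OF c]]
    by (subst suminf_mult) auto
  also have "\<dots> = (\<Sum>n. integral\<^sup>L M (?F n))"
    by (rule integral_suminf[OF int]) (use sm sm2 in auto)
  finally show "(\<integral>r. f r * minor_series c (g r) (h r) \<partial>M) = (\<Sum>n. of_real (c n) * (\<integral>r. f r * minor_coeff n (g r) (h r) \<partial>M))"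
    unfolding eq .
  have "summable (\<lambda>n. cmod (integral\<^sup>L M (?F n)))"
    by (rule summable_comparison_test'[OF sm2, where N=0]) simp
  thus "summable (\<lambda>n. of_real (c n) * (\<integral>r. f r * minor_coeff n (g r) (h r) \<partial>M))"
    unfolding eq by (rule summable_norm_cancel)
qed

text \<open>Sums \<open>minor_coeff_Suc\<close> against the weights. The coefficient of index n
  enters the equation for index n + 1, hence the shifted weights under the integral; the term n = 0
  fits because the first minor coefficient is \<open>k\<close> and \<open>det_coeff 0 = 1\<close>.
  The second form uses that the coefficients commute with \<open>k\<close>.\<close>

lemma minor_series_expand:
  assumes c: "admissible c"
  shows "minor_series c s t = det_series c * k s t - (\<integral>r. k s r * minor_series (\<lambda>n. c (Suc n)) r t \<partial>M)"
    and "minor_series c s t = det_series c * k s t - (\<integral>r. minor_series (\<lambda>n. c (Suc n)) s r * k r t \<partial>M)"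
proof -
  obtain C where C: "\<And>n. \<bar>c n\<bar> \<le> C * 2 ^ n" using c unfolding admissible_def by blast
  have c': "admissible (\<lambda>n. c (Suc n))"
    unfolding admissible_def using C[of "Suc _"] by (intro exI[of _ "2 * C"]) (simp add: ac_simps)
  let ?I = "\<lambda>n. \<integral>r. k s r * minor_coeff n r t \<partial>M"
  note I = integral_suminf_admissible[OF c' k_const(1) k_le, of "\<lambda>r. r" "\<lambda>_. t"]
  have sI: "summable (\<lambda>n. of_real (c (Suc n)) * ?I n)" using I(2) by (simp add: space_M)
  have sa: "summable (\<lambda>n. of_real (c n) * det_coeff n)" by (rule summable_norm_cancel[OF summable_det_coeff[OF c]])
  have sb: "summable (\<lambda>n. of_real (c n) * minor_coeff n s t)" by (rule summable_norm_cancel[OF summable_minor_coeff[OF c]])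
  have sa': "summable (\<lambda>n. of_real (c (Suc n)) * det_coeff (Suc n))" using sa by (subst summable_Suc_iff)
  have "minor_series c s t = of_real (c 0) * k s t + (\<Sum>n. of_real (c (Suc n)) * minor_coeff (Suc n) s t)"
    unfolding minor_series_def using suminf_split_head[OF sb] by (simp add: minor_coeff_0)
  also have "(\<Sum>n. of_real (c (Suc n)) * minor_coeff (Suc n) s t) =
      (\<Sum>n. of_real (c (Suc n)) * det_coeff (Suc n) * k s t - of_real (c (Suc n)) * ?I n)"
    by (simp add: minor_coeff_Suc algebra_simps)
  also have "\<dots> = (\<Sum>n. of_real (c (Suc n)) * det_coeff (Suc n)) * k s t - (\<Sum>n. of_real (c (Suc n)) * ?I n)"
    by (subst suminf_diff[symmetric]) (auto intro!: summable_mult2 sa' sI simp: suminf_mult2[OF sa'])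
  also have "(\<Sum>n. of_real (c (Suc n)) * det_coeff (Suc n)) = det_series c - of_real (c 0)"
    unfolding det_series_def using suminf_split_head[OF sa] by (simp add: det_coeff_0)
  finally have *: "minor_series c s t = det_series c * k s t - (\<Sum>n. of_real (c (Suc n)) * ?I n)" by (simp add: algebra_simps)
  thus "minor_series c s t = det_series c * k s t - (\<integral>r. k s r * minor_series (\<lambda>n. c (Suc n)) r t \<partial>M)"
    using I(1) by (simp add: space_M)
  have "(\<integral>r. k r t * minor_series (\<lambda>n. c (Suc n)) s r \<partial>M) = (\<Sum>n. of_real (c (Suc n)) * (\<integral>r. k r t * minor_coeff n s r \<partial>M))"
    by (rule integral_suminf_admissible(1)[OF c' k_const(2) k_le]) (auto simp: space_M)
  thus "minor_series c s t = det_series c * k s t - (\<integral>r. minor_series (\<lambda>n. c (Suc n)) s r * k r t \<partial>M)"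
    using * by (simp add: minor_coeff_comm mult.commute)
qed

lemma det_series_shift:
  assumes c: "admissible c"
  shows "(\<Sum>n. of_real (c n) * (of_nat (Suc n) * det_coeff (Suc n))) = (\<integral>s. minor_series c s s - k s s * det_series c \<partial>M)"
proof -
  let ?I = "\<lambda>n. \<integral>s. minor_coeff n s s \<partial>M"
  note I = integral_suminf_admissible[OF c, of "\<lambda>_. 1" "\<lambda>r. r" "\<lambda>r. r", simplified]
  have sa: "summable (\<lambda>n. of_real (c n) * det_coeff n)" by (rule summable_norm_cancel[OF summable_det_coeff[OF c]])
  have kint: "integrable M (\<lambda>y. k y y)" by (rule integrable_bounded[OF _ k_le]) (auto intro: measurable_k)
  have bint: "integrable M (\<lambda>y. minor_coeff n y y)" for n
    by (rule integrable_bounded[OF _ cmod_minor_coeff_le]) (auto intro: minor_coeff_measurable)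
  have Nint: "integrable M (\<lambda>y. minor_series c y y)"
    by (rule integrable_bounded[OF _ minor_series_le[OF c]]) (auto intro: minor_series_measurable)
  have "(\<Sum>n. of_real (c n) * (of_nat (Suc n) * det_coeff (Suc n))) = 
     (\<Sum>n. of_real (c n) * ?I n - of_real (c n) * det_coeff n * (\<integral>s. k s s \<partial>M))"
    unfolding det_coeff_Suc using kint bint by (simp add: algebra_simps)
  also have "\<dots> = (\<Sum>n. of_real (c n) * ?I n) - (\<Sum>n. of_real (c n) * det_coeff n) * (\<integral>s. k s s \<partial>M)"
    by (subst suminf_diff[symmetric]) (auto intro!: summable_mult2 sa I simp: suminf_mult2[OF sa])
  also have "\<dots> = (\<integral>s. minor_series c s s - k s s * det_series c \<partial>M)"
    using I(1) kint Nint by (simp add: det_series_def)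
  finally show ?thesis .
qed

lemma admissible_choose: "admissible (\<lambda>n. real (n choose j))"
  unfolding admissible_def
  by (rule exI[of _ 1]) (metis abs_of_nat binomial_le_pow2 mult_1 of_nat_le_iff of_nat_numeral of_nat_power)

text \<open>The \<open>j\<close>-th Taylor coefficients at \<open>z = 1\<close> of \<open>D(z) = (\<Sum>n. det_coeff n * z ^ n)\<close> and of the first minor.\<close>

definition det_taylor :: "nat \<Rightarrow> complex" where "det_taylor j = det_series (\<lambda>n. real (n choose j))"
definition minor_taylor :: "nat \<Rightarrow> 'x \<Rightarrow> 'x \<Rightarrow> complex" where "minor_taylor j = minor_series (\<lambda>n. real (n choose j))"

lemma minor_taylor_0: "minor_taylor 0 s t = det_taylor 0 * k s t - (\<integral>r. k s r * minor_taylor 0 r t \<partial>M)"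
proof -
  have "(\<lambda>n. real (Suc n choose 0)) = (\<lambda>n. real (n choose 0))" by simp
  note e = this
  show ?thesis using minor_series_expand(1)[OF admissible_choose[of 0], of s t]
    unfolding e det_taylor_def[symmetric] minor_taylor_def[symmetric] .
qed

text \<open>Taylor coefficients at z = 1 of N(z) = D(z) k - z k N(z). The factor z adds the
  preceding coefficient; in terms of weights this is Pascal's rule.\<close>

lemma minor_taylor_Suc: "minor_taylor (Suc j) s t = det_taylor (Suc j) * k s t - (\<integral>r. k s r * (minor_taylor j r t + minor_taylor (Suc j) r t) \<partial>M)"
proof -
  have "minor_series (\<lambda>n. real (Suc n choose Suc j)) r t = minor_taylor j r t + minor_taylor (Suc j) r t" for r
    unfolding minor_taylor_def minor_series_def
    using suminf_add[OF summable_norm_cancel[OF summable_minor_coeff[OF admissible_choose]] summable_norm_cancel[OF summable_minor_coeff[OF admissible_choose]]]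
    by (simp add: algebra_simps)
  note e = this
  show ?thesis using minor_series_expand(1)[OF admissible_choose[of "Suc j"], of s t]
    unfolding e det_taylor_def[symmetric] minor_taylor_def[symmetric] .
qed

text \<open>Taylor coefficients of D'(z) = tr (N(z) - D(z) k); differentiation appears as the
  absorption identity (j + 1) (n + 1 choose j + 1) = (n + 1) (n choose j).\<close>

lemma det_taylor_Suc: "of_nat (Suc j) * det_taylor (Suc j) = (\<integral>s. minor_taylor j s s - k s s * det_taylor j \<partial>M)"
proof -
  have sa: "summable (\<lambda>n. of_real (real (n choose Suc j)) * det_coeff n)"
    by (rule summable_norm_cancel[OF summable_det_coeff[OF admissible_choose]])
  have sa': "summable (\<lambda>n. of_real (real (Suc n choose Suc j)) * det_coeff (Suc n))"
    using sa by (subst summable_Suc_iff)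
  have "det_taylor (Suc j) = (\<Sum>n. of_real (real (Suc n choose Suc j)) * det_coeff (Suc n))"
    unfolding det_taylor_def det_series_def using suminf_split_head[OF sa] by simp
  hence "of_nat (Suc j) * det_taylor (Suc j) = (\<Sum>n. of_nat (Suc j) * (of_nat (Suc n choose Suc j) * det_coeff (Suc n)))"
    using suminf_mult[OF sa', of "of_nat (Suc j)"] by simp
  also have "\<dots> = (\<Sum>n. of_real (real (n choose j)) * (of_nat (Suc n) * det_coeff (Suc n)))"
  proof (rule arg_cong[where f=suminf], rule ext)
    fix n
    have "of_nat (Suc j) * (of_nat (Suc n choose Suc j)::complex) = of_nat (Suc n) * of_nat (n choose j)"
      by (metis Suc_times_binomial of_nat_mult)
    thus "of_nat (Suc j) * (of_nat (Suc n choose Suc j) * det_coeff (Suc n)) 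
       = complex_of_real (real (n choose j)) * (of_nat (Suc n) * det_coeff (Suc n))"
      by (simp add: mult.assoc[symmetric] del: of_nat_Suc binomial_Suc_Suc)
  qed
  also have "\<dots> = (\<integral>s. minor_taylor j s s - k s s * det_taylor j \<partial>M)"
    unfolding minor_taylor_def det_taylor_def by (rule det_series_shift[OF admissible_choose])
  finally show ?thesis .
qed

text \<open>Evaluates the Taylor expansion at z = 0, truncated at order \<open>J\<close>. The
  resulting weights \<open>w n\<close>, alternating partial sums of binomials, are 1 at n = 0,
  vanish for 0 < n <= J and are at most 2^n beyond. If all Taylor coefficients vanish, 1 =
  \<open>det_coeff 0\<close> is bounded by a tail of a convergent series, which is arbitrarily
  small.\<close>

lemma not_all_det_taylor_zero: "\<exists>j. det_taylor j \<noteq> 0"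
proof (rule ccontr)
  assume "\<not> ?thesis"
  hence det_taylor: "det_taylor j = 0" for j by blast
  let ?u = "\<lambda>n. 2 ^ n * coeff_bound n"
  have "1 \<le> e" if "e > 0" for e :: real
  proof -
    obtain J where J: "\<And>n. n \<ge> J \<Longrightarrow> norm (\<Sum>i. ?u (i + n)) < e"
      using suminf_exist_split[OF \<open>e > 0\<close> summable_coeff_bound] by blast
    define w where "w n = (\<Sum>j\<le>J. (-1) ^ j * (of_nat (n choose j) :: complex))" for n
    have sj: "summable (\<lambda>n. of_real (real (n choose j)) * det_coeff n)" for j
      by (rule summable_norm_cancel[OF summable_det_coeff[OF admissible_choose]])
    have "(\<lambda>n. \<Sum>j\<le>J. (-1) ^ j * (of_real (real (n choose j)) * det_coeff n)) sums (\<Sum>j\<le>J. (-1) ^ j * det_taylor j)"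
      unfolding det_taylor_def det_series_def using sj by (intro sums_sum sums_mult summable_sums)
    hence sw: "(\<lambda>n. w n * det_coeff n) sums 0"
      by (simp add: det_taylor w_def sum_distrib_right mult.assoc)
    have w0: "w n = 0" if "0 < n" "n \<le> J" for n
    proof -
      have "w n = (\<Sum>j\<le>n. (-1) ^ j * of_nat (n choose j))"
        unfolding w_def using that by (intro sum.mono_neutral_right) (auto simp: binomial_eq_0)
      thus ?thesis using choose_alternating_sum[OF that(1), where 'a=complex] by simp
    qed
    have w1: "w 0 = 1" unfolding w_def by (simp add: sum.atMost_shift)
    have wle: "cmod (w n) \<le> 2 ^ n" for n
    proof -
      have "cmod (w n) \<le> (\<Sum>j\<le>J. real (n choose j))"
        unfolding w_def by (rule sum_norm_le) (simp add: norm_mult norm_power)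
      also have "\<dots> \<le> (\<Sum>j\<le>max n J. real (n choose j))" by (rule sum_mono2) auto
      also have "\<dots> = (\<Sum>j\<le>n. real (n choose j))" by (rule sum.mono_neutral_right) (auto simp: binomial_eq_0)
      also have "\<dots> = 2 ^ n" using choose_row_sum[of n] by (metis of_nat_sum of_nat_numeral of_nat_power)
      finally show ?thesis .
    qed
    have sm: "summable (\<lambda>n. w n * det_coeff n)" using sw by (rule sums_summable)
    have "0 = (\<Sum>n. w (n + Suc J) * det_coeff (n + Suc J)) + (\<Sum>n<Suc J. w n * det_coeff n)"
      using suminf_split_initial_segment[OF sm, of "Suc J"] sums_unique[OF sw] by simp
    also have "(\<Sum>n<Suc J. w n * det_coeff n) = (\<Sum>n\<in>{0}. w n * det_coeff n)"
      by (rule sum.mono_neutral_right) (auto simp: w0)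
    finally have "(\<Sum>n. w (n + Suc J) * det_coeff (n + Suc J)) = - 1"
      by (simp only: eq_neg_iff_add_eq_0) (simp add: w1 det_coeff_0)
    hence "1 = cmod (\<Sum>n. w (n + Suc J) * det_coeff (n + Suc J))"
      by (simp only: norm_minus_cancel norm_one)
    also have "\<dots> \<le> (\<Sum>n. ?u (n + Suc J))"
    proof (rule norm_suminf_le)
      show "cmod (w (n + Suc J) * det_coeff (n + Suc J)) \<le> ?u (n + Suc J)" for n
        unfolding norm_mult by (intro mult_mono wle cmod_det_coeff_le) auto
      show "summable (\<lambda>n. ?u (n + Suc J))" using summable_coeff_bound by (subst summable_iff_shift)
    qed
    also have "\<dots> < e" using J[of "Suc J"] by simp
    finally show ?thesis by simp
  qed
  from this[of "1/2"] show False by simp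
qed

section \<open>Vanishing of the determinant and the eigenvalue -1\<close>

theorem fredholm_alternative:
  "(\<Sum>n. det_coeff n) = 0 \<longleftrightarrow>
    (\<exists>v\<in>borel_measurable M. (\<exists>C. \<forall>s. cmod (v s) \<le> C) \<and> \<not> (AE s in M. v s = 0) \<and>
        (\<forall>s. v s = - (\<integral>t. k s t * v t \<partial>M)))"
proof
  assume "\<exists>v\<in>borel_measurable M. (\<exists>C. \<forall>s. cmod (v s) \<le> C) \<and> \<not> (AE s in M. v s = 0) \<and>
        (\<forall>s. v s = - (\<integral>t. k s t * v t \<partial>M))"
  then obtain v C where v: "v \<in> borel_measurable M" "\<And>s. cmod (v s) \<le> C" "\<not> (AE s in M. v s = 0)"
     "\<And>s. v s = - (\<integral>t. k s t * v t \<partial>M)" by blast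
  obtain s where s: "v s \<noteq> 0" using v(3) by auto
  interpret MM: pair_sigma_finite M M ..
  define B where "B = (\<Sum>n. \<bar>real (n choose 0)\<bar> * coeff_bound n)"
  have nule: "cmod (minor_taylor 0 s t) \<le> B" for s t unfolding minor_taylor_def B_def by (rule minor_series_le[OF admissible_choose])
  have B0: "B \<ge> 0" using nule norm_ge_zero order_trans by blast
  have C0: "C \<ge> 0" using v(2) norm_ge_zero order_trans by blast
  \<comment> \<open>The form with \<open>k\<close> on the right is required here, since the identity
    is going to be integrated against \<open>v\<close> in the variable \<open>t\<close>.\<close>
  have minor_taylor: "minor_taylor 0 s t = det_taylor 0 * k s t - (\<integral>r. minor_taylor 0 s r * k r t \<partial>M)" for s t
  proof -
    have e: "(\<lambda>n. real (Suc n choose 0)) = (\<lambda>n. real (n choose 0))" by simp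
    show ?thesis using minor_series_expand(2)[OF admissible_choose[of 0], of s t]
      unfolding e det_taylor_def[symmetric] minor_taylor_def[symmetric] .
  qed
  have fin: "finite_measure (M \<Otimes>\<^sub>M M)" by (rule finite_measure_pair_measure) unfold_locales
  have m: "(\<lambda>w. minor_taylor 0 s (fst w) * (k (fst w) (snd w) * v (snd w))) \<in> borel_measurable (M \<Otimes>\<^sub>M M)"
    unfolding minor_taylor_def using v(1)
    by (intro borel_measurable_times measurable_k minor_series_measurable measurable_compose[OF measurable_snd v(1)]) (auto simp: space_M)
  have int: "integrable (M \<Otimes>\<^sub>M M) (\<lambda>(r, t). minor_taylor 0 s r * (k r t * v t))"
  proof (rule finite_measure.integrable_const_bound[OF fin, where B="B * C"])
    show "(\<lambda>(r, t). minor_taylor 0 s r * (k r t * v t)) \<in> borel_measurable (M \<Otimes>\<^sub>M M)"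
      using m by (simp add: case_prod_unfold)
    have "cmod (minor_taylor 0 s r * (k r t * v t)) \<le> B * C" for r t
      unfolding norm_mult[of "minor_taylor 0 s r"]
      by (intro mult_mono nule norm_mult_le_of_le_1 k_le v B0) auto
    thus "AE w in M \<Otimes>\<^sub>M M. cmod (case w of (r, t) \<Rightarrow> minor_taylor 0 s r * (k r t * v t)) \<le> B * C"
      by (auto simp: case_prod_unfold)
  qed
  have kv: "integrable M (\<lambda>t. k s t * v t)"
    by (rule integrable_bounded[where C=C]) (auto intro!: borel_measurable_times k_const v norm_mult_le_of_le_1 k_le)
  have in2: "integrable M (\<lambda>t. (\<integral>r. minor_taylor 0 s r * k r t \<partial>M) * v t)"
    using MM.integrable_snd[OF int] by (simp add: mult.assoc[symmetric])
  \<comment> \<open>Applying N = D(1) k - N k to v = -k v, the two terms that contain the minor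
    cancel. What remains is D(1) (k v)(s) = 0 with (k v)(s) = -v(s) nonzero.\<close>
  have "(\<integral>t. minor_taylor 0 s t * v t \<partial>M) = (\<integral>t. det_taylor 0 * (k s t * v t) - (\<integral>r. minor_taylor 0 s r * k r t \<partial>M) * v t \<partial>M)"
    by (subst minor_taylor) (simp add: algebra_simps)
  also have "\<dots> = det_taylor 0 * (\<integral>t. k s t * v t \<partial>M) - (\<integral>t. (\<integral>r. minor_taylor 0 s r * k r t \<partial>M) * v t \<partial>M)"
    using kv in2 by simp
  also have "(\<integral>t. (\<integral>r. minor_taylor 0 s r * k r t \<partial>M) * v t \<partial>M) = (\<integral>t. (\<integral>r. minor_taylor 0 s r * (k r t * v t) \<partial>M) \<partial>M)"
    by (simp add: mult.assoc[symmetric])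
  also have "\<dots> = (\<integral>r. (\<integral>t. minor_taylor 0 s r * (k r t * v t) \<partial>M) \<partial>M)"
    by (rule MM.Fubini_integral[OF int])
  also have "\<dots> = (\<integral>r. minor_taylor 0 s r * (\<integral>t. k r t * v t \<partial>M) \<partial>M)"
    by simp
  also have "(\<integral>r. minor_taylor 0 s r * (\<integral>t. k r t * v t \<partial>M) \<partial>M) = (\<integral>r. - (minor_taylor 0 s r * v r) \<partial>M)"
    using v(4) by (intro Bochner_Integration.integral_cong refl) (metis minus_minus mult_minus_right)
  finally have "det_taylor 0 * (\<integral>t. k s t * v t \<partial>M) = 0" by simp
  hence "det_taylor 0 = 0" using v(4)[of s] s by auto
  thus "(\<Sum>n. det_coeff n) = 0" by (simp add: det_taylor_def det_series_def)
next
  assume D: "(\<Sum>n. det_coeff n) = 0"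
  show "\<exists>v\<in>borel_measurable M. (\<exists>C. \<forall>s. cmod (v s) \<le> C) \<and> \<not> (AE s in M. v s = 0) \<and>
        (\<forall>s. v s = - (\<integral>t. k s t * v t \<partial>M))"
  proof (rule ccontr)
    assume no: "\<not> ?thesis"
    have no': "AE s in M. v s = 0" if "v \<in> borel_measurable M" "\<exists>C. \<forall>s. cmod (v s) \<le> C"
      "\<forall>s. v s = - (\<integral>t. k s t * v t \<partial>M)" for v
      using no that by blast
    \<comment> \<open>A column of the minor that solves the homogeneous equation is a bounded
      candidate eigenfunction, hence zero almost everywhere. Then the integral in its equation
      vanishes, and with it the column at every point, the diagonal included.\<close>
    have van: "minor_taylor j s t = 0" if eq: "\<And>s. minor_taylor j s t = - (\<integral>r. k s r * minor_taylor j r t \<partial>M)" for j s t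
    proof -
      have "(\<lambda>s. minor_taylor j s t) \<in> borel_measurable M"
        unfolding minor_taylor_def by (rule minor_series_measurable) (auto simp: space_M)
      moreover have "\<exists>C. \<forall>s. cmod (minor_taylor j s t) \<le> C"
        unfolding minor_taylor_def using minor_series_le[OF admissible_choose] by blast
      ultimately have "AE s in M. minor_taylor j s t = 0" by (rule no'[OF _ _ allI[OF eq]])
      hence "AE r in M. k s r * minor_taylor j r t = 0" by auto
      hence "(\<integral>r. k s r * minor_taylor j r t \<partial>M) = 0" by (rule integral_eq_zero_AE)
      thus ?thesis unfolding eq[of s] by simp
    qed
    have step: "det_taylor (Suc j) = 0" if "det_taylor j = 0" "\<And>s t. minor_taylor j s t = 0" for j
    proof -
      have "of_nat (Suc j) * det_taylor (Suc j) = 0" unfolding det_taylor_Suc using that by simp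
      thus ?thesis by (metis mult_eq_0_iff of_nat_eq_0_iff nat.distinct(1))
    qed
    \<comment> \<open>Once order j vanishes, the trace formula kills the next determinant
      coefficient, and the next minor is then left with the homogeneous equation.\<close>
    have "det_taylor j = 0 \<and> (\<forall>s t. minor_taylor j s t = 0)" for j
    proof (induction j)
      case 0
      have det_taylor: "det_taylor 0 = 0" using D by (simp add: det_taylor_def det_series_def)
      have "minor_taylor 0 s t = 0" for s t by (rule van) (subst minor_taylor_0, simp add: det_taylor)
      thus ?case using det_taylor by blast
    next
      case (Suc j)
      have det_taylor: "det_taylor (Suc j) = 0" using step[of j] Suc by blast
      have "minor_taylor (Suc j) s t = 0" for s t by (rule van) (subst minor_taylor_Suc, simp add: det_taylor Suc)
      thus ?case using det_taylor by blast
    qed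
    thus False using not_all_det_taylor_zero by blast
  qed
qed

end

section \<open>Matrix kernels on the line\<close>

lemma integrable_bounded_finite_measure:
  fixes f :: "'a \<Rightarrow> complex"
  assumes "finite_measure M" "f \<in> borel_measurable M" "\<And>x. cmod (f x) \<le> C"
  shows "integrable M f"
  using assms by (intro finite_measure.integrable_const_bound[where B=C]) auto

text \<open>Every permutation uses each row and each column once, so row and column weights come out
  as one common product.\<close>

lemma detS_scale: "detS J (\<lambda>i j. u i * f i j * v j) = (\<Prod>i\<in>J. u i * v i) * detS J f" if "finite J"
proof -
  have "(\<Prod>i\<in>J. u i * f i (p i) * v (p i)) = (\<Prod>i\<in>J. u i * v i) * (\<Prod>i\<in>J. f i (p i))" if "p permutes J" for p
    using prod.permute[OF that, of v] by (simp add: prod.distrib o_def)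
  thus ?thesis unfolding detS_def sum_distrib_left by (intro sum.cong) auto
qed

locale weighted_line =
  fixes g :: "real \<Rightarrow> real"
  assumes g_measurable [measurable]: "g \<in> borel_measurable lborel"
    and g_pos: "g x > 0"
    and g2_integrable: "integrable lborel (\<lambda>x. (g x)\<^sup>2)"
begin

text \<open>Dividing \<open>K x y\<close> by \<open>g x * g y\<close> bounds the kernel by 1. Each
  point of a determinant occurs once as a row and once as a column, so a factor (g x)^2 is released
  per point and becomes the density.\<close>

definition weight_measure :: "real measure" where "weight_measure = density lborel (\<lambda>x. (g x)\<^sup>2)"
definition indexed_measure :: "('m::finite \<times> real) measure" where "indexed_measure = count_space UNIV \<Otimes>\<^sub>M weight_measure"

lemma sets_weight_measure [measurable_cong]: "sets weight_measure = sets lborel" by (simp add: weight_measure_def)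
lemma space_weight_measure [simp]: "space weight_measure = UNIV" by (simp add: weight_measure_def)

lemma finite_weight_measure: "finite_measure weight_measure"
proof (rule finite_measureI)
  have "emeasure weight_measure (space weight_measure) = (\<integral>\<^sup>+x. ennreal ((g x)\<^sup>2) \<partial>lborel)"
    by (simp add: weight_measure_def emeasure_density)
  also have "\<dots> < \<infinity>" using g2_integrable by (simp add: integrable_iff_bounded)
  finally show "emeasure weight_measure (space weight_measure) \<noteq> \<infinity>" by simp
qed

lemma finite_indexed_measure: "finite_measure (indexed_measure :: ('m::finite \<times> real) measure)"
  unfolding indexed_measure_def
  by (rule finite_measure_pair_measure[OF finite_weight_measure finite_measure_count_space]) simp

lemma space_indexed_measure: "space indexed_measure = UNIV" by (simp add: indexed_measure_def space_pair_measure)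

lemma integral_weight_measure: "f \<in> borel_measurable lborel \<Longrightarrow> (\<integral>y. f y \<partial>weight_measure) = (\<integral>y. (g y)\<^sup>2 *\<^sub>R f y \<partial>lborel)"
  for f :: "real \<Rightarrow> complex"
  unfolding weight_measure_def by (rule integral_density) auto

lemma measurable_indexed_section:
  fixes f :: "'m::finite \<times> real \<Rightarrow> complex"
  assumes "f \<in> borel_measurable indexed_measure"
  shows "(\<lambda>y. f (c, y)) \<in> borel_measurable lborel"
proof -
  have "(\<lambda>y. (c, y)) \<in> lborel \<rightarrow>\<^sub>M indexed_measure" unfolding indexed_measure_def by measurable
  from measurable_compose[OF this assms] show ?thesis .
qed

lemma integral_indexed_measure:
  fixes f :: "'m::finite \<times> real \<Rightarrow> complex"
  assumes f: "f \<in> borel_measurable indexed_measure" and le: "\<And>p. cmod (f p) \<le> C"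
  shows "(\<integral>p. f p \<partial>indexed_measure) = (\<Sum>c\<in>UNIV. \<integral>y. (g y)\<^sup>2 *\<^sub>R f (c, y) \<partial>lborel)"
proof -
  interpret weight_measure: finite_measure weight_measure by (rule finite_weight_measure)
  interpret P: pair_sigma_finite "count_space (UNIV::'m set)" weight_measure
    by (intro pair_sigma_finite.intro sigma_finite_measure_count_space_finite finite weight_measure.sigma_finite_measure_axioms)
  have "integrable indexed_measure f" by (rule integrable_bounded_finite_measure[OF finite_indexed_measure f le])
  hence "(\<integral>p. f p \<partial>indexed_measure) = (\<integral>c. (\<integral>y. f (c, y) \<partial>weight_measure) \<partial>count_space UNIV)"
    unfolding indexed_measure_def by (rule P.integral_fst'[symmetric])
  also have "\<dots> = (\<Sum>c\<in>UNIV. \<integral>y. f (c, y) \<partial>weight_measure)"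
    by (rule lebesgue_integral_count_space_finite) simp
  also have "\<dots> = (\<Sum>c\<in>UNIV. \<integral>y. (g y)\<^sup>2 *\<^sub>R f (c, y) \<partial>lborel)"
    by (intro sum.cong refl integral_weight_measure measurable_indexed_section[OF f])
  finally show ?thesis .
qed

text \<open>As \<open>g\<close> is positive, the weighted measure and Lebesgue measure have the same
  null sets.\<close>

lemma AE_indexed_iff:
  assumes m: "{p \<in> space indexed_measure. P p} \<in> sets (indexed_measure :: ('m::finite \<times> real) measure)"
  shows "(AE p in (indexed_measure :: ('m \<times> real) measure). P p) \<longleftrightarrow> (\<forall>c. AE y in lborel. P (c, y))"
proof -
  interpret weight_measure: finite_measure weight_measure by (rule finite_weight_measure)
  interpret P: pair_sigma_finite "count_space (UNIV::'m set)" weight_measure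
    by (intro pair_sigma_finite.intro sigma_finite_measure_count_space_finite finite weight_measure.sigma_finite_measure_axioms)
  have "(AE p in (indexed_measure :: ('m \<times> real) measure). P p) \<longleftrightarrow> (AE c in count_space (UNIV::'m set). AE y in weight_measure. P (c, y))"
    unfolding indexed_measure_def using P.AE_pair_iff[of "\<lambda>c y. P (c, y)"] m[unfolded indexed_measure_def] by simp
  also have "\<dots> \<longleftrightarrow> (\<forall>c. AE y in weight_measure. P (c, y))" by (simp add: AE_count_space)
  also have "\<dots> \<longleftrightarrow> (\<forall>c. AE y in lborel. P (c, y))"
    unfolding weight_measure_def by (subst AE_density) (use g_pos in \<open>auto simp: less_imp_neq[symmetric]\<close>)
  finally show ?thesis .
qed

lemma comb_measurable:
  "(\<lambda>x. \<lambda>i\<in>J. (a i, x i)) \<in> Pi\<^sub>M J (\<lambda>_. lborel) \<rightarrow>\<^sub>M Pi\<^sub>M J (\<lambda>_. indexed_measure :: ('m::finite \<times> real) measure)"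
proof (rule measurable_restrict)
  fix i assume "i \<in> J"
  hence "(\<lambda>x. x i) \<in> Pi\<^sub>M J (\<lambda>_. lborel) \<rightarrow>\<^sub>M lborel" by (rule measurable_component_singleton)
  thus "(\<lambda>x. (a i, x i)) \<in> Pi\<^sub>M J (\<lambda>_. lborel) \<rightarrow>\<^sub>M (indexed_measure :: ('m \<times> real) measure)"
    unfolding indexed_measure_def by (intro measurable_Pair) (auto cong: measurable_cong_sets simp: sets_weight_measure)
qed

text \<open>Integrating over points (index, real) means summing over the assignments
  \<open>a\<close> of indices and integrating over the reals with density, which is the shape of the
  terms of \<open>det2_kernel\<close>. The bound on \<open>F\<close> supplies the integrability that
  allows one coordinate to be integrated at a time.\<close>

lemma integral_PiM_indexed:
  fixes F :: "(nat \<Rightarrow> 'm::finite \<times> real) \<Rightarrow> complex"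
  assumes "finite J" "F \<in> borel_measurable (Pi\<^sub>M J (\<lambda>_. indexed_measure))" "\<And>p. cmod (F p) \<le> C"
  shows "(\<integral>p. F p \<partial>(Pi\<^sub>M J (\<lambda>_. indexed_measure))) =
     (\<integral>x. (\<Sum>a\<in>PiE J (\<lambda>_. UNIV). (\<Prod>i\<in>J. (g (x i))\<^sup>2) *\<^sub>R F (\<lambda>i\<in>J. (a i, x i))) \<partial>(Pi\<^sub>M J (\<lambda>_. lborel)))"
  using assms
proof (induction J arbitrary: F C rule: finite_induct)
  case empty
  show ?case by (simp add: PiM_empty lebesgue_integral_count_space_finite)
next
  case (insert i J)
  interpret PL: product_sigma_finite "\<lambda>_::nat. lborel :: real measure" by standard
  interpret M: finite_measure "indexed_measure :: ('m \<times> real) measure" by (rule finite_indexed_measure)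
  interpret PM: product_sigma_finite "\<lambda>_::nat. indexed_measure :: ('m \<times> real) measure" by standard
  have C0: "C \<ge> 0" using insert.prems(2) norm_ge_zero order_trans by blast
  note Fm = insert.prems(1) and FC = insert.prems(2)
  have upd: "(\<lambda>(p, q). p(i := q)) \<in> Pi\<^sub>M J (\<lambda>_. indexed_measure) \<Otimes>\<^sub>M indexed_measure \<rightarrow>\<^sub>M Pi\<^sub>M (insert i J) (\<lambda>_. indexed_measure :: ('m \<times> real) measure)"
    using measurable_add_dim[of i J "\<lambda>_. indexed_measure :: ('m \<times> real) measure"] by simp
  have Fupd: "(\<lambda>(p, q). F (p(i := q))) \<in> borel_measurable (Pi\<^sub>M J (\<lambda>_. indexed_measure) \<Otimes>\<^sub>M indexed_measure)"
    using measurable_compose[OF upd Fm] by (simp add: case_prod_unfold fun_upd_def)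
  define G where "G p = (\<integral>q. F (p(i := q)) \<partial>indexed_measure)" for p
  have Gm: "G \<in> borel_measurable (Pi\<^sub>M J (\<lambda>_. indexed_measure))"
    unfolding G_def by (rule M.borel_measurable_lebesgue_integral[OF Fupd])
  have GC: "cmod (G p) \<le> C * measure (indexed_measure :: ('m \<times> real) measure) UNIV" for p
    unfolding G_def using M.norm_integral_le_const[OF FC] by (simp add: space_indexed_measure)
  have intF: "integrable (Pi\<^sub>M (insert i J) (\<lambda>_. indexed_measure)) F"
  proof -
    have "integrable (Pi\<^sub>M (insert i J) (\<lambda>_. indexed_measure :: ('m \<times> real) measure)) (\<lambda>p. \<Prod>l\<in>insert i J. (1::real))"
      using insert.hyps by (intro PM.product_integrable_prod) auto
    hence "integrable (Pi\<^sub>M (insert i J) (\<lambda>_. indexed_measure :: ('m \<times> real) measure)) (\<lambda>p. C * 1)"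
      by (intro integrable_mult_right) simp
    thus ?thesis by (rule Bochner_Integration.integrable_bound) (use Fm FC C0 in auto)
  qed
  let ?c = "\<lambda>a x. (\<lambda>l\<in>insert i J. (a l, x l))"
  let ?H = "\<lambda>a x. (\<Prod>l\<in>insert i J. (g (x l))\<^sup>2) *\<^sub>R F (?c a x)"
  have intH: "integrable (Pi\<^sub>M (insert i J) (\<lambda>_. lborel)) (?H a)" for a
  proof -
    have "integrable (Pi\<^sub>M (insert i J) (\<lambda>_. lborel)) (\<lambda>x. \<Prod>l\<in>insert i J. (g (x l))\<^sup>2)"
      using insert.hyps g2_integrable by (intro PL.product_integrable_prod) auto
    hence I: "integrable (Pi\<^sub>M (insert i J) (\<lambda>_. lborel)) (\<lambda>x. C * (\<Prod>l\<in>insert i J. (g (x l))\<^sup>2))"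
      by (rule integrable_mult_right)
    have "(\<lambda>x. \<Prod>l\<in>insert i J. (g (x l))\<^sup>2) \<in> borel_measurable (Pi\<^sub>M (insert i J) (\<lambda>_. lborel))"
      using insert.hyps by measurable
    moreover have "(\<lambda>x. F (?c a x)) \<in> borel_measurable (Pi\<^sub>M (insert i J) (\<lambda>_. lborel))"
      by (rule measurable_compose[OF comb_measurable Fm])
    moreover have "norm (?H a x) \<le> norm (C * (\<Prod>l\<in>insert i J. (g (x l))\<^sup>2))" for x
    proof -
      have nn: "0 \<le> (\<Prod>l\<in>insert i J. (g (x l))\<^sup>2)" by (intro prod_nonneg) auto
      have "norm (?H a x) = (\<Prod>l\<in>insert i J. (g (x l))\<^sup>2) * cmod (F (?c a x))"
        by (simp only: norm_scaleR abs_of_nonneg[OF nn])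
      also have "\<dots> \<le> (\<Prod>l\<in>insert i J. (g (x l))\<^sup>2) * C" by (rule mult_left_mono[OF FC nn])
      also have "\<dots> = norm (C * (\<Prod>l\<in>insert i J. (g (x l))\<^sup>2))"
        by (simp only: real_norm_def abs_mult abs_of_nonneg[OF nn] abs_of_nonneg[OF C0] mult.commute)
      finally show ?thesis .
    qed
    ultimately show ?thesis
      by (intro Bochner_Integration.integrable_bound[OF I]) (auto intro: borel_measurable_scaleR)
  qed
  have "(\<integral>p. F p \<partial>(Pi\<^sub>M (insert i J) (\<lambda>_. indexed_measure))) = (\<integral>p. G p \<partial>(Pi\<^sub>M J (\<lambda>_. indexed_measure)))"
    unfolding G_def by (rule PM.product_integral_insert[OF insert.hyps intF])
  also have "\<dots> = (\<integral>x. (\<Sum>a\<in>PiE J (\<lambda>_. UNIV). (\<Prod>l\<in>J. (g (x l))\<^sup>2) *\<^sub>R G (\<lambda>l\<in>J. (a l, x l))) \<partial>(Pi\<^sub>M J (\<lambda>_. lborel)))"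
    by (rule insert.IH[OF Gm GC])
  also have "\<dots> = (\<integral>x. (\<integral>y. (\<Sum>a\<in>PiE (insert i J) (\<lambda>_. UNIV). ?H a (x(i := y))) \<partial>lborel) \<partial>(Pi\<^sub>M J (\<lambda>_. lborel)))"
  proof (intro Bochner_Integration.integral_cong refl)
    fix x assume x: "x \<in> space (Pi\<^sub>M J (\<lambda>_. lborel :: real measure))"
    have H: "?H (a(i := c)) (x(i := y)) = (\<Prod>l\<in>J. (g (x l))\<^sup>2) *\<^sub>R ((g y)\<^sup>2 *\<^sub>R F ((\<lambda>l\<in>J. (a l, x l))(i := (c, y))))" for a c y
    proof -
      have "?c (a(i := c)) (x(i := y)) = (\<lambda>l\<in>J. (a l, x l))(i := (c, y))"
        using insert.hyps by (auto simp: fun_eq_iff)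
      moreover have "(\<Prod>l\<in>insert i J. (g ((x(i := y)) l))\<^sup>2) = (g y)\<^sup>2 * (\<Prod>l\<in>J. (g (x l))\<^sup>2)"
        using insert.hyps by (auto intro!: prod.cong)
      ultimately show ?thesis by (simp add: mult.commute)
    qed
    have comb_space: "(\<lambda>l\<in>J. (a l, x l)) \<in> space (Pi\<^sub>M J (\<lambda>_. indexed_measure :: ('m \<times> real) measure))" for a
      by (auto simp: space_PiM space_indexed_measure)
    have Fq: "(\<lambda>q. F ((\<lambda>l\<in>J. (a l, x l))(i := q))) \<in> borel_measurable indexed_measure" for a
      using measurable_compose[OF measurable_Pair1'[OF comb_space[of a]] Fupd] by simp
    have Gx: "G (\<lambda>l\<in>J. (a l, x l)) = (\<Sum>c\<in>UNIV. \<integral>y. (g y)\<^sup>2 *\<^sub>R F ((\<lambda>l\<in>J. (a l, x l))(i := (c, y))) \<partial>lborel)" for a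
      unfolding G_def by (rule integral_indexed_measure[OF Fq FC])
    have int1: "integrable lborel (\<lambda>y. (g y)\<^sup>2 *\<^sub>R F ((\<lambda>l\<in>J. (a l, x l))(i := (c, y))))" for a c
    proof (rule Bochner_Integration.integrable_bound)
      show "integrable lborel (\<lambda>y. C * (g y)\<^sup>2)" using g2_integrable by (rule integrable_mult_right)
      show "(\<lambda>y. (g y)\<^sup>2 *\<^sub>R F ((\<lambda>l\<in>J. (a l, x l))(i := (c, y)))) \<in> borel_measurable lborel"
        using measurable_indexed_section[OF Fq] by (intro borel_measurable_scaleR) auto
      show "AE y in lborel. norm ((g y)\<^sup>2 *\<^sub>R F ((\<lambda>l\<in>J. (a l, x l))(i := (c, y)))) \<le> norm (C * (g y)\<^sup>2)"
        using FC C0 by (auto simp: abs_mult mult.commute[of C] intro!: mult_left_mono)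
    qed
    \<comment> \<open>An assignment on \<open>insert i J\<close> is an assignment on
      \<open>J\<close> together with the index given to \<open>i\<close>.\<close>
    have "(\<integral>y. (\<Sum>a\<in>PiE (insert i J) (\<lambda>_. UNIV). ?H a (x(i := y))) \<partial>lborel)
       = (\<integral>y. (\<Sum>(c, a)\<in>UNIV \<times> PiE J (\<lambda>_. UNIV). ?H (a(i := c)) (x(i := y))) \<partial>lborel)"
    proof -
      have inj: "inj_on (\<lambda>(c, a). a(i := c)) ((UNIV::'m set) \<times> PiE J (\<lambda>_. UNIV))"
      proof (rule inj_onI, clarify)
        fix c c' :: 'm and a a' assume a: "a \<in> PiE J (\<lambda>_. UNIV)" "a' \<in> PiE J (\<lambda>_. UNIV)" "a(i := c) = a'(i := c')"
        have "a l = a' l" for l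
        proof (cases "l = i")
          case True thus ?thesis using a(1,2) insert.hyps by (auto simp: PiE_def extensional_def)
        next
          case False thus ?thesis using fun_cong[OF a(3), of l] by simp
        qed
        thus "c = c' \<and> a = a'" using fun_cong[OF a(3), of i] by auto
      qed
      show ?thesis unfolding PiE_insert_eq
        by (subst sum.reindex[OF inj]) (simp add: case_prod_unfold o_def)
    qed
    also have "\<dots> = (\<integral>y. (\<Sum>a\<in>PiE J (\<lambda>_. UNIV). \<Sum>c\<in>UNIV. ?H (a(i := c)) (x(i := y))) \<partial>lborel)"
      by (subst sum.swap) (simp add: sum.cartesian_product)
    also have "\<dots> = (\<Sum>a\<in>PiE J (\<lambda>_. UNIV). \<Sum>c\<in>UNIV. (\<Prod>l\<in>J. (g (x l))\<^sup>2) *\<^sub>R (\<integral>y. (g y)\<^sup>2 *\<^sub>R F ((\<lambda>l\<in>J. (a l, x l))(i := (c, y))) \<partial>lborel))"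
      unfolding H
      by (subst Bochner_Integration.integral_sum, intro Bochner_Integration.integrable_sum integrable_scaleR_right int1,
          intro sum.cong refl, subst Bochner_Integration.integral_sum, intro integrable_scaleR_right int1,
          intro sum.cong refl integral_scaleR_right)
    also have "\<dots> = (\<Sum>a\<in>PiE J (\<lambda>_. UNIV). (\<Prod>l\<in>J. (g (x l))\<^sup>2) *\<^sub>R G (\<lambda>l\<in>J. (a l, x l)))"
      unfolding Gx by (simp add: scaleR_sum_right)
    finally show "(\<Sum>a\<in>PiE J (\<lambda>_. UNIV). (\<Prod>l\<in>J. (g (x l))\<^sup>2) *\<^sub>R G (\<lambda>l\<in>J. (a l, x l)))
       = (\<integral>y. (\<Sum>a\<in>PiE (insert i J) (\<lambda>_. UNIV). ?H a (x(i := y))) \<partial>lborel)" by (rule sym)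
  qed
  also have "\<dots> = (\<integral>x. (\<Sum>a\<in>PiE (insert i J) (\<lambda>_. UNIV). ?H a x) \<partial>(Pi\<^sub>M (insert i J) (\<lambda>_. lborel)))"
    by (rule PL.product_integral_insert[symmetric, OF insert.hyps]) (intro Bochner_Integration.integrable_sum intH)
  finally show ?case .
qed

text \<open>The alternative for the normalised kernel, carried back by w = g v. A bounded
  \<open>v\<close> corresponds to \<open>w\<close> dominated by \<open>g\<close>, so the solutions
  come with decay built in.\<close>

theorem det2_kernel_eq_0_iff:
  fixes K :: "real \<Rightarrow> real \<Rightarrow> complex^'m^'m"
  assumes K_meas: "\<And>i j. (\<lambda>p. K (fst p) (snd p) $ i $ j) \<in> borel_measurable (lborel \<Otimes>\<^sub>M lborel)"
    and K_le: "\<And>x y i j. cmod (K x y $ i $ j) \<le> g x * g y"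
  shows "det2_kernel K = 0 \<longleftrightarrow> (\<exists>w :: 'm \<Rightarrow> real \<Rightarrow> complex.
     (\<forall>i. w i \<in> borel_measurable lborel) \<and> (\<exists>C. \<forall>i x. cmod (w i x) \<le> C * g x) \<and>
     (\<exists>i. \<not> (AE x in lborel. w i x = 0)) \<and>
     (\<forall>i x. w i x = - (\<Sum>j\<in>UNIV. \<integral>y. K x y $ i $ j * w j y \<partial>lborel)))"
proof -
  define b where "b p q = K (snd p) (snd q) $ fst p $ fst q / (g (snd p) * g (snd q))" for p q :: "'m \<times> real"
  have b_le: "cmod (b p q) \<le> 1" for p q
    using K_le[of "snd p" "snd q"] g_pos[of "snd p"] g_pos[of "snd q"]
    by (simp add: b_def norm_divide norm_mult divide_le_eq)
  have b_meas: "case_prod b \<in> borel_measurable (indexed_measure \<Otimes>\<^sub>M indexed_measure)"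
  proof -
    let ?N = "indexed_measure \<Otimes>\<^sub>M indexed_measure :: (('m \<times> real) \<times> ('m \<times> real)) measure"
    have snd: "(\<lambda>z. snd (fst z)) \<in> ?N \<rightarrow>\<^sub>M lborel" "(\<lambda>z. snd (snd z)) \<in> ?N \<rightarrow>\<^sub>M lborel"
      unfolding indexed_measure_def by measurable
    have fst: "(\<lambda>z. (fst (fst z), fst (snd z))) \<in> ?N \<rightarrow>\<^sub>M count_space UNIV"
    proof -
      have ff: "(\<lambda>z. fst (fst z)) \<in> ?N \<rightarrow>\<^sub>M count_space UNIV" "(\<lambda>z. fst (snd z)) \<in> ?N \<rightarrow>\<^sub>M count_space UNIV"
        unfolding indexed_measure_def by measurable
      have "count_space (UNIV::'m set) \<Otimes>\<^sub>M count_space (UNIV::'m set) = count_space UNIV"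
        using pair_measure_count_space[of "UNIV::'m set" "UNIV::'m set"] by simp
      thus ?thesis using measurable_Pair[OF ff] by simp
    qed
    have "(\<lambda>z. K (snd (fst z)) (snd (snd z)) $ i $ j / (g (snd (fst z)) * g (snd (snd z)))) \<in> borel_measurable ?N" for i j
      using measurable_compose[OF measurable_Pair[OF snd] K_meas[of i j]]
        measurable_compose[OF snd(1) g_measurable] measurable_compose[OF snd(2) g_measurable]
      by simp
    note K' = this
    define F where "F ij z = K (snd (fst z)) (snd (snd z)) $ fst ij $ snd ij / (g (snd (fst z)) * g (snd (snd z)))"
      for ij :: "'m \<times> 'm" and z :: "('m \<times> real) \<times> ('m \<times> real)"
    \<comment> \<open>Which matrix entry is read depends on the point, so measurability is reduced
      to the finitely many index pairs.\<close>
    have "(\<lambda>z. F (fst (fst z), fst (snd z)) z) \<in> borel_measurable ?N"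
    proof (rule measurable_compose_countable'[where f=F and I=UNIV])
      show "F ij \<in> borel_measurable ?N" for ij unfolding F_def using K' by simp
    qed (use fst in \<open>simp_all add: countable_finite\<close>)
    thus ?thesis by (simp add: b_def F_def case_prod_unfold)
  qed
  interpret B: bounded_kernel "indexed_measure :: ('m \<times> real) measure" b
    by (intro bounded_kernel.intro finite_indexed_measure bounded_kernel_axioms.intro space_indexed_measure b_meas b_le)
  have term_eq: "(1 / fact n) * (\<integral>x. (\<Sum>a\<in>PiE {..<n} (\<lambda>_. UNIV).
        detn n (\<lambda>i j. if i = j then 0 else K (x i) (x j) $ a i $ a j)) \<partial>(Pi\<^sub>M {..<n} (\<lambda>_. lborel))) = B.det_coeff n" for n
  proof -
    have "detn n (\<lambda>i j. if i = j then 0 else K (x i) (x j) $ a i $ a j) =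
       (\<Prod>i<n. (g (x i))\<^sup>2) *\<^sub>R B.hollow_det {..<n} (\<lambda>i\<in>{..<n}. (a i, x i))" for a x
    proof -
      have "detn n (\<lambda>i j. if i = j then 0 else K (x i) (x j) $ a i $ a j) =
        detS {..<n} (\<lambda>i j. of_real (g (x i)) * (if i = j then 0 else b (a i, x i) (a j, x j)) * of_real (g (x j)))"
        unfolding detS_lessThan[symmetric]
        by (intro detS_cong) (use g_pos in \<open>auto simp: b_def less_imp_neq[symmetric]\<close>)
      also have "\<dots> = (\<Prod>i<n. (g (x i))\<^sup>2) *\<^sub>R detS {..<n} (\<lambda>i j. if i = j then 0 else b (a i, x i) (a j, x j))"
        by (subst detS_scale) (simp_all add: scaleR_conv_of_real power2_eq_square)
      also have "detS {..<n} (\<lambda>i j. if i = j then 0 else b (a i, x i) (a j, x j)) = B.hollow_det {..<n} (\<lambda>i\<in>{..<n}. (a i, x i))"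
        unfolding B.hollow_det_def by (intro detS_cong) auto
      finally show ?thesis .
    qed
    thus ?thesis
      unfolding B.det_coeff_def B.hollow_int_def
      by (simp add: integral_PiM_indexed[OF _ B.hollow_det_measurable B.hollow_det_le])
  qed
  have "det2_kernel K = (\<Sum>n. B.det_coeff n)" unfolding det2_kernel_def term_eq ..
  hence "det2_kernel K = 0 \<longleftrightarrow> (\<exists>v\<in>borel_measurable indexed_measure. (\<exists>C. \<forall>s. cmod (v s) \<le> C) \<and> \<not> (AE s in indexed_measure. v s = 0) \<and>
        (\<forall>s. v s = - (\<integral>t. b s t * v t \<partial>indexed_measure)))"
    using B.fredholm_alternative by simp
  also have "\<dots> \<longleftrightarrow> (\<exists>w :: 'm \<Rightarrow> real \<Rightarrow> complex.
     (\<forall>i. w i \<in> borel_measurable lborel) \<and> (\<exists>C. \<forall>i x. cmod (w i x) \<le> C * g x) \<and>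
     (\<exists>i. \<not> (AE x in lborel. w i x = 0)) \<and>
     (\<forall>i x. w i x = - (\<Sum>j\<in>UNIV. \<integral>y. K x y $ i $ j * w j y \<partial>lborel)))" (is "?V \<longleftrightarrow> ?W")
  proof -
    \<comment> \<open>Of the factor (g y)^2 from the density, one \<open>g y\<close> cancels the
      denominator of \<open>b\<close> and the other turns \<open>v\<close> into
      \<open>w\<close>.\<close>
    have main: "(\<integral>t. b (i, x) t * v t \<partial>indexed_measure) * g x = (\<Sum>j\<in>UNIV. \<integral>y. K x y $ i $ j * (g y * v (j, y)) \<partial>lborel)"
      if v: "v \<in> borel_measurable indexed_measure" "\<And>s. cmod (v s) \<le> C" for v :: "'m \<times> real \<Rightarrow> complex" and C i x
    proof -
      have "(\<integral>t. b (i, x) t * v t \<partial>indexed_measure) = (\<Sum>j\<in>UNIV. \<integral>y. (g y)\<^sup>2 *\<^sub>R (b (i, x) (j, y) * v (j, y)) \<partial>lborel)"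
        by (rule integral_indexed_measure[where C=C]) (auto intro!: borel_measurable_times v B.k_const norm_mult_le_of_le_1 b_le)
      moreover have "(\<integral>y. (g y)\<^sup>2 *\<^sub>R (b (i, x) (j, y) * v (j, y)) \<partial>lborel) * g x = 
          (\<integral>y. K x y $ i $ j * (g y * v (j, y)) \<partial>lborel)" for j
        unfolding Bochner_Integration.integral_mult_left_zero[symmetric]
        using g_pos by (intro Bochner_Integration.integral_cong refl)
          (auto simp: b_def scaleR_conv_of_real power2_eq_square less_imp_neq[symmetric])
      ultimately show ?thesis by (simp add: sum_distrib_right)
    qed
    show ?thesis
    proof
      assume ?V
      then obtain v C where v: "v \<in> borel_measurable indexed_measure" "\<And>s. cmod (v s) \<le> C" "\<not> (AE s in indexed_measure. v s = 0)"
        "\<And>s. v s = - (\<integral>t. b s t * v t \<partial>indexed_measure)" by blast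
      define w where "w i x = g x * v (i, x)" for i x
      have "w i \<in> borel_measurable lborel" for i
        unfolding w_def using measurable_indexed_section[OF v(1)] by measurable
      moreover have "cmod (w i x) \<le> C * g x" for i x
        using v(2)[of "(i, x)"] g_pos[of x] by (simp add: w_def norm_mult mult.commute mult_left_mono)
      moreover have "\<exists>i. \<not> (AE x in lborel. w i x = 0)"
      proof (rule ccontr)
        assume "\<not> ?thesis"
        hence "AE x in lborel. v (i, x) = 0" for i
          using g_pos by (auto simp: w_def less_imp_neq[symmetric])
        hence "AE s in indexed_measure. v s = 0" using v(1) by (subst AE_indexed_iff) auto
        thus False using v(3) by blast
      qed
      moreover have "w i x = - (\<Sum>j\<in>UNIV. \<integral>y. K x y $ i $ j * w j y \<partial>lborel)" for i x
        unfolding w_def main[OF v(1,2), of i x, symmetric] by (subst v(4)) simp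
      ultimately show ?W by blast
    next
      assume ?W
      then obtain w C where w: "\<And>i. w i \<in> borel_measurable lborel" "\<And>i x. cmod (w i x) \<le> C * g x"
        "\<exists>i. \<not> (AE x in lborel. w i x = 0)"
        "\<And>i x. w i x = - (\<Sum>j\<in>UNIV. \<integral>y. K x y $ i $ j * w j y \<partial>lborel)" by blast
      define v where "v p = w (fst p) (snd p) / g (snd p)" for p :: "'m \<times> real"
      have wv: "w i x = g x * v (i, x)" for i x using g_pos[of x] by (simp add: v_def)
      have vm: "v \<in> borel_measurable indexed_measure"
      proof -
        have fst: "fst \<in> (indexed_measure :: ('m \<times> real) measure) \<rightarrow>\<^sub>M count_space UNIV"
          and snd: "snd \<in> (indexed_measure :: ('m \<times> real) measure) \<rightarrow>\<^sub>M lborel"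
          unfolding indexed_measure_def by measurable
        have "(\<lambda>p. w i (snd p) / g (snd p)) \<in> borel_measurable (indexed_measure :: ('m \<times> real) measure)" for i
          using measurable_compose[OF snd w(1)[of i]] measurable_compose[OF snd g_measurable] by simp
        note W = this
        define F where "F i p = w i (snd p) / g (snd p)" for i and p :: "'m \<times> real"
        have "(\<lambda>p. F (fst p) p) \<in> borel_measurable (indexed_measure :: ('m \<times> real) measure)"
        proof (rule measurable_compose_countable'[where f=F and I=UNIV])
          show "F i \<in> borel_measurable (indexed_measure :: ('m \<times> real) measure)" for i unfolding F_def using W by simp
        qed (use fst in \<open>simp_all add: countable_finite\<close>)
        thus ?thesis unfolding v_def F_def .
      qed
      moreover have vC: "cmod (v s) \<le> C" for s
        using w(2)[of "fst s" "snd s"] g_pos[of "snd s"] by (simp add: v_def norm_divide divide_le_eq)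
      moreover have "\<not> (AE s in indexed_measure. v s = 0)"
      proof
        assume "AE s in indexed_measure. v s = 0"
        hence *: "AE x in lborel. v (i, x) = 0" for i using vm by (subst (asm) AE_indexed_iff) auto
        have "AE x in lborel. w i x = 0" for i using *[of i] unfolding wv by eventually_elim simp
        thus False using w(3) by blast
      qed
      moreover have "v s = - (\<integral>t. b s t * v t \<partial>indexed_measure)" for s
      proof -
        obtain i x where s: "s = (i, x)" by (cases s)
        have "w i x = - ((\<integral>t. b (i, x) t * v t \<partial>indexed_measure) * g x)"
          unfolding main[OF vm vC, of i x] by (subst w(4)) (simp add: wv)
        thus ?thesis using g_pos[of x] by (simp add: s v_def[of "(i,x)"] field_simps)
      qed
      ultimately show ?V by blast
    qed
  qed
  finally show ?thesis .
qed

end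

section \<open>Spectral resolution and the explicit kernel\<close>

lemma mat_mult_nth: "(mat c ** P) $ i $ j = c * P $ i $ j"
  for P :: "'a::comm_ring_1^'n^'m"
proof -
  have "(\<Sum>k\<in>UNIV. (if i = k then c else 0) * P $ k $ j) = (\<Sum>k\<in>UNIV. if k = i then c * P $ k $ j else 0)"
    by (intro sum.cong) auto
  thus ?thesis by (simp add: matrix_matrix_mult_def mat_def)
qed

lemma mult_mat_nth: "(P ** mat c) $ i $ j = c * P $ i $ j"
  for P :: "'a::comm_ring_1^'n^'m"
proof -
  have "(\<Sum>k\<in>UNIV. P $ i $ k * (if k = j then c else 0)) = (\<Sum>k\<in>UNIV. if k = j then c * P $ i $ k else 0)"
    by (intro sum.cong) auto
  thus ?thesis by (simp add: matrix_matrix_mult_def mat_def)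
qed

lemma mat_commute: "P ** mat c = mat c ** P" for P :: "'a::comm_ring_1^'n^'n"
  by (simp add: vec_eq_iff mat_mult_nth mult_mat_nth)

lemma mat_mat_mult: "mat c ** (mat d ** P) = mat (c * d) ** P" for P :: "'a::comm_ring_1^'n^'n"
  by (simp add: vec_eq_iff mat_mult_nth mult.assoc)

lemma mat_mult_vec: "(mat c ** P) *v v = c *s (P *v v)" for P :: "'a::comm_ring_1^'n^'n"
  by (simp add: vec_eq_iff matrix_vector_mult_def mat_mult_nth sum_distrib_left mult.assoc)

lemma matrix_mult_sum_right: "finite I \<Longrightarrow> A ** (\<Sum>i\<in>I. F i) = (\<Sum>i\<in>I. A ** F i)"
  for A :: "'a::comm_ring_1^'n^'m" and F :: "'i \<Rightarrow> 'a^'k^'n"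
  by (induction I rule: finite_induct) (auto simp: matrix_add_ldistrib)

lemma matrix_mult_sum_left: "finite I \<Longrightarrow> (\<Sum>i\<in>I. F i) ** A = (\<Sum>i\<in>I. F i ** A)"
  for A :: "'a::comm_ring_1^'k^'n" and F :: "'i \<Rightarrow> 'a^'n^'m"
  by (induction I rule: finite_induct) (auto simp: vec_eq_iff matrix_matrix_mult_def sum.distrib distrib_right)

lemma sum_matrix_vector_mult: "finite I \<Longrightarrow> (\<Sum>i\<in>I. F i) *v v = (\<Sum>i\<in>I. F i *v v)"
  for F :: "'i \<Rightarrow> 'a::comm_ring_1^'n^'m"
  by (induction I rule: finite_induct) (auto simp: matrix_vector_mult_add_rdistrib)

section \<open>Functional calculus of a diagonalisable matrix\<close>

locale spectral_resolution =
  fixes P :: "'k::finite \<Rightarrow> complex^'n^'n" and ev :: "'k \<Rightarrow> complex" and A :: "complex^'n^'n"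
  assumes P_mult: "P i ** P j = (if i = j then P i else 0)"
    and P_sum: "(\<Sum>i\<in>UNIV. P i) = mat 1"
    and A_eq: "A = (\<Sum>i\<in>UNIV. mat (ev i) ** P i)"
begin

text \<open>Complex multiples are written \<open>mat c ** P i\<close>, since scaleR only offers real
  ones. The values \<open>ev i\<close> may repeat, so r1 = r2 needs no separate case later.\<close>

lemma comb_mult:
  "(\<Sum>i\<in>I. mat (c i) ** P i) ** (\<Sum>j\<in>J. mat (d j) ** P j) = (\<Sum>i\<in>I \<inter> J. mat (c i * d i) ** P i)"
proof -
  have "(\<Sum>i\<in>I. mat (c i) ** P i) ** (mat (d j) ** P j) = (if j \<in> I then mat (c j * d j) ** P j else 0)" for j
  proof -
    have "(mat (c i) ** P i) ** (mat (d j) ** P j) = (if i = j then mat (c j * d j) ** P j else 0)" for i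
    proof -
      have "(mat (c i) ** P i) ** (mat (d j) ** P j) = mat (c i) ** (P i ** mat (d j)) ** P j"
        by (simp add: matrix_mul_assoc)
      also have "\<dots> = mat (c i) ** (mat (d j) ** (P i ** P j))"
        unfolding mat_commute[of "P i"] by (simp add: matrix_mul_assoc)
      finally show ?thesis by (simp add: mat_mat_mult P_mult)
    qed
    thus ?thesis by (simp add: matrix_mult_sum_left)
  qed
  thus ?thesis by (simp add: matrix_mult_sum_right sum.If_cases Int_commute)
qed

lemma mpow_eq: "mpow A k = (\<Sum>i\<in>UNIV. mat (ev i ^ k) ** P i)"
proof (induction k)
  case 0
  show ?case by (simp add: mpow_def P_sum)
next
  case (Suc k)
  have "mpow A (Suc k) = A ** mpow A k" by (simp add: mpow_def)
  thus ?case unfolding Suc by (simp add: A_eq comb_mult)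
qed

lemma mexp_eq: "mexp A = (\<Sum>i\<in>UNIV. mat (exp (ev i)) ** P i)"
proof -
  have bl: "bounded_linear (\<lambda>c. mat c ** P i)" for i
    by (intro linear_conv_bounded_linear[THEN iffD1] linearI)
       (simp_all add: vec_eq_iff mat_mult_nth algebra_simps)
  have "(\<lambda>k. mat (ev i ^ k /\<^sub>R fact k) ** P i) sums (mat (exp (ev i)) ** P i)" for i
    by (rule bounded_linear.sums[OF bl exp_converges])
  hence "(\<lambda>k. \<Sum>i\<in>UNIV. mat (ev i ^ k /\<^sub>R fact k) ** P i) sums (\<Sum>i\<in>UNIV. mat (exp (ev i)) ** P i)"
    by (intro sums_sum)
  moreover have "(\<Sum>i\<in>UNIV. mat (ev i ^ k /\<^sub>R fact k) ** P i) = (1 / fact k) *\<^sub>R mpow A k" for k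
    unfolding mpow_eq scaleR_sum_right
    by (intro sum.cong refl) (simp add: vec_eq_iff mat_mult_nth divide_inverse)
  ultimately show ?thesis unfolding mexp_def by (simp add: sums_iff)
qed

text \<open>\<open>A - mat z\<close> has the same projections with eigenvalues
  \<open>ev i - z\<close>, so its power annihilates exactly the components with
  \<open>ev i = z\<close>. The real span suffices because each component \<open>P i *v v\<close>
  already lies in a generalized eigenspace.\<close>

lemma span_gen_eigenspaces:
  "span (\<Union>{gen_eigenspace A z | z. S z}) = {v. (\<Sum>i | S (ev i). P i) *v v = v}"
proof -
  define Q where "Q = (\<Sum>i | S (ev i). P i)"
  have shift: "spectral_resolution P (\<lambda>i. ev i - z) (A - mat z)" for z
  proof
    have "mat z = (\<Sum>i\<in>UNIV. mat z ** P i)"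
      using P_sum by (simp add: matrix_mult_sum_right[symmetric])
    thus "A - mat z = (\<Sum>i\<in>UNIV. mat (ev i - z) ** P i)"
      unfolding A_eq by (simp add: sum_subtractf[symmetric] vec_eq_iff mat_mult_nth algebra_simps)
  qed (use P_mult P_sum in auto)
  have gen: "gen_eigenspace A z = {v. (\<Sum>i\<in>UNIV. mat ((ev i - z) ^ CARD('n)) ** P i) *v v = 0}" for z
    unfolding gen_eigenspace_def spectral_resolution.mpow_eq[OF shift] ..
  have decomp: "v = (\<Sum>i\<in>UNIV. P i *v v)" for v
    using arg_cong[OF P_sum, of "\<lambda>M. M *v v"] by (simp add: sum_matrix_vector_mult)
  have Qv: "Q *v v = (\<Sum>i | S (ev i). P i *v v)" for v
    unfolding Q_def by (simp add: sum_matrix_vector_mult)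
  have kill: "P j *v v = 0" if "v \<in> gen_eigenspace A z" "ev j \<noteq> z" for v z j
  proof -
    have "P j *v ((\<Sum>i\<in>UNIV. mat ((ev i - z) ^ CARD('n)) ** P i) *v v) = 0"
      using that(1) unfolding gen by simp
    moreover have "P j ** (\<Sum>i\<in>UNIV. mat ((ev i - z) ^ CARD('n)) ** P i) = mat ((ev j - z) ^ CARD('n)) ** P j"
      using comb_mult[of "\<lambda>_. 1" "{j}" "\<lambda>i. (ev i - z) ^ CARD('n)" UNIV] by simp
    ultimately have "(ev j - z) ^ CARD('n) *s (P j *v v) = 0"
      by (simp add: matrix_vector_mul_assoc mat_mult_vec)
    thus ?thesis using that(2) by (simp add: vec_eq_iff)
  qed
  have sc: "Q *v (c *\<^sub>R v) = c *\<^sub>R (Q *v v)" for c v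
    by (simp add: vec_eq_iff matrix_vector_mult_def scaleR_sum_right)
  have sub: "subspace {v. Q *v v = v}"
    unfolding subspace_def by (simp add: matrix_vector_right_distrib sc)
  have "gen_eigenspace A z \<subseteq> {v. Q *v v = v}" if "S z" for z
  proof (clarify)
    fix v assume v: "v \<in> gen_eigenspace A z"
    have "(\<Sum>i | S (ev i). P i *v v) = (\<Sum>i\<in>UNIV. P i *v v)"
    proof (rule sum.mono_neutral_left)
      show "\<forall>i\<in>UNIV - {i. S (ev i)}. P i *v v = 0"
      proof
        fix i assume "i \<in> UNIV - {i. S (ev i)}"
        hence "ev i \<noteq> z" using that by auto
        thus "P i *v v = 0" by (rule kill[OF v])
      qed
    qed auto
    thus "Q *v v = v" using decomp[of v] Qv by simp
  qed
  hence "span (\<Union>{gen_eigenspace A z | z. S z}) \<subseteq> {v. Q *v v = v}"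
    by (intro span_minimal sub) blast
  moreover have "v \<in> span (\<Union>{gen_eigenspace A z | z. S z})" if "Q *v v = v" for v
  proof -
    have "P i *v v \<in> gen_eigenspace A (ev i)" for i
    proof -
      have "(\<Sum>j\<in>UNIV. mat ((ev j - ev i) ^ CARD('n)) ** P j) ** P i = 0"
        using comb_mult[of "\<lambda>j. (ev j - ev i) ^ CARD('n)" UNIV "\<lambda>_. 1" "{i}"]
        by (simp add: vec_eq_iff mat_mult_nth)
      thus ?thesis unfolding gen by (simp add: matrix_vector_mul_assoc)
    qed
    hence "(\<Sum>i | S (ev i). P i *v v) \<in> span (\<Union>{gen_eigenspace A z | z. S z})"
      by (intro span_sum span_base) auto
    thus ?thesis using that Qv by simp
  qed
  ultimately show ?thesis unfolding Q_def by blast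
qed

text \<open>Without eigenvalues on the imaginary axis the stable and unstable projections add up to
  the identity. The definite description is then resolved because an idempotent is determined by its
  range and kernel.\<close>

lemma stable_proj_eq:
  assumes "\<And>i. Re (ev i) \<noteq> 0"
  shows "stable_proj A = (\<Sum>i | Re (ev i) < 0. P i)"
proof -
  define Q where "Q = (\<Sum>i | Re (ev i) < 0. P i)"
  define R where "R = (\<Sum>i | Re (ev i) > 0. P i)"
  have idem: "Q ** Q = Q" using comb_mult[of "\<lambda>_. 1" "{i. Re (ev i) < 0}" "\<lambda>_. 1" "{i. Re (ev i) < 0}"]
    by (simp add: Q_def)
  have "Q + R = (\<Sum>i\<in>{i. Re (ev i) < 0} \<union> {i. Re (ev i) > 0}. P i)"
    unfolding Q_def R_def by (subst sum.union_disjoint) auto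
  also have "{i. Re (ev i) < 0} \<union> {i. Re (ev i) > 0} = UNIV" using assms by (auto simp: neq_iff)
  finally have QR: "Q + R = mat 1" using P_sum by simp
  have range: "range ((*v) Q) = {v. Q *v v = v}"
    using idem by (auto simp: matrix_vector_mul_assoc) (metis rangeI)
  have R: "R *v v = v \<longleftrightarrow> Q *v v = 0" for v
    using arg_cong[OF QR, of "\<lambda>M. M *v v"] by (auto simp: matrix_vector_mult_add_rdistrib)
  have Q: "Q ** Q = Q \<and> range ((*v) Q) = stable_subspace A \<and> {v. Q *v v = 0} = unstable_subspace A"
    unfolding stable_subspace_def unstable_subspace_def span_gen_eigenspaces[of "\<lambda>z. Re z < 0"]
      span_gen_eigenspaces[of "\<lambda>z. Re z > 0"] Q_def[symmetric] R_def[symmetric] range R using idem by simp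
  show ?thesis
    unfolding stable_proj_def Q_def[symmetric]
  proof (rule the_equality, rule Q)
    fix T assume T: "T ** T = T \<and> range ((*v) T) = stable_subspace A \<and> {v. T *v v = 0} = unstable_subspace A"
    \<comment> \<open>Split v = Q v + (v - Q v): a competitor fixes the first part, which lies in
      its range, and kills the second, which lies in its kernel.\<close>
    have "T *v v = Q *v v" for v
    proof -
      have "Q *v v \<in> range ((*v) T)" using T Q by (metis rangeI)
      then obtain u where u: "Q *v v = T *v u" by blast
      have 1: "T *v (Q *v v) = Q *v v" unfolding u using T by (simp add: matrix_vector_mul_assoc)
      have "Q *v (v - Q *v v) = 0" using idem by (simp add: matrix_vector_mult_diff_distrib matrix_vector_mul_assoc)
      hence "T *v (v - Q *v v) = 0" using T Q by blast
      thus ?thesis using 1 by (simp add: matrix_vector_mult_diff_distrib)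
    qed
    thus "T = Q" by (simp add: matrix_eq)
  qed
qed

lemma stable_proj_mexp:
  assumes "\<And>i. Re (ev i) \<noteq> 0"
  shows "stable_proj A ** mexp (t *\<^sub>R A) ** stable_proj A = (\<Sum>i | Re (ev i) < 0. mat (exp (t *\<^sub>R ev i)) ** P i)"
    and "(mat 1 - stable_proj A) ** mexp (t *\<^sub>R A) ** (mat 1 - stable_proj A) = (\<Sum>i | Re (ev i) > 0. mat (exp (t *\<^sub>R ev i)) ** P i)"
proof -
  have "spectral_resolution P (\<lambda>i. t *\<^sub>R ev i) (t *\<^sub>R A)"
  proof
    show "t *\<^sub>R A = (\<Sum>i\<in>UNIV. mat (t *\<^sub>R ev i) ** P i)"
      unfolding A_eq scaleR_sum_right by (simp add: vec_eq_iff mat_mult_nth)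
  qed (use P_mult P_sum in auto)
  note E = spectral_resolution.mexp_eq[OF this]
  have "mat 1 - stable_proj A = (\<Sum>i\<in>UNIV - {i. Re (ev i) < 0}. P i)"
    unfolding stable_proj_eq[OF assms] P_sum[symmetric] by (simp add: sum_diff)
  also have "UNIV - {i. Re (ev i) < 0} = {i. Re (ev i) > 0}" using assms by (auto simp: not_less le_less)
  finally have F: "mat 1 - stable_proj A = (\<Sum>i | Re (ev i) > 0. P i)" .
  show "stable_proj A ** mexp (t *\<^sub>R A) ** stable_proj A = (\<Sum>i | Re (ev i) < 0. mat (exp (t *\<^sub>R ev i)) ** P i)"
    unfolding E stable_proj_eq[OF assms]
    using comb_mult[of "\<lambda>_. 1" "{i. Re (ev i) < 0}" "\<lambda>i. exp (t *\<^sub>R ev i)" UNIV]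
      comb_mult[of "\<lambda>i. exp (t *\<^sub>R ev i)" "{i. Re (ev i) < 0}" "\<lambda>_. 1" "{i. Re (ev i) < 0}"] by simp
  show "(mat 1 - stable_proj A) ** mexp (t *\<^sub>R A) ** (mat 1 - stable_proj A) = (\<Sum>i | Re (ev i) > 0. mat (exp (t *\<^sub>R ev i)) ** P i)"
    unfolding E F
    using comb_mult[of "\<lambda>_. 1" "{i. Re (ev i) > 0}" "\<lambda>i. exp (t *\<^sub>R ev i)" UNIV]
      comb_mult[of "\<lambda>i. exp (t *\<^sub>R ev i)" "{i. Re (ev i) > 0}" "\<lambda>_. 1" "{i. Re (ev i) > 0}"] by simp
qed

end

text \<open>\<open>eig2 p q\<close> acts as \<open>p\<close> on \<open>(1, -\<i>)\<close> and as \<open>q\<close> on \<open>(1, \<i>)\<close>, the common eigenvectors of all \<open>rc a b\<close>.\<close>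

definition eig2 :: "complex \<Rightarrow> complex \<Rightarrow> complex^2^2" where
  "eig2 p q = (\<chi> i j. if i = j then (p + q) / 2 else if i = 1 then \<i> * (p - q) / 2 else - \<i> * (p - q) / 2)"

lemma eig2_mult: "eig2 p q ** eig2 p' q' = eig2 (p * p') (q * q')"
  by (simp add: vec_eq_iff forall_2 matrix_matrix_mult_def sum_2 eig2_def field_simps)

lemma eig2_add: "eig2 p q + eig2 p' q' = eig2 (p + p') (q + q')"
  by (simp add: vec_eq_iff forall_2 eig2_def field_simps)

lemma eig2_minus: "- eig2 p q = eig2 (- p) (- q)"
  by (simp add: vec_eq_iff forall_2 eig2_def field_simps)

lemma eig2_diff: "eig2 p q - eig2 p' q' = eig2 (p - p') (q - q')"
  by (simp add: vec_eq_iff forall_2 eig2_def field_simps)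

lemma mat_eig2: "mat c = eig2 c c"
  by (simp add: vec_eq_iff forall_2 mat_def eig2_def)

lemma zero_eig2: "0 = eig2 0 0"
  by (simp add: vec_eq_iff forall_2 eig2_def)

lemma cplx_rc: "cplx (rc a b) = eig2 (Complex a b) (Complex a (- b))"
  by (simp add: vec_eq_iff forall_2 cplx_def rc_def eig2_def complex_eq_iff)

lemma cplx_mult: "cplx (A ** B) = cplx A ** cplx B"
  by (simp add: vec_eq_iff cplx_def matrix_matrix_mult_def)

lemma cplx_add: "cplx (A + B) = cplx A + cplx B"
  by (simp add: vec_eq_iff cplx_def)

lemma matrix_inv_rc:
  assumes "(a, b) \<noteq> (0, 0)"
  shows "cplx (matrix_inv (rc a b)) = eig2 (1 / Complex a b) (1 / Complex a (- b))"
proof -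
  define n where "n = a\<^sup>2 + b\<^sup>2"
  define B where "B = rc (a / n) (- b / n)"
  have n0: "n \<noteq> 0" using assms by (simp add: n_def sum_power2_eq_zero_iff)
  have n: "a * a / n + b * b / n = 1" "b * b / n + a * a / n = 1"
    using n0 by (simp_all add: add_divide_distrib[symmetric]) (simp_all add: n_def power2_eq_square)
  have "rc a b ** B = mat 1" "B ** rc a b = mat 1"
    using n by (simp_all add: vec_eq_iff forall_2 matrix_matrix_mult_def sum_2 rc_def B_def mat_def)
  note B = this
  have "rc a b ** matrix_inv (rc a b) = mat 1"
    unfolding matrix_inv_def by (rule someI2[of _ B]) (use B in auto)
  hence inv: "matrix_inv (rc a b) = B"
    by (metis B(2) matrix_mul_assoc matrix_mul_lid matrix_mul_rid)
  have "1 / Complex a b = Complex (a / (a\<^sup>2 + b\<^sup>2)) (- b / (a\<^sup>2 + b\<^sup>2))"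
    by (simp add: complex_eq_iff Re_divide Im_divide)
  moreover have "1 / Complex a (- b) = Complex (a / (a\<^sup>2 + b\<^sup>2)) (b / (a\<^sup>2 + b\<^sup>2))"
    by (simp add: complex_eq_iff Re_divide Im_divide)
  ultimately show ?thesis unfolding inv B_def n_def cplx_rc by simp
qed

section \<open>Block matrices and the first-order system\<close>

lemma sum_UNIV_Plus: "(\<Sum>k\<in>UNIV. f k) = (\<Sum>i\<in>UNIV. f (Inl i)) + (\<Sum>j\<in>UNIV. f (Inr j))"
  for f :: "'a::finite + 'b::finite \<Rightarrow> 'c::comm_monoid_add"
  unfolding UNIV_Plus_UNIV[symmetric] by (subst sum.Plus) (auto)

lemma blockm_nth [simp]:
  "blockm A B C D $ Inl i $ Inl j = A $ i $ j" "blockm A B C D $ Inl i $ Inr j = B $ i $ j"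
  "blockm A B C D $ Inr i $ Inl j = C $ i $ j" "blockm A B C D $ Inr i $ Inr j = D $ i $ j"
  by (simp_all add: blockm_def)

lemma vec4_eq_iff: "(M = N) \<longleftrightarrow> (\<forall>i j. M $ Inl i $ Inl j = N $ Inl i $ Inl j \<and> M $ Inl i $ Inr j = N $ Inl i $ Inr j \<and>
    M $ Inr i $ Inl j = N $ Inr i $ Inl j \<and> M $ Inr i $ Inr j = N $ Inr i $ Inr j)"
  for M N :: "'a^idx4^idx4"
  unfolding vec_eq_iff by (metis sum.exhaust)

lemma blockm_mult:
  "blockm A B C D ** blockm A' B' C' D' =
     blockm (A ** A' + B ** C') (A ** B' + B ** D') (C ** A' + D ** C') (C ** B' + D ** D')"
  by (simp add: vec4_eq_iff matrix_matrix_mult_def sum_UNIV_Plus)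

lemma blockm_add: "blockm A B C D + blockm A' B' C' D' = blockm (A + A') (B + B') (C + C') (D + D')"
  by (simp add: vec4_eq_iff)

lemma blockm_minus: "- blockm A B C D = blockm (- A) (- B) (- C) (- D)"
  by (simp add: vec4_eq_iff)

lemma mat_blockm: "mat c ** blockm A B C D = blockm (mat c ** A) (mat c ** B) (mat c ** C) (mat c ** D)"
  by (simp add: vec4_eq_iff mat_mult_nth)

lemma mat_1_blockm: "mat 1 = blockm (mat 1) 0 0 (mat 1)"
  by (simp add: vec4_eq_iff mat_def)

lemma zero_blockm: "0 = blockm 0 0 0 0"
  by (simp add: vec4_eq_iff)

text \<open>For the block C with rows (0, 1) and (r^2, 0), the projection onto the eigenvalue s r
  along -s r is (1 + s C / r) / 2; these are its four entries. The first flag selects the decaying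
  sign s = -1, the second selects r1 over r2 together with its eigenvector of the coefficient
  matrices.\<close>

definition eproj :: "complex \<Rightarrow> complex \<Rightarrow> bool \<times> bool \<Rightarrow> complex^idx4^idx4" where
  "eproj r1 r2 sc = (let s = (if fst sc then - 1 else 1); r = (if snd sc then r1 else r2);
      E = (\<lambda>c. if snd sc then eig2 c 0 else eig2 0 c) in blockm (E (1/2)) (E (s / (2 * r))) (E (s * r / 2)) (E (1/2)))"

definition eval4 :: "complex \<Rightarrow> complex \<Rightarrow> bool \<times> bool \<Rightarrow> complex" where
  "eval4 r1 r2 sc = (if fst sc then - 1 else 1) * (if snd sc then r1 else r2)"

lemma sum_bool2: "(\<Sum>i\<in>UNIV. f i) = f (True,True) + f (True,False) + f (False,True) + f (False,False)"
  for f :: "bool \<times> bool \<Rightarrow> 'a::comm_monoid_add"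
  by (simp add: UNIV_Times_UNIV[symmetric] sum.cartesian_product[symmetric] UNIV_bool ac_simps del: UNIV_Times_UNIV)

lemma spectral_resolution_eproj:
  assumes "r1 \<noteq> 0" "r2 \<noteq> 0"
  shows "spectral_resolution (eproj r1 r2) (eval4 r1 r2) (blockm 0 (mat 1) (eig2 (r1\<^sup>2) (r2\<^sup>2)) 0)"
proof
  fix i j :: "bool \<times> bool"
  obtain s c s' c' where ij: "i = (s, c)" "j = (s', c')" by (cases i, cases j) auto
  show "eproj r1 r2 i ** eproj r1 r2 j = (if i = j then eproj r1 r2 i else 0)"
    using assms unfolding ij
    by (cases s; cases c; cases s'; cases c')
       (simp_all add: eproj_def Let_def blockm_mult eig2_mult eig2_add zero_blockm zero_eig2)
next
  show "(\<Sum>i\<in>UNIV. eproj r1 r2 i) = mat 1"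
    using assms by (simp add: sum_bool2 eproj_def Let_def blockm_add eig2_add mat_1_blockm mat_eig2 zero_eig2)
next
  show "blockm 0 (mat 1) (eig2 (r1\<^sup>2) (r2\<^sup>2)) 0 = (\<Sum>i\<in>UNIV. mat (eval4 r1 r2 i) ** eproj r1 r2 i)"
    using assms
    by (simp add: sum_bool2 eproj_def Let_def eval4_def mat_blockm mat_eig2 eig2_mult blockm_add eig2_add zero_eig2 power2_eq_square)
qed

lemma Ainf_eq:
  assumes "(D, \<beta>) \<noteq> (0, 0)"
    and "(lam - Complex \<delta> \<alpha>) / Complex \<beta> (D/2) = r1\<^sup>2" "(lam - Complex \<delta> (- \<alpha>)) / Complex \<beta> (- D/2) = r2\<^sup>2"
  shows "Ainf D \<beta> \<delta> \<alpha> lam = blockm 0 (mat 1) (eig2 (r1\<^sup>2) (r2\<^sup>2)) 0"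
proof -
  have "cplx (matrix_inv (rc \<beta> (D/2))) = eig2 (1 / Complex \<beta> (D/2)) (1 / Complex \<beta> (- (D/2)))"
    by (rule matrix_inv_rc) (use assms(1) in auto)
  thus ?thesis
    using assms(2,3) by (simp add: Ainf_def cplx_rc mat_eig2 eig2_diff eig2_mult)
qed

text \<open>The weights \<open>Rr\<close> and \<open>Rl\<close> single out the upper right block of
  the propagator. That block has opposite signs in its stable and unstable parts, and the two
  branches of the kernel carry opposite signs as well, so both yield the same function of \<bar>x -
  y\<bar> between the weights.\<close>

lemma Kker_eq:
  fixes D \<beta> \<delta> \<alpha> \<epsilon> \<gamma> \<mu> \<nu> x y :: real and \<psi> :: "real \<Rightarrow> complex" and lam r1 r2 :: complex
  assumes "(D, \<beta>) \<noteq> (0, 0)"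
    and r: "(lam - Complex \<delta> \<alpha>) / Complex \<beta> (D/2) = r1\<^sup>2" "(lam - Complex \<delta> (- \<alpha>)) / Complex \<beta> (- D/2) = r2\<^sup>2"
    and Re: "Re r1 > 0" "Re r2 > 0"
  defines "S \<equiv> \<lambda>x. cplx (psd_sqrt (absm (Mmat \<epsilon> \<gamma> \<mu> \<nu> \<psi> x)))"
    and "T \<equiv> \<lambda>y. cplx (polarV (Mmat \<epsilon> \<gamma> \<mu> \<nu> \<psi> y) ** psd_sqrt (absm (Mmat \<epsilon> \<gamma> \<mu> \<nu> \<psi> y)))"
  shows "Kker D \<beta> \<delta> \<alpha> \<epsilon> \<gamma> \<mu> \<nu> \<psi> lam x y = blockm
     (- (S x ** eig2 (exp (- r1 * \<bar>x - y\<bar>) / (2 * r1) / Complex \<beta> (D/2)) (exp (- r2 * \<bar>x - y\<bar>) / (2 * r2) / Complex \<beta> (- D/2)) ** T y)) 0 0 0"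
proof -
  define A where "A = Ainf D \<beta> \<delta> \<alpha> lam"
  have r0: "r1 \<noteq> 0" "r2 \<noteq> 0" using Re by auto
  interpret spectral_resolution "eproj r1 r2" "eval4 r1 r2" A
    unfolding A_def Ainf_eq[OF assms(1-3)] by (rule spectral_resolution_eproj[OF r0])
  have Re0: "Re (eval4 r1 r2 i) \<noteq> 0" for i using Re by (auto simp: eval4_def)
  note se = stable_proj_mexp[OF Re0]
  have sets: "{i. Re (eval4 r1 r2 i) < 0} = {(True,True),(True,False)}" "{i. Re (eval4 r1 r2 i) > 0} = {(False,True),(False,False)}"
    using Re by (auto simp: eval4_def split: if_splits)
  have Rl: "Rl D \<beta> \<epsilon> \<gamma> \<mu> \<nu> \<psi> y = blockm 0 0 (- (eig2 (1 / Complex \<beta> (D/2)) (1 / Complex \<beta> (- D/2)) ** T y)) 0"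
  proof -
    have "cplx (matrix_inv (rc \<beta> (D/2))) = eig2 (1 / Complex \<beta> (D/2)) (1 / Complex \<beta> (- (D/2)))"
      by (rule matrix_inv_rc) (use assms(1) in auto)
    thus ?thesis by (simp add: Rl_def Let_def T_def cplx_mult matrix_mul_assoc)
  qed
  have Rr: "Rr \<epsilon> \<gamma> \<mu> \<nu> \<psi> x = blockm (S x) 0 0 0" by (simp add: Rr_def S_def)
  have neg: "M ** (- N) = - (M ** N)" for M N :: "complex^2^2"
    by (simp add: vec_eq_iff matrix_matrix_mult_def sum_negf)
  have neg': "(- M) ** N = - (M ** N)" for M N :: "complex^2^2"
    by (simp add: vec_eq_iff matrix_matrix_mult_def sum_negf)
  have neg3: "- (M ** eig2 p q ** N) = M ** eig2 (- p) (- q) ** N" for M N :: "complex^2^2" and p q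
    unfolding eig2_minus[symmetric] neg neg' ..
  have z: "M ** 0 = 0" "0 ** M = 0" for M :: "complex^2^2"
    by (simp_all add: vec_eq_iff matrix_matrix_mult_def)
  show ?thesis
  proof (cases "y \<le> x")
    case True
    have "Kker D \<beta> \<delta> \<alpha> \<epsilon> \<gamma> \<mu> \<nu> \<psi> lam x y = - (blockm (S x) 0 0 0 **
        (stable_proj A ** mexp ((x - y) *\<^sub>R A) ** stable_proj A) ** Rl D \<beta> \<epsilon> \<gamma> \<mu> \<nu> \<psi> y)"
      using True by (simp add: Kker_def Let_def A_def Rr matrix_mul_assoc)
    also have "stable_proj A ** mexp ((x - y) *\<^sub>R A) ** stable_proj A =
       blockm (eig2 (exp (- r1 * \<bar>x - y\<bar>) / 2) (exp (- r2 * \<bar>x - y\<bar>) / 2))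
          (eig2 (- exp (- r1 * \<bar>x - y\<bar>) / (2 * r1)) (- exp (- r2 * \<bar>x - y\<bar>) / (2 * r2)))
          (eig2 (- exp (- r1 * \<bar>x - y\<bar>) * r1 / 2) (- exp (- r2 * \<bar>x - y\<bar>) * r2 / 2))
          (eig2 (exp (- r1 * \<bar>x - y\<bar>) / 2) (exp (- r2 * \<bar>x - y\<bar>) / 2))"
    proof -
      have e: "exp ((x - y) *\<^sub>R (- r)) = exp (- r * \<bar>x - y\<bar>)" for r :: complex
        using True by (simp add: scaleR_conv_of_real mult.commute)
      show ?thesis unfolding se sets
        by (simp add: eproj_def Let_def eval4_def mat_blockm mat_eig2 eig2_mult blockm_add eig2_add e del: scaleR_minus_right)
    qed
    finally show ?thesis
      by (simp add: Rl blockm_mult blockm_minus neg z matrix_mul_assoc[symmetric] eig2_mult)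
         (simp add: matrix_mul_assoc eig2_mult neg3)
  next
    case False
    have "Kker D \<beta> \<delta> \<alpha> \<epsilon> \<gamma> \<mu> \<nu> \<psi> lam x y = (blockm (S x) 0 0 0 **
        ((mat 1 - stable_proj A) ** mexp ((x - y) *\<^sub>R A) ** (mat 1 - stable_proj A)) ** Rl D \<beta> \<epsilon> \<gamma> \<mu> \<nu> \<psi> y)"
      using False by (simp add: Kker_def Let_def A_def Rr matrix_mul_assoc)
    also have "(mat 1 - stable_proj A) ** mexp ((x - y) *\<^sub>R A) ** (mat 1 - stable_proj A) =
       blockm (eig2 (exp (- r1 * \<bar>x - y\<bar>) / 2) (exp (- r2 * \<bar>x - y\<bar>) / 2))
          (eig2 (exp (- r1 * \<bar>x - y\<bar>) / (2 * r1)) (exp (- r2 * \<bar>x - y\<bar>) / (2 * r2)))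
          (eig2 (exp (- r1 * \<bar>x - y\<bar>) * r1 / 2) (exp (- r2 * \<bar>x - y\<bar>) * r2 / 2))
          (eig2 (exp (- r1 * \<bar>x - y\<bar>) / 2) (exp (- r2 * \<bar>x - y\<bar>) / 2))"
    proof -
      have e: "exp ((x - y) *\<^sub>R r) = exp (- r * \<bar>x - y\<bar>)" for r :: complex
        using False by (simp add: scaleR_conv_of_real algebra_simps)
      show ?thesis unfolding se sets
        by (simp add: eproj_def Let_def eval4_def mat_blockm mat_eig2 eig2_mult blockm_add eig2_add e)
    qed
    finally show ?thesis
      by (simp add: Rl blockm_mult blockm_minus neg z matrix_mul_assoc[symmetric] eig2_mult)
         (simp add: matrix_mul_assoc eig2_mult neg3)
  qed
qed

section \<open>Polar decomposition of real 2x2 matrices\<close>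

definition psd :: "real^'n^'n \<Rightarrow> bool" where
  "psd S \<longleftrightarrow> transpose S = S \<and> (\<forall>v. 0 \<le> v \<bullet> (S *v v))"

lemma mat2_eq_iff: "(A = B) \<longleftrightarrow> A$1$1 = B$1$1 \<and> A$1$2 = B$1$2 \<and> A$2$1 = B$2$1 \<and> A$2$2 = B$2$2"
  for A B :: "'a^2^2"
  by (auto simp: vec_eq_iff forall_2)

lemma mult2_nth: "(A ** B) $ i $ j = A$i$1 * B$1$j + A$i$2 * B$2$j"
  for A B :: "'a::comm_semiring_1^2^2"
  by (simp add: matrix_matrix_mult_def sum_2)

lemma mat2_nth: "(mat c :: 'a::zero^2^2)$1$1 = c" "(mat c :: 'a::zero^2^2)$1$2 = 0" 
  "(mat c :: 'a::zero^2^2)$2$1 = 0" "(mat c :: 'a::zero^2^2)$2$2 = c"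
  by (simp_all add: mat_def)

lemma psd2_iff: "psd S \<longleftrightarrow> S$1$2 = S$2$1 \<and> 0 \<le> S$1$1 \<and> 0 \<le> S$2$2 \<and> (S$1$2)\<^sup>2 \<le> S$1$1 * S$2$2"
  for S :: "real^2^2"
proof -
  have q: "v \<bullet> (S *v v) = S$1$1 * (v$1)\<^sup>2 + (S$1$2 + S$2$1) * (v$1 * v$2) + S$2$2 * (v$2)\<^sup>2" for v
    by (simp add: inner_vec_def sum_2 matrix_vector_mult_def power2_eq_square algebra_simps)
  have tr: "transpose S = S \<longleftrightarrow> S$1$2 = S$2$1"
    by (auto simp: mat2_eq_iff transpose_def)
  show ?thesis
  proof
    assume "psd S"
    hence sym: "S$1$2 = S$2$1" and pos: "\<And>v. 0 \<le> v \<bullet> (S *v v)" by (auto simp: psd_def tr)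
    have p: "0 \<le> S$1$1 * x\<^sup>2 + 2 * S$1$2 * (x * y) + S$2$2 * y\<^sup>2" for x y
      using pos[of "vector [x, y]"] by (simp add: q sym)
    have 1: "0 \<le> S$1$1" "0 \<le> S$2$2" using p[of 1 0] p[of 0 1] by auto
    have "(S$1$2)\<^sup>2 \<le> S$1$1 * S$2$2"
    proof (cases "S$1$1 = 0")
      case True
      have "S$1$2 = 0"
      proof (rule ccontr)
        assume n: "S$1$2 \<noteq> 0"
        \<comment> \<open>With vanishing first diagonal entry and y = 1 the form is affine in x;
          this x gives it the value -1.\<close>
        have "0 \<le> 2 * S$1$2 * (- (S$2$2 + 1) / (2 * S$1$2)) + S$2$2"
          using p[of "- (S$2$2 + 1) / (2 * S$1$2)" 1] True by simp
        also have "\<dots> = - 1" using n by (simp add: field_simps)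
        finally show False by simp
      qed
      thus ?thesis using True by simp
    next
      case False
      \<comment> \<open>On the test vector (-S12, S11) the form equals S11 * det S.\<close>
      have "0 \<le> S$1$1 * (S$1$1 * S$2$2 - (S$1$2)\<^sup>2)"
        using p[of "- S$1$2" "S$1$1"] by (simp add: power2_eq_square algebra_simps)
      thus ?thesis using False 1 by (simp add: zero_le_mult_iff)
    qed
    thus "S$1$2 = S$2$1 \<and> 0 \<le> S$1$1 \<and> 0 \<le> S$2$2 \<and> (S$1$2)\<^sup>2 \<le> S$1$1 * S$2$2" using sym 1 by blast
  next
    assume H: "S$1$2 = S$2$1 \<and> 0 \<le> S$1$1 \<and> 0 \<le> S$2$2 \<and> (S$1$2)\<^sup>2 \<le> S$1$1 * S$2$2"
    have "0 \<le> v \<bullet> (S *v v)" for v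
    proof (cases "S$1$1 = 0")
      case True
      thus ?thesis using H by (auto simp: q)
    next
      case False
      have "S$1$1 * (v \<bullet> (S *v v)) = (S$1$1 * v$1 + S$1$2 * v$2)\<^sup>2 + (S$1$1 * S$2$2 - (S$1$2)\<^sup>2) * (v$2)\<^sup>2"
        using H by (simp add: q power2_eq_square algebra_simps)
      also have "\<dots> \<ge> 0" using H by (intro add_nonneg_nonneg mult_nonneg_nonneg) auto
      finally show ?thesis using False H by (simp add: zero_le_mult_iff)
    qed
    thus "psd S" using H by (simp add: psd_def tr)
  qed
qed

definition sqrt_det :: "real^2^2 \<Rightarrow> real" where "sqrt_det P = sqrt (P$1$1 * P$2$2 - P$1$2 * P$2$1)"
text \<open>The trace of the square root of \<open>P\<close>, not the square root of its
  trace.\<close>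

definition sqrt_trace :: "real^2^2 \<Rightarrow> real" where "sqrt_trace P = sqrt (P$1$1 + P$2$2 + 2 * sqrt_det P)"

text \<open>By Cayley--Hamilton a square root \<open>X\<close> of \<open>P\<close> satisfies \<open>(tr X) X = P + (det X) I\<close>
  with \<open>det X = sqrt (det P)\<close> and \<open>(tr X)\<^sup>2 = tr P + 2 det X\<close>.\<close>

lemma psd_root:
  fixes X P :: "real^2^2"
  assumes X: "psd X" and XP: "X ** X = P"
  shows "sqrt_det P = X$1$1 * X$2$2 - X$1$2 * X$2$1" "sqrt_trace P = X$1$1 + X$2$2" "sqrt_trace P *\<^sub>R X = P + mat (sqrt_det P)"
    "sqrt_trace P = 0 \<longleftrightarrow> X = 0"
proof -
  note x = X[unfolded psd2_iff]
  note p = XP[symmetric]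
  have "P$1$1 * P$2$2 - P$1$2 * P$2$1 = (X$1$1 * X$2$2 - X$1$2 * X$2$1)\<^sup>2"
    unfolding p mult2_nth by (simp add: power2_eq_square algebra_simps)
  moreover have "0 \<le> X$1$1 * X$2$2 - X$1$2 * X$2$1" using x by (auto simp: power2_eq_square)
  ultimately show d: "sqrt_det P = X$1$1 * X$2$2 - X$1$2 * X$2$1" unfolding sqrt_det_def by simp
  have "P$1$1 + P$2$2 + 2 * sqrt_det P = (X$1$1 + X$2$2)\<^sup>2"
    unfolding d unfolding p mult2_nth by (simp add: power2_eq_square algebra_simps)
  thus t: "sqrt_trace P = X$1$1 + X$2$2" unfolding sqrt_trace_def using x by simp
  show "sqrt_trace P *\<^sub>R X = P + mat (sqrt_det P)"
    unfolding mat2_eq_iff t d unfolding p by (simp add: mult2_nth mat2_nth algebra_simps)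
  have "X = 0" if "X$1$1 + X$2$2 = 0"
  proof -
    have 0: "X$1$1 = 0" "X$2$2 = 0" using that x by auto
    hence "X$1$2 = 0" using x by simp
    thus ?thesis using 0 x by (simp add: mat2_eq_iff)
  qed
  thus "sqrt_trace P = 0 \<longleftrightarrow> X = 0" unfolding t by auto
qed

lemma psd_root_unique:
  fixes X Y :: "real^2^2"
  assumes "psd X" "psd Y" "X ** X = Y ** Y"
  shows "X = Y"
proof (cases "sqrt_trace (X ** X) = 0")
  case True
  thus ?thesis using psd_root(4)[OF assms(1) refl] psd_root(4)[OF assms(2) refl] assms(3) by simp
next
  case False
  have "sqrt_trace (X ** X) *\<^sub>R X = sqrt_trace (X ** X) *\<^sub>R Y"
    using psd_root(3)[OF assms(1) refl] psd_root(3)[OF assms(2) refl] assms(3) by simp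
  thus ?thesis using False by simp
qed

lemma psd_sqrt_unique: "psd X \<Longrightarrow> X ** X = P \<Longrightarrow> psd_sqrt P = X" for X P :: "real^2^2"
  unfolding psd_sqrt_def
  by (rule the_equality) (auto simp: psd_def intro!: psd_root_unique[unfolded psd_def])

lemma psd_sqrt2:
  fixes P :: "real^2^2"
  assumes "psd P"
  shows "psd_sqrt P = (1 / sqrt_trace P) *\<^sub>R (P + mat (sqrt_det P))" "psd (psd_sqrt P)" "psd_sqrt P ** psd_sqrt P = P"
proof -
  define X where "X = (1 / sqrt_trace P) *\<^sub>R (P + mat (sqrt_det P))"
  note p = assms[unfolded psd2_iff]
  have d0: "0 \<le> sqrt_det P" using p by (auto simp: sqrt_det_def power2_eq_square)
  have d2: "sqrt_det P * sqrt_det P = P$1$1 * P$2$2 - P$1$2 * P$2$1" using p by (auto simp: sqrt_det_def power2_eq_square)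
  have t0: "0 \<le> sqrt_trace P" using p d0 by (simp add: sqrt_trace_def)
  have t2: "sqrt_trace P * sqrt_trace P = P$1$1 + P$2$2 + 2 * sqrt_det P" using p d0 by (simp add: sqrt_trace_def)
  have X: "psd X \<and> X ** X = P"
  proof (cases "sqrt_trace P = 0")
    \<comment> \<open>Here P = 0, and the convention 1 / 0 = 0 makes the closed formula return the
      correct root 0.\<close>
    case True
    hence "P$1$1 + P$2$2 + 2 * sqrt_det P = 0" using t2 by simp
    hence "P$1$1 = 0" "P$2$2 = 0" using p d0 by auto
    hence "P = 0" using p by (simp add: mat2_eq_iff)
    moreover have "X = 0" using True by (simp add: X_def)
    ultimately show ?thesis by (simp add: psd2_iff mat2_eq_iff mult2_nth)
  next
    case False
    have "(sqrt_trace P *\<^sub>R X) ** (sqrt_trace P *\<^sub>R X) = (sqrt_trace P * sqrt_trace P) *\<^sub>R P"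
      unfolding t2 using False d2 p
      by (simp add: X_def mat2_eq_iff mult2_nth mat2_nth algebra_simps)
    moreover have "(sqrt_trace P *\<^sub>R X) ** (sqrt_trace P *\<^sub>R X) = (sqrt_trace P * sqrt_trace P) *\<^sub>R (X ** X)"
      by (simp add: mat2_eq_iff mult2_nth algebra_simps)
    ultimately have XX: "X ** X = P" using False by simp
    have "(P$1$2)\<^sup>2 \<le> (P$1$1 + sqrt_det P) * (P$2$2 + sqrt_det P)"
    proof -
      have "(P$1$1 + sqrt_det P) * (P$2$2 + sqrt_det P) = P$1$1 * P$2$2 + (sqrt_det P * (P$1$1 + P$2$2) + sqrt_det P * sqrt_det P)"
        by (simp add: algebra_simps)
      moreover have "0 \<le> sqrt_det P * (P$1$1 + P$2$2) + sqrt_det P * sqrt_det P"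
        using p d0 by (intro add_nonneg_nonneg mult_nonneg_nonneg) auto
      ultimately show ?thesis using p by linarith
    qed
    hence "(P$1$2)\<^sup>2 / (sqrt_trace P)\<^sup>2 \<le> (P$1$1 + sqrt_det P) * (P$2$2 + sqrt_det P) / (sqrt_trace P)\<^sup>2" by (rule divide_right_mono) simp
    hence "psd X" using p d0 t0
      by (simp add: psd2_iff X_def mat2_nth power_divide power2_eq_square)
    thus ?thesis using XX by blast
  qed
  have "psd_sqrt P = X" using X by (intro psd_sqrt_unique) auto
  thus "psd_sqrt P = (1 / sqrt_trace P) *\<^sub>R (P + mat (sqrt_det P))" "psd (psd_sqrt P)" "psd_sqrt P ** psd_sqrt P = P"
    using X X_def by auto
qed

text \<open>Every real 2x2 matrix is the sum of a conformal and an anticonformal one; the orthogonal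
  factor of its polar decomposition is the normalisation of the larger of the two parts.\<close>

definition conf_norm :: "real^2^2 \<Rightarrow> real" where
  "conf_norm M = sqrt (((M$1$1 + M$2$2) / 2)\<^sup>2 + ((M$2$1 - M$1$2) / 2)\<^sup>2)"
definition anti_norm :: "real^2^2 \<Rightarrow> real" where
  "anti_norm M = sqrt (((M$1$1 - M$2$2) / 2)\<^sup>2 + ((M$1$2 + M$2$1) / 2)\<^sup>2)"

definition polar_factor :: "real^2^2 \<Rightarrow> real^2^2" where
  "polar_factor M = (if anti_norm M \<le> conf_norm M
     then (1 / conf_norm M) *\<^sub>R (\<chi> i j. if i = j then (M$1$1 + M$2$2) / 2 else if i = 1 then - (M$2$1 - M$1$2) / 2 else (M$2$1 - M$1$2) / 2)
     else (1 / anti_norm M) *\<^sub>R (\<chi> i j. if i = j then (if i = 1 then (M$1$1 - M$2$2) / 2 else - (M$1$1 - M$2$2) / 2) else (M$1$2 + M$2$1) / 2))"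

text \<open>Let W be the normalised larger part. Then the transpose of W times that part is its norm
  times the identity, and times the other part it is traceless and symmetric with eigenvalues plus
  and minus the smaller norm. The sum is thus positive semidefinite, with trace twice the larger
  norm.\<close>

lemma polar_factor_props:
  fixes M :: "real^2^2"
  assumes "M \<noteq> 0"
  shows "orthogonal_matrix (polar_factor M)" "psd (transpose (polar_factor M) ** M)" 
    "(transpose (polar_factor M) ** M)$1$1 + (transpose (polar_factor M) ** M)$2$2 = 2 * max (conf_norm M) (anti_norm M)"
proof -
  define a b c e where "a = (M$1$1 + M$2$2) / 2" and "b = (M$2$1 - M$1$2) / 2" and "c = (M$1$1 - M$2$2) / 2" and "e = (M$1$2 + M$2$1) / 2"
  define r s where "r = conf_norm M" and "s = anti_norm M"
  have m: "M$1$1 = a + c" "M$1$2 = e - b" "M$2$1 = e + b" "M$2$2 = a - c"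
    by (simp_all add: a_def b_def c_def e_def field_simps)
  have r: "r * r = a * a + b * b" "r \<ge> 0" by (auto simp: r_def conf_norm_def a_def b_def power2_eq_square)
  have s: "s * s = c * c + e * e" "s \<ge> 0" by (auto simp: s_def anti_norm_def c_def e_def power2_eq_square)
  show "orthogonal_matrix (polar_factor M)" "psd (transpose (polar_factor M) ** M)" 
    "(transpose (polar_factor M) ** M)$1$1 + (transpose (polar_factor M) ** M)$2$2 = 2 * max (conf_norm M) (anti_norm M)"
  proof (atomize (full), cases "s \<le> r")
    case True
    have r0: "r > 0"
    proof (rule ccontr)
      assume "\<not> r > 0"
      hence "r = 0" "s = 0" using r(2) s(2) True by auto
      hence "a = 0" "b = 0" "c = 0" "e = 0" using r(1) s(1) by (auto simp: sum_squares_eq_zero_iff)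
      hence "M = 0" using m by (simp add: mat2_eq_iff)
      thus False using assms by simp
    qed
    have w: "polar_factor M $1$1 = a / r" "polar_factor M $1$2 = - b / r" "polar_factor M $2$1 = b / r" "polar_factor M $2$2 = a / r"
      using True r0 by (auto simp: polar_factor_def r_def[symmetric] s_def[symmetric] a_def b_def field_simps)
    have one: "a / r * (a / r) + b / r * (b / r) = 1" "b / r * (b / r) + a / r * (a / r) = 1"
      using r0 by (simp_all add: add_divide_distrib[symmetric] r(1)[symmetric] add.commute)
    have o: "orthogonal_matrix (polar_factor M)"
      unfolding orthogonal_matrix_def using one by (simp add: mat2_eq_iff mult2_nth mat2_nth transpose_def w)
    \<comment> \<open>Entries of the transposed polar factor times the anticonformal part, which has
      the rows (p, q) and (q, -p).\<close>
    define p q where "p = (a * c + b * e) / r" and "q = (a * e - b * c) / r"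
    have sum: "a / r * a + b / r * b = r" using r0 by (simp add: add_divide_distrib[symmetric] r(1)[symmetric])
    have "p * p + q * q = ((a * c + b * e) * (a * c + b * e) + (a * e - b * c) * (a * e - b * c)) / (r * r)"
      unfolding add_divide_distrib[of "_ * _" "_ * _"] by (simp only: p_def q_def times_divide_times_eq)
    also have "(a * c + b * e) * (a * c + b * e) + (a * e - b * c) * (a * e - b * c) = (r * r) * (s * s)"
      unfolding r(1) s(1) by (simp add: algebra_simps)
    finally have pq: "p * p + q * q = s * s" using r0 by simp
    have h: "(transpose (polar_factor M) ** M)$1$1 = r + p" "(transpose (polar_factor M) ** M)$1$2 = q"
      "(transpose (polar_factor M) ** M)$2$1 = q" "(transpose (polar_factor M) ** M)$2$2 = r - p"
      using sum by (simp_all add: mult2_nth transpose_def w m p_def q_def algebra_simps add_divide_distrib diff_divide_distrib)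
    have "s * s \<le> r * r" using True s(2) by (intro mult_mono) auto
    hence le: "p * p + q * q \<le> r * r" using pq by simp
    have "\<bar>p\<bar> \<le> r" using le r0 by (intro abs_le_square_iff[THEN iffD2, of p r, simplified abs_of_nonneg[OF r(2)]]) (simp add: power2_eq_square add_increasing2 le order_trans[OF _ le])
    hence "psd (transpose (polar_factor M) ** M)" unfolding psd2_iff h using le by (auto simp: power2_eq_square algebra_simps)
    thus "orthogonal_matrix (polar_factor M) \<and> psd (transpose (polar_factor M) ** M) \<and>
      (transpose (polar_factor M) ** M)$1$1 + (transpose (polar_factor M) ** M)$2$2 = 2 * max (conf_norm M) (anti_norm M)"
      using o True by (simp add: h r_def[symmetric] s_def[symmetric])
  next
    case False
    have s0: "s > 0" using False r(2) by simp
    have w: "polar_factor M $1$1 = c / s" "polar_factor M $1$2 = e / s" "polar_factor M $2$1 = e / s" "polar_factor M $2$2 = - c / s"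
      using False s0 by (auto simp: polar_factor_def r_def[symmetric] s_def[symmetric] c_def e_def field_simps)
    have one: "c / s * (c / s) + e / s * (e / s) = 1" "e / s * (e / s) + c / s * (c / s) = 1"
      using s0 by (simp_all add: add_divide_distrib[symmetric] s(1)[symmetric] add.commute)
    have o: "orthogonal_matrix (polar_factor M)"
      unfolding orthogonal_matrix_def using one by (simp add: mat2_eq_iff mult2_nth mat2_nth transpose_def w)
    define p q where "p = (a * c + b * e) / s" and "q = (a * e - b * c) / s"
    have sum: "c / s * c + e / s * e = s" using s0 by (simp add: add_divide_distrib[symmetric] s(1)[symmetric])
    have "p * p + q * q = ((a * c + b * e) * (a * c + b * e) + (a * e - b * c) * (a * e - b * c)) / (s * s)"
      unfolding add_divide_distrib[of "_ * _" "_ * _"] by (simp only: p_def q_def times_divide_times_eq)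
    also have "(a * c + b * e) * (a * c + b * e) + (a * e - b * c) * (a * e - b * c) = (s * s) * (r * r)"
      unfolding r(1) s(1) by (simp add: algebra_simps)
    finally have pq: "p * p + q * q = r * r" using s0 by simp
    have h: "(transpose (polar_factor M) ** M)$1$1 = s + p" "(transpose (polar_factor M) ** M)$1$2 = q"
      "(transpose (polar_factor M) ** M)$2$1 = q" "(transpose (polar_factor M) ** M)$2$2 = s - p"
      using sum by (simp_all add: mult2_nth transpose_def w m p_def q_def algebra_simps add_divide_distrib diff_divide_distrib)
    have "r * r \<le> s * s" using False r(2) by (intro mult_mono) auto
    hence le: "p * p + q * q \<le> s * s" using pq by simp
    have "\<bar>p\<bar> \<le> s" using le s0 by (intro abs_le_square_iff[THEN iffD2, of p s, simplified abs_of_nonneg[OF s(2)]]) (simp add: power2_eq_square add_increasing2 le order_trans[OF _ le])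
    hence "psd (transpose (polar_factor M) ** M)" unfolding psd2_iff h using le by (auto simp: power2_eq_square algebra_simps)
    thus "orthogonal_matrix (polar_factor M) \<and> psd (transpose (polar_factor M) ** M) \<and>
      (transpose (polar_factor M) ** M)$1$1 + (transpose (polar_factor M) ** M)$2$2 = 2 * max (conf_norm M) (anti_norm M)"
      using o False by (simp add: h r_def[symmetric] s_def[symmetric])
  qed
qed

lemma polar_factor_0: "polar_factor 0 = 0"
  by (simp add: polar_factor_def mat2_eq_iff conf_norm_def anti_norm_def)

text \<open>For nonzero \<open>M\<close> the right-hand side is positive semidefinite with square
  \<open>transpose M ** M\<close>, by orthogonality of the polar factor; uniqueness of the root
  identifies it.\<close>

lemma absm_eq: "absm M = transpose (polar_factor M) ** M" for M :: "real^2^2"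
proof (cases "M = 0")
  case True
  have "psd (0 :: real^2^2)" by (simp add: psd2_iff)
  hence "psd_sqrt (0 :: real^2^2) = 0" by (rule psd_sqrt_unique) (simp add: mat2_eq_iff mult2_nth)
  moreover have "N ** (0 :: real^2^2) = 0" for N by (simp add: mat2_eq_iff mult2_nth)
  ultimately show ?thesis unfolding absm_def True by simp
next
  case False
  note w = polar_factor_props[OF False]
  let ?H = "transpose (polar_factor M) ** M"
  have "?H ** ?H = transpose ?H ** ?H" using w(2) by (simp add: psd_def)
  also have "\<dots> = transpose M ** (polar_factor M ** transpose (polar_factor M)) ** M"
    by (simp add: matrix_transpose_mul matrix_mul_assoc transpose_transpose)
  also have "\<dots> = transpose M ** M" using w(1) by (simp add: orthogonal_matrix_def)
  finally show ?thesis unfolding absm_def using w(2) by (intro psd_sqrt_unique)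
qed

lemma psd_absm: "psd (absm M)" for M :: "real^2^2"
proof (cases "M = 0")
  case True
  thus ?thesis unfolding absm_eq by (simp add: psd2_iff mult2_nth)
next
  case False
  thus ?thesis unfolding absm_eq by (rule polar_factor_props)
qed

lemma polarV: 
  fixes M :: "real^2^2"
  shows "orthogonal_matrix (polarV M)" "polarV M ** absm M = M"
proof -
  have "\<exists>V. orthogonal_matrix V \<and> M = V ** absm M"
  proof (cases "M = 0")
    case True
    have "absm M = 0" using True by (simp add: absm_eq mat2_eq_iff mult2_nth)
    thus ?thesis using True orthogonal_matrix_id by (intro exI[of _ "mat 1"]) simp
  next
    case False
    show ?thesis using polar_factor_props(1)[OF False]
      by (intro exI[of _ "polar_factor M"]) (simp add: absm_eq matrix_mul_assoc orthogonal_matrix_def)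
  qed
  from someI_ex[OF this] show "orthogonal_matrix (polarV M)" "polarV M ** absm M = M"
    unfolding polarV_def by auto
qed

section \<open>The two weights of the kernel\<close>

definition polar_right :: "real^2^2 \<Rightarrow> real^2^2" where "polar_right M = psd_sqrt (absm M)"
definition polar_left :: "real^2^2 \<Rightarrow> real^2^2" where "polar_left M = polarV M ** psd_sqrt (absm M)"

lemma polar_left_right: "polar_left M ** polar_right M = M"
  unfolding polar_left_def polar_right_def
  by (simp add: matrix_mul_assoc[symmetric] psd_sqrt2(3)[OF psd_absm] polarV(2))

lemma trace_absm_le: "(absm M)$1$1 + (absm M)$2$2 \<le> 2 * (\<bar>M$1$1\<bar> + \<bar>M$1$2\<bar> + \<bar>M$2$1\<bar> + \<bar>M$2$2\<bar>)"
  for M :: "real^2^2"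
proof (cases "M = 0")
  case True
  thus ?thesis by (simp add: absm_eq mult2_nth)
next
  case False
  have 1: "conf_norm M \<le> \<bar>(M$1$1 + M$2$2) / 2\<bar> + \<bar>(M$2$1 - M$1$2) / 2\<bar>"
    unfolding conf_norm_def by (rule sqrt_sum_squares_le_sum_abs)
  have 2: "anti_norm M \<le> \<bar>(M$1$1 - M$2$2) / 2\<bar> + \<bar>(M$1$2 + M$2$1) / 2\<bar>"
    unfolding anti_norm_def by (rule sqrt_sum_squares_le_sum_abs)
  have 3: "\<bar>(x + y) / 2\<bar> \<le> (\<bar>x\<bar> + \<bar>y\<bar>) / 2" "\<bar>(x - y) / 2\<bar> \<le> (\<bar>x\<bar> + \<bar>y\<bar>) / 2" for x y :: real
    by auto
  have 4: "(x + y) / 2 + (z + w) / 2 \<le> x + z + w + y" if "0 \<le> x" "0 \<le> y" "0 \<le> z" "0 \<le> w" for x y z w :: real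
    using that by (simp add: field_simps)
  note 5 = 4[OF abs_ge_zero abs_ge_zero abs_ge_zero abs_ge_zero]
  have "conf_norm M \<le> \<bar>M$1$1\<bar> + \<bar>M$1$2\<bar> + \<bar>M$2$1\<bar> + \<bar>M$2$2\<bar>"
    using order_trans[OF 1 order_trans[OF add_mono[OF 3(1) 3(2)] 5]] by (simp only: add_ac)
  moreover have "anti_norm M \<le> \<bar>M$1$1\<bar> + \<bar>M$1$2\<bar> + \<bar>M$2$1\<bar> + \<bar>M$2$2\<bar>"
    using order_trans[OF 2 order_trans[OF add_mono[OF 3(2) 3(1)] 5]] by (simp only: add_ac)
  ultimately have "max (conf_norm M) (anti_norm M) \<le> \<bar>M$1$1\<bar> + \<bar>M$1$2\<bar> + \<bar>M$2$1\<bar> + \<bar>M$2$2\<bar>"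
    by (rule max.boundedI)
  thus ?thesis unfolding absm_eq polar_factor_props(3)[OF False] by (rule mult_left_mono) simp
qed

text \<open>The trace of a Gram matrix is the sum of the squared entries. It is applied to both
  weights, whose Gram matrix is |M|; each weight therefore inherits half of the decay rate of
  M.\<close>

lemma gram_le:
  fixes T :: "real^2^2"
  assumes "transpose T ** T = H"
  shows "(T$i$j)\<^sup>2 \<le> H$1$1 + H$2$2"
proof -
  have "H$1$1 + H$2$2 = (T$1$1)\<^sup>2 + (T$1$2)\<^sup>2 + (T$2$1)\<^sup>2 + (T$2$2)\<^sup>2"
    unfolding assms[symmetric] by (simp add: mult2_nth transpose_def power2_eq_square)
  thus ?thesis using exhaust_2[of i] exhaust_2[of j] by auto
qed

lemma polar_right_le: "(polar_right M $ i $ j)\<^sup>2 \<le> 2 * (\<bar>M$1$1\<bar> + \<bar>M$1$2\<bar> + \<bar>M$2$1\<bar> + \<bar>M$2$2\<bar>)"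
proof -
  have "transpose (polar_right M) ** polar_right M = absm M"
    using psd_sqrt2(2,3)[OF psd_absm, of M] unfolding polar_right_def psd_def by simp
  from order_trans[OF gram_le[OF this] trace_absm_le] show ?thesis .
qed

lemma polar_left_le: "(polar_left M $ i $ j)\<^sup>2 \<le> 2 * (\<bar>M$1$1\<bar> + \<bar>M$1$2\<bar> + \<bar>M$2$1\<bar> + \<bar>M$2$2\<bar>)"
proof -
  have "transpose (polar_left M) ** polar_left M = transpose (psd_sqrt (absm M)) ** (transpose (polarV M) ** polarV M) ** psd_sqrt (absm M)"
    unfolding polar_left_def by (simp add: matrix_transpose_mul matrix_mul_assoc)
  also have "\<dots> = absm M"
    using psd_sqrt2(2,3)[OF psd_absm, of M] polarV(1)[of M] unfolding psd_def by (simp add: orthogonal_matrix_def)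
  finally show ?thesis by (rule order_trans[OF gram_le trace_absm_le])
qed

lemma polar_right_eq: "polar_right M = (1 / sqrt_trace (absm M)) *\<^sub>R (absm M + mat (sqrt_det (absm M)))"
  unfolding polar_right_def by (rule psd_sqrt2(1)[OF psd_absm])

text \<open>The chosen factor \<open>polarV M\<close> is ambiguous for singular \<open>M\<close>. By
  the root formula the left weight contains it only through \<open>M\<close> itself and through a
  multiple by the square root of det |M|; where that multiple is nonzero, |M| is invertible and the
  factor is unique. The result is an explicit, hence measurable, function of the entries.\<close>

lemma polar_left_eq: "polar_left M = (1 / sqrt_trace (absm M)) *\<^sub>R (M + sqrt_det (absm M) *\<^sub>R polar_factor M)"
proof -
  define H where "H = absm M"
  have "polar_left M = (1 / sqrt_trace H) *\<^sub>R (polarV M ** (H + mat (sqrt_det H)))"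
  proof -
    have "psd_sqrt H = (1 / sqrt_trace H) *\<^sub>R (H + mat (sqrt_det H))" unfolding H_def by (rule psd_sqrt2(1)[OF psd_absm])
    thus ?thesis unfolding polar_left_def H_def[symmetric]
      by (simp add: mat2_eq_iff mult2_nth algebra_simps add_divide_distrib)
  qed
  also have "polarV M ** (H + mat (sqrt_det H)) = M + sqrt_det H *\<^sub>R polarV M"
    using polarV(2)[of M] by (simp add: matrix_add_ldistrib H_def) (simp add: mat2_eq_iff mult2_nth mat2_nth)
  also have "sqrt_det H *\<^sub>R polarV M = sqrt_det H *\<^sub>R polar_factor M"
  proof (cases "sqrt_det H = 0 \<or> M = 0")
    case True
    thus ?thesis by (auto simp: H_def absm_eq polar_factor_0 sqrt_det_def mult2_nth)
  next
    case False
    \<comment> \<open>The adjugate of \<open>H\<close>: it cancels \<open>H\<close> up to the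
      nonzero determinant.\<close>
    define Hi :: "real^2^2" where "Hi = (\<chi> i j. (if i = j then (if i = 1 then H$2$2 else H$1$1) else - (H $ i $ j)))"
    have HH: "H ** Hi = mat (H$1$1 * H$2$2 - H$1$2 * H$2$1)"
      by (simp add: mat2_eq_iff mult2_nth mat2_nth Hi_def algebra_simps)
    have det: "H$1$1 * H$2$2 - H$1$2 * H$2$1 \<noteq> 0" using False by (auto simp: sqrt_det_def)
    have "polar_factor M ** H = M" using polar_factor_props(1)[of M] False
      by (simp add: H_def absm_eq matrix_mul_assoc orthogonal_matrix_def)
    hence "polar_factor M ** H ** Hi = polarV M ** H ** Hi" using polarV(2)[of M] by (simp add: H_def)
    hence "polar_factor M ** mat (H$1$1 * H$2$2 - H$1$2 * H$2$1) = polarV M ** mat (H$1$1 * H$2$2 - H$1$2 * H$2$1)"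
      by (simp add: matrix_mul_assoc[symmetric] HH)
    hence "polar_factor M = polarV M" using det by (simp add: mat2_eq_iff mult2_nth mat2_nth)
    thus ?thesis by simp
  qed
  finally show ?thesis unfolding H_def .
qed

lemma borel_measurable_polar:
  assumes M [measurable]: "\<And>i j. (\<lambda>x. F x $ i $ j) \<in> borel_measurable N"
  shows "(\<lambda>x. polar_right (F x) $ i $ j) \<in> borel_measurable N" "(\<lambda>x. polar_left (F x) $ i $ j) \<in> borel_measurable N"
proof -
  have n [measurable]: "(\<lambda>x. conf_norm (F x)) \<in> borel_measurable N" "(\<lambda>x. anti_norm (F x)) \<in> borel_measurable N"
    unfolding conf_norm_def anti_norm_def by measurable
  have polar_factor [measurable]: "(\<lambda>x. polar_factor (F x) $ i $ j) \<in> borel_measurable N" for i j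
  proof -
    have polar_factor: "polar_factor (F x) $ i $ j = (if anti_norm (F x) \<le> conf_norm (F x)
     then (1 / conf_norm (F x)) * (if i = j then (F x$1$1 + F x$2$2) / 2 else if i = 1 then - (F x$2$1 - F x$1$2) / 2 else (F x$2$1 - F x$1$2) / 2)
     else (1 / anti_norm (F x)) * (if i = j then (if i = 1 then (F x$1$1 - F x$2$2) / 2 else - (F x$1$1 - F x$2$2) / 2) else (F x$1$2 + F x$2$1) / 2))" for x
      by (simp add: polar_factor_def)
    show ?thesis unfolding polar_factor by measurable
  qed
  have H [measurable]: "(\<lambda>x. absm (F x) $ i $ j) \<in> borel_measurable N" for i j
    unfolding absm_eq mult2_nth transpose_def by simp
  have sqrt_det [measurable]: "(\<lambda>x. sqrt_det (absm (F x))) \<in> borel_measurable N" unfolding sqrt_det_def by measurable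
  have sqrt_trace [measurable]: "(\<lambda>x. sqrt_trace (absm (F x))) \<in> borel_measurable N" unfolding sqrt_trace_def by measurable
  have m: "(\<lambda>x. mat (sqrt_det (absm (F x))) $ i $ j) \<in> borel_measurable N" for i j :: 2
    unfolding mat_def by simp
  show "(\<lambda>x. polar_right (F x) $ i $ j) \<in> borel_measurable N" unfolding polar_right_eq using m by simp
  show "(\<lambda>x. polar_left (F x) $ i $ j) \<in> borel_measurable N" unfolding polar_left_eq by simp
qed

section \<open>The Green function of a second-order equation on the line\<close>

lemma integrable_exp_neg_abs:
  assumes c: "c > 0"
  shows "integrable lborel (\<lambda>x::real. exp (- c * \<bar>x\<bar>))"
proof -
  have "filterlim (\<lambda>x. - (c * x)) at_bot at_top"
    unfolding filterlim_uminus_at_bot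
    by (simp add: filterlim_tendsto_pos_mult_at_top[OF tendsto_const c filterlim_ident])
  hence "((\<lambda>x. - exp (- c * x) / c) \<longlongrightarrow> - 0 / c) at_top"
    using c by (intro tendsto_intros filterlim_compose[OF exp_at_bot]) auto
  hence "(\<integral>\<^sup>+x. ennreal (exp (- c * x)) * indicator {0..} x \<partial>lborel) = ennreal (- 0 / c - (- exp (- c * 0) / c))"
    using c by (intro nn_integral_FTC_atLeast) (auto intro!: derivative_eq_intros)
  moreover have "(\<integral>\<^sup>+x. ennreal (norm (indicator {0..} x * exp (- c * x))) \<partial>lborel)
      = (\<integral>\<^sup>+x. ennreal (exp (- c * x)) * indicator {0..} x \<partial>lborel)"
    by (intro nn_integral_cong) (auto simp: indicator_def)
  ultimately have "(\<integral>\<^sup>+x. ennreal (norm (indicator {0..} x * exp (- c * x))) \<partial>lborel) < \<infinity>"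
    by simp
  hence 1: "integrable lborel (\<lambda>x::real. indicator {0..} x * exp (- c * x))"
    by (intro integrableI_bounded) auto
  have 2: "integrable lborel (\<lambda>x::real. indicator {0..} (- x) * exp (- c * (- x)))"
    using lborel_integrable_real_affine[OF 1, of "-1" 0] by simp
  show ?thesis
    by (rule Bochner_Integration.integrable_bound[OF Bochner_Integration.integrable_add[OF 1 2]])
       (auto simp: indicator_def)
qed

lemma not_integrable_bounded_below:
  fixes f :: "real \<Rightarrow> real"
  assumes f: "integrable lborel f" and c: "c > 0" and S: "S \<in> sets lborel" "emeasure lborel S = \<infinity>"
    and le: "\<And>x. x \<in> S \<Longrightarrow> c \<le> f x"
  shows False
proof -
  have "integrable lborel (\<lambda>x. c * indicator S x)"
    by (rule Bochner_Integration.integrable_bound[OF f]) (use S le c in \<open>force simp: indicator_def\<close>)+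
  hence "integrable lborel (\<lambda>x. indicator S x :: real)" using c by simp
  thus False using S by (simp add: integrable_indicator_iff)
qed

lemma emeasure_lborel_atLeast: "emeasure lborel {0::real..} = \<infinity>"
proof -
  have "ennreal (real n) \<le> emeasure lborel {0::real..}" for n
  proof -
    have "ennreal (real n) = emeasure lborel {0..real n}" by simp
    also have "\<dots> \<le> emeasure lborel {0::real..}" by (intro emeasure_mono) auto
    finally show ?thesis .
  qed
  thus ?thesis by (metis ennreal_SUP_of_nat_eq_top SUP_least ennreal_of_nat_eq_real_of_nat infinity_ennreal_def top.extremum_uniqueI)
qed

section \<open>Square integrable solutions of the homogeneous equations\<close>

lemma exp_mult_has_vector_derivative:
  "((\<lambda>x. exp (r * complex_of_real x)) has_vector_derivative r * exp (r * complex_of_real x)) (at x within S)"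
  using exp_scaleR_has_vector_derivative_right[of r x S]
  by (simp add: scaleR_conv_of_real mult.commute)

lemma norm_exp_mult: "cmod (exp (r * complex_of_real x)) = exp (Re r * x)"
  by (simp add: norm_exp_eq_Re)

text \<open>Solutions are multiples of exp (r x), whose modulus is bounded below on the half line
  where it grows, so only the zero multiple is square integrable.\<close>

lemma ode1_L2_unique:
  fixes w :: "real \<Rightarrow> complex"
  assumes w: "\<And>x. (w has_vector_derivative r * w x) (at x)" and r: "Re r \<noteq> 0"
    and L2: "integrable lborel (\<lambda>x. (cmod (w x))\<^sup>2)"
  shows "w x = 0"
proof -
  define h where "h x = exp (- r * complex_of_real x) * w x" for x
  have "(h has_vector_derivative exp (- r * complex_of_real x) * (r * w x) + (- r * exp (- r * complex_of_real x)) * w x) (at x)" for x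
    unfolding h_def by (rule has_vector_derivative_mult[OF exp_mult_has_vector_derivative w])
  hence "(h has_vector_derivative 0) (at x within UNIV)" for x by (simp add: algebra_simps)
  then obtain c where c: "\<And>x. h x = c"
    using has_vector_derivative_zero_constant[of UNIV h] by auto
  have wx: "w x = c * exp (r * complex_of_real x)" for x
    using c[of x] by (simp add: h_def exp_minus field_simps)
  have "c = 0"
  proof (rule ccontr)
    assume c0: "c \<noteq> 0"
    have sq: "(cmod (w x))\<^sup>2 = (cmod c)\<^sup>2 * exp (2 * (Re r * x))" for x
      unfolding wx norm_mult norm_exp_mult by (simp add: power_mult_distrib exp_double)
    show False
    proof (cases "Re r > 0")
      case True
      show False
        by (rule not_integrable_bounded_below[OF L2, where S="{0..}" and c="(cmod c)\<^sup>2"])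
           (use c0 True in \<open>auto simp: sq emeasure_lborel_atLeast\<close>)
    next
      case False
      have "integrable lborel (\<lambda>x. (cmod (w (- x)))\<^sup>2)"
        using lborel_integrable_real_affine[OF L2, of "-1" 0] by simp
      thus False
        by (rule not_integrable_bounded_below[where S="{0..}" and c="(cmod c)\<^sup>2"])
           (use c0 False r in \<open>auto simp: sq emeasure_lborel_atLeast mult_le_0_iff\<close>)
    qed
  qed
  thus ?thesis by (simp add: wx)
qed

lemma square_sum_le: "(cmod (a + b))\<^sup>2 \<le> 2 * (cmod a)\<^sup>2 + 2 * (cmod b)\<^sup>2"
proof -
  have "(cmod (a + b))\<^sup>2 \<le> (cmod a + cmod b)\<^sup>2" by (intro power_mono norm_triangle_ineq) auto
  also have "\<dots> \<le> 2 * (cmod a)\<^sup>2 + 2 * (cmod b)\<^sup>2"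
    using zero_le_power2[of "cmod a - cmod b"] by (simp add: power2_sum power2_diff)
  finally show ?thesis .
qed

lemma integrable_square_add:
  fixes f g :: "real \<Rightarrow> complex"
  assumes "f \<in> borel_measurable lborel" "g \<in> borel_measurable lborel"
    "integrable lborel (\<lambda>x. (cmod (f x))\<^sup>2)" "integrable lborel (\<lambda>x. (cmod (g x))\<^sup>2)"
  shows "integrable lborel (\<lambda>x. (cmod (a * f x + b * g x))\<^sup>2)"
proof (rule Bochner_Integration.integrable_bound)
  show "integrable lborel (\<lambda>x. 2 * ((cmod a)\<^sup>2 * (cmod (f x))\<^sup>2) + 2 * ((cmod b)\<^sup>2 * (cmod (g x))\<^sup>2))"
    using assms by simp
  show "(\<lambda>x. (cmod (a * f x + b * g x))\<^sup>2) \<in> borel_measurable lborel" using assms by measurable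
  show "AE x in lborel. norm ((cmod (a * f x + b * g x))\<^sup>2) \<le> norm (2 * ((cmod a)\<^sup>2 * (cmod (f x))\<^sup>2) + 2 * ((cmod b)\<^sup>2 * (cmod (g x))\<^sup>2))"
    using square_sum_le[of "a * f _" "b * g _"] by (auto simp: norm_mult power_mult_distrib)
qed

lemma vector_derivative_continuous: "(\<And>x. (f has_vector_derivative f' x) (at x)) \<Longrightarrow> continuous_on UNIV f"
  by (meson continuous_at_imp_continuous_on has_vector_derivative_continuous)

lemma borel_measurable_cont: "continuous_on UNIV f \<Longrightarrow> f \<in> borel_measurable lborel" 
  for f :: "real \<Rightarrow> 'a::{second_countable_topology,real_normed_vector}"
  by (simp add: borel_measurable_continuous_onI)

lemma vector_derivative_measurable:
  fixes f :: "real \<Rightarrow> complex"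
  shows "(\<And>x. (f has_vector_derivative f' x) (at x)) \<Longrightarrow> f \<in> borel_measurable lborel"
  by (rule borel_measurable_cont[OF vector_derivative_continuous])

text \<open>Factorisation of the operator: z' + s z solves the first-order equation with rate s for
  both s = r and s = -r, hence vanishes for both.\<close>

lemma ode2_L2_unique:
  fixes z z1 :: "real \<Rightarrow> complex"
  assumes z: "\<And>x. (z has_vector_derivative z1 x) (at x)" "\<And>x. (z1 has_vector_derivative r\<^sup>2 * z x) (at x)"
    and r: "Re r \<noteq> 0"
    and L2: "integrable lborel (\<lambda>x. (cmod (z x))\<^sup>2)" "integrable lborel (\<lambda>x. (cmod (z1 x))\<^sup>2)"
  shows "z x = 0"
proof -
  have m: "z \<in> borel_measurable lborel" "z1 \<in> borel_measurable lborel"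
    by (rule vector_derivative_measurable[OF z(1)], rule vector_derivative_measurable[OF z(2)])
  have "z1 x + s * z x = 0" if s: "s\<^sup>2 = r\<^sup>2" "Re s \<noteq> 0" for s x
  proof (rule ode1_L2_unique[where w="\<lambda>x. z1 x + s * z x" and r=s, OF _ s(2)])
    fix x
    have "((\<lambda>x. z1 x + s * z x) has_vector_derivative (s\<^sup>2 * z x + s * z1 x)) (at x)"
      unfolding s(1) by (intro has_vector_derivative_add z has_vector_derivative_mult_right)
    thus "((\<lambda>x. z1 x + s * z x) has_vector_derivative s * (z1 x + s * z x)) (at x)"
      by (simp add: algebra_simps power2_eq_square)
    show "integrable lborel (\<lambda>x. (cmod (z1 x + s * z x))\<^sup>2)"
      using integrable_square_add[OF m(2,1) L2(2,1), of 1 s] by simp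
  qed
  from this[of r x] this[of "- r" x] r have "z1 x + r * z x = 0" "z1 x - r * z x = 0" by auto
  hence "2 * (r * z x) = 0" by (metis add_cancel_right_left diff_eq_eq eq_iff_diff_eq_0 mult_2 add.commute)
  thus ?thesis using r by auto
qed

section \<open>The Green function and its two tails\<close>

definition green :: "complex \<Rightarrow> (real \<Rightarrow> complex) \<Rightarrow> real \<Rightarrow> complex" where
  "green r f x = (\<integral>y. exp (- r * \<bar>x - y\<bar>) / (2 * r) * f y \<partial>lborel)"

definition right_tail :: "complex \<Rightarrow> (real \<Rightarrow> complex) \<Rightarrow> real \<Rightarrow> complex" where
  "right_tail r f x = (\<integral>y. (if x < y then exp (r * of_real (x - y)) * f y else 0) \<partial>lborel)"

text \<open>Defined by reflection, so that differentiability carries over from the right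
  tail.\<close>

definition left_tail :: "complex \<Rightarrow> (real \<Rightarrow> complex) \<Rightarrow> real \<Rightarrow> complex" where
  "left_tail r f x = right_tail r (\<lambda>y. f (- y)) (- x)"

text \<open>Common majorant of both tails. It is bounded and integrable, which is how square
  integrability of the tails is obtained.\<close>

definition exp_conv :: "real \<Rightarrow> (real \<Rightarrow> complex) \<Rightarrow> real \<Rightarrow> real" where
  "exp_conv s f x = (\<integral>y. exp (- s * \<bar>x - y\<bar>) * cmod (f y) \<partial>lborel)"

lemma norm_kernel: "cmod (exp (- r * \<bar>x - y\<bar>)) = exp (- Re r * \<bar>x - y\<bar>)" for x y :: real
  by (simp add: norm_exp_eq_Re)

context
  fixes r :: complex and f :: "real \<Rightarrow> complex"
  assumes r: "Re r > 0" and f: "integrable lborel f"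
begin

lemma f_meas [measurable]: "f \<in> borel_measurable lborel" using f by simp

lemma kernel_integrable: "integrable lborel (\<lambda>y. exp (- r * \<bar>x - y\<bar>) / (2 * r) * f y)" for x :: real
proof (rule Bochner_Integration.integrable_bound)
  show "integrable lborel (\<lambda>y. 1 / (2 * cmod r) * cmod (f y))" using f by simp
  show "(\<lambda>y. exp (- r * \<bar>x - y\<bar>) / (2 * r) * f y) \<in> borel_measurable lborel" by measurable
  have "exp (- Re r * \<bar>x - y\<bar>) \<le> 1" for y using r by simp
  thus "AE y in lborel. norm (exp (- r * \<bar>x - y\<bar>) / (2 * r) * f y) \<le> norm (1 / (2 * cmod r) * cmod (f y))"
    unfolding norm_mult norm_divide norm_kernel using r
    by (intro AE_I2) (auto intro!: divide_right_mono mult_right_mono mult_left_le_one_le)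
qed

lemma green_bounded: "cmod (green r f x) \<le> 1 / (2 * cmod r) * (\<integral>y. cmod (f y) \<partial>lborel)"
proof -
  have "exp (- Re r * \<bar>x - y\<bar>) \<le> 1" for y using r by simp
  hence "cmod (green r f x) \<le> (\<integral>y. 1 / (2 * cmod r) * cmod (f y) \<partial>lborel)"
    unfolding green_def
    by (intro Bochner_Integration.integral_norm_bound_integral kernel_integrable)
       (use f r in \<open>auto simp: norm_mult norm_divide norm_kernel intro!: divide_right_mono mult_left_le_one_le\<close>)
  thus ?thesis by simp
qed

lemma green_continuous: "continuous_on UNIV (green r f)"
proof -
  have "(\<lambda>n. green r f (s n)) \<longlonglongrightarrow> green r f x" if s: "s \<longlonglongrightarrow> x" for s x
    unfolding green_def
  proof (rule integral_dominated_convergence)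
    show "integrable lborel (\<lambda>y. 1 / (2 * cmod r) * cmod (f y))" using f by simp
    show "(\<lambda>y. exp (- r * \<bar>x - y\<bar>) / (2 * r) * f y) \<in> borel_measurable lborel" by measurable
    show "(\<lambda>y. exp (- r * \<bar>s n - y\<bar>) / (2 * r) * f y) \<in> borel_measurable lborel" for n by measurable
    show "AE y in lborel. (\<lambda>n. exp (- r * \<bar>s n - y\<bar>) / (2 * r) * f y) \<longlonglongrightarrow> exp (- r * \<bar>x - y\<bar>) / (2 * r) * f y"
      using r by (intro AE_I2 tendsto_intros s) auto
    show "AE y in lborel. norm (exp (- r * \<bar>s n - y\<bar>) / (2 * r) * f y) \<le> 1 / (2 * cmod r) * cmod (f y)" for n
      using r by (intro AE_I2) (auto simp: norm_mult norm_divide norm_kernel intro!: divide_right_mono mult_left_le_one_le)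
  qed
  thus ?thesis by (auto simp: continuous_on_eq_continuous_at continuous_at_sequentially o_def)
qed

lemma right_tail_integrable: "integrable lborel (\<lambda>y. if x < y then exp (r * of_real (x - y)) * f y else 0)"
proof (rule Bochner_Integration.integrable_bound[OF f])
  show "(\<lambda>y. if x < y then exp (r * of_real (x - y)) * f y else 0) \<in> borel_measurable lborel" by measurable
  have "exp (Re r * (x - y)) \<le> 1" if "x < y" for y using r that by (simp add: mult_le_0_iff)
  thus "AE y in lborel. norm (if x < y then exp (r * of_real (x - y)) * f y else 0) \<le> norm (f y)"
    by (intro AE_I2) (auto simp: norm_mult norm_exp_mult simp del: of_real_diff intro!: mult_left_le_one_le)
qed

lemma exp_conv_integrand_integrable: "integrable lborel (\<lambda>y. exp (- Re r * \<bar>x - y\<bar>) * cmod (f y))"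
proof (rule Bochner_Integration.integrable_bound[OF f])
  show "(\<lambda>y. exp (- Re r * \<bar>x - y\<bar>) * cmod (f y)) \<in> borel_measurable lborel" by measurable
  show "AE y in lborel. norm (exp (- Re r * \<bar>x - y\<bar>) * cmod (f y)) \<le> norm (f y)"
    using r by (intro AE_I2) (auto simp: norm_mult intro!: mult_left_le_one_le)
qed

lemma exp_conv_bounds: "0 \<le> exp_conv (Re r) f x" "exp_conv (Re r) f x \<le> (\<integral>y. cmod (f y) \<partial>lborel)"
proof -
  show "0 \<le> exp_conv (Re r) f x" unfolding exp_conv_def by (intro Bochner_Integration.integral_nonneg) auto
  show "exp_conv (Re r) f x \<le> (\<integral>y. cmod (f y) \<partial>lborel)"
    unfolding exp_conv_def using f r by (intro integral_mono exp_conv_integrand_integrable) (auto intro!: mult_left_le_one_le)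
qed

text \<open>Convolution of two integrable functions, by translation invariance and Fubini.\<close>

lemma integrable_exp_conv: "integrable lborel (exp_conv (Re r) f)"
proof -
  let ?h = "\<lambda>y x. exp (- Re r * \<bar>x - y\<bar>) * cmod (f y)"
  have tr: "integrable lborel (\<lambda>x. exp (- Re r * \<bar>x - y\<bar>))" "(\<integral>x. exp (- Re r * \<bar>x - y\<bar>) \<partial>lborel) = (\<integral>x. exp (- Re r * \<bar>x\<bar>) \<partial>lborel)" for y :: real
    using lborel_integrable_real_affine[OF integrable_exp_neg_abs[OF r], of 1 "- y"]
      lborel_integral_real_affine[of 1 "\<lambda>x. exp (- Re r * \<bar>x\<bar>)" "- y"] by (simp_all add: algebra_simps)
  have "integrable (lborel \<Otimes>\<^sub>M lborel) (\<lambda>p. ?h (fst p) (snd p))"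
  proof (rule lborel_pair.Fubini_integrable)
    show "(\<lambda>p. ?h (fst p) (snd p)) \<in> borel_measurable (lborel \<Otimes>\<^sub>M lborel)" by measurable
    have "(\<lambda>y. \<integral>x. norm (?h (fst (y, x)) (snd (y, x))) \<partial>lborel) = (\<lambda>y. (\<integral>x. exp (- Re r * \<bar>x\<bar>) \<partial>lborel) * cmod (f y))"
      by (simp add: abs_mult tr(2)[simplified])
    thus "integrable lborel (\<lambda>y. \<integral>x. norm (?h (fst (y, x)) (snd (y, x))) \<partial>lborel)" using f by simp
    show "AE y in lborel. integrable lborel (\<lambda>x. ?h (fst (y, x)) (snd (y, x)))"
      using tr(1) by (intro AE_I2) simp
  qed
  from lborel_pair.integrable_product_swap[OF this]
  have "integrable (lborel \<Otimes>\<^sub>M lborel) (\<lambda>p. ?h (snd p) (fst p))"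
    by (simp add: case_prod_unfold)
  from lborel_pair.integrable_fst'[OF this] show ?thesis unfolding exp_conv_def by simp
qed

lemma right_tail_le: "cmod (right_tail r f x) \<le> exp_conv (Re r) f x"
  unfolding right_tail_def exp_conv_def
  by (intro Bochner_Integration.integral_norm_bound_integral right_tail_integrable exp_conv_integrand_integrable)
     (auto simp: norm_mult norm_exp_mult right_diff_distrib simp del: of_real_diff)

text \<open>After multiplication by exp (-r x) the point x enters only through the domain of
  integration, so up to an exponential factor the tail is an indefinite integral and can be
  differentiated.\<close>

lemma right_tail_shift:
  assumes cx: "c \<le> x"
  shows "exp (- r * of_real x) * right_tail r f x = exp (- r * of_real c) * right_tail r f c - integral {c..x} (\<lambda>y. exp (- r * of_real y) * f y)"
proof -
  have e: "exp (- r * of_real x) * (if x < y then exp (r * of_real (x - y)) * f y else 0) = (if x < y then exp (- r * of_real y) * f y else 0)" for x y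
    by (simp add: exp_add[symmetric] mult.assoc[symmetric] algebra_simps)
  have P: "exp (- r * of_real x) * right_tail r f x = (\<integral>y. (if x < y then exp (- r * of_real y) * f y else 0) \<partial>lborel)" for x
    unfolding right_tail_def Bochner_Integration.integral_mult_right_zero[symmetric] e ..
  have int: "integrable lborel (\<lambda>y. if x < y then exp (- r * of_real y) * f y else 0)" for x
    using integrable_mult_right[OF right_tail_integrable[of x], of "exp (- r * of_real x)"] unfolding e by simp
  let ?h = "\<lambda>y. (if c < y then exp (- r * of_real y) * f y else 0) - (if x < y then exp (- r * of_real y) * f y else 0)"
  \<comment> \<open>The two sides differ at most at the endpoint y = c.\<close>
  have ae: "AE y in lborel. ?h y = indicator {c..x} y *\<^sub>R (exp (- r * of_real y) * f y)"
    using AE_lborel_singleton[of c] by eventually_elim (use cx in \<open>auto simp: indicator_def\<close>)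
  have hint: "integrable lborel ?h" using int by (intro Bochner_Integration.integrable_diff)
  have si: "set_integrable lborel {c..x} (\<lambda>y. exp (- r * of_real y) * f y)"
    unfolding set_integrable_def
    by (rule integrable_cong_AE_imp[OF hint]) (use ae in \<open>auto\<close>)
  have "exp (- r * of_real c) * right_tail r f c - exp (- r * of_real x) * right_tail r f x = (\<integral>y. ?h y \<partial>lborel)"
    unfolding P using int by simp
  also have "\<dots> = (LINT y:{c..x}|lborel. exp (- r * of_real y) * f y)"
    unfolding set_lebesgue_integral_def by (rule integral_cong_AE) (use ae in auto)
  also have "\<dots> = integral {c..x} (\<lambda>y. exp (- r * of_real y) * f y)"
    by (rule set_borel_integral_eq_integral(2)[OF si])
  finally show ?thesis by (simp add: algebra_simps)
qed

lemma right_tail_has_vector_derivative: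
  assumes cont: "continuous_on UNIV f"
  shows "(right_tail r f has_vector_derivative r * right_tail r f x - f x) (at x)"
proof -
  define c d where "c = x - 1" and "d = x + 1"
  define K where "K = exp (- r * of_real c) * right_tail r f c"
  let ?I = "\<lambda>u. integral {c..u} (\<lambda>y. exp (- r * of_real y) * f y)"
  have P: "right_tail r f u = exp (r * of_real u) * (K - ?I u)" if "u \<in> {c..d}" for u
    using right_tail_shift[of c u] that by (simp add: K_def exp_minus field_simps)
  have x: "x \<in> {c..d}" by (simp add: c_def d_def)
  have "continuous_on {c..d} (\<lambda>y. exp (- r * of_real y) * f y)"
    by (intro continuous_intros continuous_on_subset[OF cont]) auto
  hence "(?I has_vector_derivative exp (- r * of_real x) * f x) (at x within {c..d})"
    by (rule integral_has_vector_derivative[OF _ x])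
  hence "((\<lambda>u. exp (r * of_real u) * (K - ?I u)) has_vector_derivative
      exp (r * of_real x) * (0 - exp (- r * of_real x) * f x) + r * exp (r * of_real x) * (K - ?I x)) (at x within {c..d})"
    by (intro has_vector_derivative_mult exp_mult_has_vector_derivative has_vector_derivative_diff has_vector_derivative_const)
  moreover have "exp (r * of_real x) * (0 - exp (- r * of_real x) * f x) + r * exp (r * of_real x) * (K - ?I x) = r * right_tail r f x - f x"
    unfolding P[OF x] by (simp add: exp_minus field_simps)
  ultimately have D: "((\<lambda>u. exp (r * of_real u) * (K - ?I u)) has_vector_derivative r * right_tail r f x - f x) (at x within {c..d})"
    by simp
  have "(right_tail r f has_vector_derivative r * right_tail r f x - f x) (at x within {c..d})"
    by (rule has_vector_derivative_transform[OF x _ D]) (use P in auto)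
  moreover have "at x within {c..d} = at x" by (rule at_within_Icc_at) (auto simp: c_def d_def)
  ultimately show ?thesis by simp
qed

lemma f_refl_integrable: "integrable lborel (\<lambda>y. f (- y))"
  using lborel_integrable_real_affine[OF f, of "-1" 0] by simp

lemma left_tail_eq: "left_tail r f x = (\<integral>y. (if y < x then exp (- r * of_real (x - y)) * f y else 0) \<partial>lborel)"
  unfolding left_tail_def right_tail_def
  by (subst lborel_integral_real_affine[of "-1" _ 0]) (auto intro!: Bochner_Integration.integral_cong simp: algebra_simps)

lemma left_tail_integrable: "integrable lborel (\<lambda>y. if y < x then exp (- r * of_real (x - y)) * f y else 0)"
proof (rule Bochner_Integration.integrable_bound[OF f])
  show "(\<lambda>y. if y < x then exp (- r * of_real (x - y)) * f y else 0) \<in> borel_measurable lborel" by measurable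
  have "exp (Re (- r) * (x - y)) \<le> 1" if "y < x" for y using r that by simp
  thus "AE y in lborel. norm (if y < x then exp (- r * of_real (x - y)) * f y else 0) \<le> norm (f y)"
    by (intro AE_I2) (auto simp only: norm_mult norm_exp_mult norm_zero split: if_split intro!: mult_left_le_one_le norm_ge_zero exp_ge_zero)
qed

lemma left_tail_le: "cmod (left_tail r f x) \<le> exp_conv (Re r) f x"
  unfolding left_tail_eq exp_conv_def
  by (intro Bochner_Integration.integral_norm_bound_integral left_tail_integrable exp_conv_integrand_integrable)
     (auto simp: norm_mult norm_exp_eq_Re)

lemma green_eq: "green r f x = (right_tail r f x + left_tail r f x) / (2 * r)"
proof -
  have "right_tail r f x + left_tail r f x = (\<integral>y. (if x < y then exp (r * of_real (x - y)) * f y else 0) + (if y < x then exp (- r * of_real (x - y)) * f y else 0) \<partial>lborel)"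
    unfolding left_tail_eq right_tail_def using right_tail_integrable left_tail_integrable by simp
  also have "\<dots> = (\<integral>y. exp (- r * \<bar>x - y\<bar>) * f y \<partial>lborel)"
  proof (rule integral_cong_AE)
    show "AE y in lborel. (if x < y then exp (r * of_real (x - y)) * f y else 0) + (if y < x then exp (- r * of_real (x - y)) * f y else 0) = exp (- r * \<bar>x - y\<bar>) * f y"
      using AE_lborel_singleton[of x] by eventually_elim (auto simp: abs_if algebra_simps)
  qed measurable
  also have "\<dots> / (2 * r) = green r f x" unfolding green_def by (simp flip: integral_divide_zero)
  finally show ?thesis by simp
qed

end

definition green_deriv :: "complex \<Rightarrow> (real \<Rightarrow> complex) \<Rightarrow> real \<Rightarrow> complex" where
  "green_deriv r f x = (right_tail r f x - left_tail r f x) / 2"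

context
  fixes r :: complex and f :: "real \<Rightarrow> complex"
  assumes r: "Re r > 0" and f: "integrable lborel f" and cont: "continuous_on UNIV f"
begin

lemma r0: "r \<noteq> 0" using r by auto

lemma left_tail_has_vector_derivative: "(left_tail r f has_vector_derivative - r * left_tail r f x + f x) (at x)"
proof -
  have c: "continuous_on UNIV (\<lambda>y. f (- y))"
    by (rule continuous_on_compose2[OF cont]) (auto intro!: continuous_intros)
  note d = right_tail_has_vector_derivative[OF r f_refl_integrable[OF r f] c, of "- x"]
  have "((\<lambda>x. - x) has_vector_derivative -1) (at x)" by (auto intro!: derivative_eq_intros)
  from vector_diff_chain_at[OF this d]
  show ?thesis unfolding left_tail_def by (simp add: o_def algebra_simps)
qed

lemma green_has_vector_derivative: "(green r f has_vector_derivative green_deriv r f x) (at x)"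
proof -
  have "((\<lambda>x. (right_tail r f x + left_tail r f x) / (2 * r)) has_vector_derivative ((r * right_tail r f x - f x) + (- r * left_tail r f x + f x)) / (2 * r)) (at x)"
    by (intro has_vector_derivative_divide has_vector_derivative_add right_tail_has_vector_derivative[OF r f cont] left_tail_has_vector_derivative)
  moreover have "((r * right_tail r f x - f x) + (- r * left_tail r f x + f x)) / (2 * r) = green_deriv r f x"
    using r0 by (simp add: green_deriv_def field_simps)
  ultimately show ?thesis unfolding green_eq[OF r f, abs_def] by simp
qed

lemma green_deriv_has_vector_derivative: "(green_deriv r f has_vector_derivative r\<^sup>2 * green r f x - f x) (at x)"
proof -
  have "((\<lambda>x. (right_tail r f x - left_tail r f x) / 2) has_vector_derivative ((r * right_tail r f x - f x) - (- r * left_tail r f x + f x)) / 2) (at x)"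
    by (intro has_vector_derivative_divide has_vector_derivative_diff right_tail_has_vector_derivative[OF r f cont] left_tail_has_vector_derivative)
  moreover have "((r * right_tail r f x - f x) - (- r * left_tail r f x + f x)) / 2 = r\<^sup>2 * green r f x - f x"
    using r0 by (simp add: green_eq[OF r f] power2_eq_square field_simps)
  ultimately show ?thesis unfolding green_deriv_def[abs_def] by (simp only:)
qed

lemma green_square_integrable:
  "integrable lborel (\<lambda>x. (cmod (green r f x))\<^sup>2)" "integrable lborel (\<lambda>x. (cmod (green_deriv r f x))\<^sup>2)"
proof -
  let ?N = "\<integral>y. cmod (f y) \<partial>lborel"
  \<comment> \<open>A function dominated by \<open>exp_conv\<close> has its square dominated by the
    supremum bound times \<open>exp_conv\<close>.\<close>
  have gen: "integrable lborel (\<lambda>x. (cmod (h x))\<^sup>2)" if "continuous_on UNIV h" "\<And>x. cmod (h x) \<le> exp_conv (Re r) f x" for h :: "real \<Rightarrow> complex"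
  proof (rule Bochner_Integration.integrable_bound)
    show "integrable lborel (\<lambda>x. ?N * exp_conv (Re r) f x)" using integrable_exp_conv[OF r f] by simp
    show "(\<lambda>x. (cmod (h x))\<^sup>2) \<in> borel_measurable lborel" using borel_measurable_cont[OF that(1)] by measurable
    have "(cmod (h x))\<^sup>2 \<le> ?N * exp_conv (Re r) f x" for x
      unfolding power2_eq_square
      by (intro mult_mono order_trans[OF that(2)] exp_conv_bounds[OF r f]) auto
    thus "AE x in lborel. norm ((cmod (h x))\<^sup>2) \<le> norm (?N * exp_conv (Re r) f x)"
      by (intro AE_I2) (smt (verit) real_norm_def zero_le_power2)
  qed
  have c: "continuous_on UNIV (right_tail r f)" "continuous_on UNIV (left_tail r f)"
    by (rule vector_derivative_continuous[OF right_tail_has_vector_derivative[OF r f cont]], rule vector_derivative_continuous[OF left_tail_has_vector_derivative])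
  note i = gen[OF c(1) right_tail_le[OF r f]] gen[OF c(2) left_tail_le[OF r f]]
  note m = c[THEN borel_measurable_cont]
  show "integrable lborel (\<lambda>x. (cmod (green r f x))\<^sup>2)"
    using integrable_square_add[OF m i, of "1 / (2 * r)" "1 / (2 * r)"] by (simp add: green_eq[OF r f] add_divide_distrib)
  show "integrable lborel (\<lambda>x. (cmod (green_deriv r f x))\<^sup>2)"
    using integrable_square_add[OF m i, of "1/2" "- 1/2"] by (simp add: green_deriv_def diff_divide_distrib)
qed

lemma green_unique:
  assumes v: "\<And>x. (v has_vector_derivative v1 x) (at x)" "\<And>x. (v1 has_vector_derivative r\<^sup>2 * v x - f x) (at x)"
    and L2: "integrable lborel (\<lambda>x. (cmod (v x))\<^sup>2)" "integrable lborel (\<lambda>x. (cmod (v1 x))\<^sup>2)"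
  shows "v x = green r f x"
proof -
  have m: "v \<in> borel_measurable lborel" "v1 \<in> borel_measurable lborel" "green r f \<in> borel_measurable lborel" "green_deriv r f \<in> borel_measurable lborel"
    using vector_derivative_measurable[OF v(1)] vector_derivative_measurable[OF v(2)]
      vector_derivative_measurable[OF green_has_vector_derivative] vector_derivative_measurable[OF green_deriv_has_vector_derivative] by auto
  have "v x - green r f x = 0"
  proof (rule ode2_L2_unique[of "\<lambda>x. v x - green r f x" "\<lambda>x. v1 x - green_deriv r f x" r])
    show "((\<lambda>x. v x - green r f x) has_vector_derivative v1 x - green_deriv r f x) (at x)" for x
      by (intro has_vector_derivative_diff v green_has_vector_derivative)
    have "((\<lambda>x. v1 x - green_deriv r f x) has_vector_derivative (r\<^sup>2 * v x - f x) - (r\<^sup>2 * green r f x - f x)) (at x)" for x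
      by (intro has_vector_derivative_diff v green_deriv_has_vector_derivative)
    thus "((\<lambda>x. v1 x - green_deriv r f x) has_vector_derivative r\<^sup>2 * (v x - green r f x)) (at x)" for x
      by (simp add: algebra_simps)
    show "Re r \<noteq> 0" using r by simp
    show "integrable lborel (\<lambda>x. (cmod (v x - green r f x))\<^sup>2)"
      using integrable_square_add[OF m(1,3) L2(1) green_square_integrable(1), of 1 "-1"] by simp
    show "integrable lborel (\<lambda>x. (cmod (v1 x - green_deriv r f x))\<^sup>2)"
      using integrable_square_add[OF m(2,4) L2(2) green_square_integrable(2), of 1 "-1"] by simp
  qed
  thus ?thesis by simp
qed

end

section \<open>Antiderivatives of integrable functions\<close>

lemma antiderivative_shift:
  fixes f h :: "real \<Rightarrow> 'a::euclidean_space"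
  assumes h: "\<And>a b. set_integrable lborel {a..b} h"
    and f: "\<And>x. f x = f 0 + interval_lebesgue_integral lborel (ereal 0) (ereal x) h"
    and cx: "c \<le> x"
  shows "f x = f c + integral {c..x} h"
proof -
  have li: "interval_lebesgue_integrable lborel (ereal a) (ereal b) h" for a b
    unfolding interval_lebesgue_integrable_def einterval_eq
    by (auto intro: set_integrable_subset[OF h[of a b]] set_integrable_subset[OF h[of b a]])
  have "interval_lebesgue_integral lborel (ereal 0) (ereal c) h + interval_lebesgue_integral lborel (ereal c) (ereal x) h
      = interval_lebesgue_integral lborel (ereal 0) (ereal x) h"
    by (rule interval_integral_sum) (simp add: li flip: ereal_min ereal_max)
  moreover have "interval_lebesgue_integral lborel (ereal c) (ereal x) h = integral {c..x} h"
    by (rule interval_integral_eq_integral[OF cx h])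
  ultimately show ?thesis using f[of x] f[of c] by simp
qed

lemma antiderivative_continuous:
  fixes f h :: "real \<Rightarrow> 'a::euclidean_space"
  assumes h: "\<And>a b. set_integrable lborel {a..b} h"
    and f: "\<And>x. f x = f 0 + interval_lebesgue_integral lborel (ereal 0) (ereal x) h"
  shows "continuous_on UNIV f"
proof -
  have "isCont f x" for x
  proof -
    define c d where "c = x - 1" and "d = x + 1"
    have "h integrable_on {c..d}" using set_borel_integral_eq_integral(1)[OF h] .
    hence "continuous_on {c..d} (\<lambda>u. f c + integral {c..u} h)"
      by (intro continuous_intros indefinite_integral_continuous_1)
    hence "continuous_on {c..d} f"
      by (rule continuous_on_eq) (use antiderivative_shift[OF h f] in auto)
    thus ?thesis by (rule continuous_on_interior) (auto simp: c_def d_def)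
  qed
  thus ?thesis by (simp add: continuous_at_imp_continuous_on)
qed

text \<open>Regularity in one dimension: the eigenvalue equation prescribes the second derivative
  only almost everywhere, but by a continuous right-hand side, and the antiderivative does not see
  the difference.\<close>

lemma antiderivative_deriv:
  fixes f h k :: "real \<Rightarrow> 'a::euclidean_space"
  assumes h: "\<And>a b. set_integrable lborel {a..b} h"
    and f: "\<And>x. f x = f 0 + interval_lebesgue_integral lborel (ereal 0) (ereal x) h"
    and k: "continuous_on UNIV k" and ae: "AE x in lborel. h x = k x"
  shows "(f has_vector_derivative k x) (at x)"
proof -
  define c d where "c = x - 1" and "d = x + 1"
  have x: "x \<in> {c..d}" by (simp add: c_def d_def)
  have eq: "integral {c..u} h = integral {c..u} k" for u
  proof -
    have kc: "set_integrable lborel {c..u} k"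
      by (rule borel_integrable_atLeastAtMost') (rule continuous_on_subset[OF k], simp)
    have "(LINT y:{c..u}|lborel. h y) = (LINT y:{c..u}|lborel. k y)"
      unfolding set_lebesgue_integral_def
      by (rule integral_cong_AE)
         (use h[of c u] kc ae in \<open>auto simp: set_integrable_def elim!: eventually_mono\<close>)
    thus ?thesis using set_borel_integral_eq_integral(2)[OF h] set_borel_integral_eq_integral(2)[OF kc] by simp
  qed
  have "((\<lambda>u. integral {c..u} k) has_vector_derivative k x) (at x within {c..d})"
    by (rule integral_has_vector_derivative[OF continuous_on_subset[OF k] x]) simp
  hence "((\<lambda>u. f c + integral {c..u} k) has_vector_derivative 0 + k x) (at x within {c..d})"
    by (intro has_vector_derivative_add has_vector_derivative_const)
  hence D: "((\<lambda>u. f c + integral {c..u} k) has_vector_derivative k x) (at x within {c..d})" by simp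
  have "(f has_vector_derivative k x) (at x within {c..d})"
    by (rule has_vector_derivative_transform[OF x _ D]) (use antiderivative_shift[OF h f] eq in auto)
  moreover have "at x within {c..d} = at x" by (rule at_within_Icc_at) (auto simp: c_def d_def)
  ultimately show ?thesis by simp
qed

section \<open>Point spectrum and the determinant\<close>

definition coord1 :: "complex^2 \<Rightarrow> complex" where "coord1 v = v$1 + \<i> * v$2"
definition coord2 :: "complex^2 \<Rightarrow> complex" where "coord2 v = v$1 - \<i> * v$2"
text \<open>The vector a/2 (1, -i) + b/2 (1, i); in these coordinates every \<open>eig2\<close> is
  diagonal.\<close>

definition of_coords :: "complex \<Rightarrow> complex \<Rightarrow> complex^2" where
  "of_coords a b = (\<chi> i. if i = 1 then (a + b) / 2 else - \<i> * (a - b) / 2)"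

lemma of_coords_nth [simp]: "of_coords a b $ 1 = (a + b) / 2" "of_coords a b $ 2 = - \<i> * (a - b) / 2"
  by (simp_all add: of_coords_def)

lemma coord_of_coords [simp]: "coord1 (of_coords a b) = a" "coord2 (of_coords a b) = b" "of_coords (coord1 v) (coord2 v) = v"
  by (simp_all add: coord1_def coord2_def vec_eq_iff forall_2 field_simps)

lemma vec2_eq_iff: "v = w \<longleftrightarrow> coord1 v = coord1 w \<and> coord2 v = coord2 w"
  by (metis coord_of_coords(3))

lemma matvec2_nth: "(A *v v) $ i = A$i$1 * v$1 + A$i$2 * v$2" for A :: "'a::comm_semiring_1^2^2"
  by (simp add: matrix_vector_mult_def sum_2)

lemma coord_eig2: "coord1 (eig2 p q *v v) = p * coord1 v" "coord2 (eig2 p q *v v) = q * coord2 v"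
  by (simp_all add: coord1_def coord2_def matvec2_nth eig2_def field_simps)

lemma coord_add: "coord1 (v + w) = coord1 v + coord1 w" "coord2 (v + w) = coord2 v + coord2 w"
  by (simp_all add: coord1_def coord2_def algebra_simps)

lemma coord_scale: "coord1 (c *s v) = c * coord1 v" "coord2 (c *s v) = c * coord2 v"
  by (simp_all add: coord1_def coord2_def algebra_simps)

lemma bounded_linear_coord: "bounded_linear coord1" "bounded_linear coord2"
  by (auto intro!: linear_conv_bounded_linear[THEN iffD1] linearI simp: coord1_def coord2_def algebra_simps)

lemma bounded_linear_of_coords: "bounded_linear (\<lambda>p. of_coords (fst p) (snd p))"
  by (auto intro!: linear_conv_bounded_linear[THEN iffD1] linearI simp: vec_eq_iff forall_2 field_simps scaleR_conv_of_real[where 'a=complex])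

lemma continuous_on_of_coords:
  "continuous_on A p \<Longrightarrow> continuous_on A q \<Longrightarrow> continuous_on A (\<lambda>x. of_coords (p x) (q x))"
  using bounded_linear.continuous_on[OF bounded_linear_of_coords continuous_on_Pair] by simp

lemma norm_vec2: "(norm v)\<^sup>2 = (cmod (v$1))\<^sup>2 + (cmod (v$2))\<^sup>2" for v :: "complex^2"
  by (simp add: norm_vec_def L2_set_def sum_2)

lemma norm_coord_le: "(cmod (coord1 v))\<^sup>2 \<le> 2 * (norm v)\<^sup>2" "(cmod (coord2 v))\<^sup>2 \<le> 2 * (norm v)\<^sup>2"
  using square_sum_le[of "v$1" "\<i> * v$2"] square_sum_le[of "v$1" "- \<i> * v$2"]
  by (simp_all add: coord1_def coord2_def norm_vec2 norm_mult)

lemma cmod_coord_le: "cmod (coord1 v) \<le> cmod (v$1) + cmod (v$2)" "cmod (coord2 v) \<le> cmod (v$1) + cmod (v$2)"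
  using norm_triangle_ineq[of "v$1" "\<i> * v$2"] norm_triangle_ineq4[of "v$1" "\<i> * v$2"]
  by (simp_all add: coord1_def coord2_def norm_mult)

lemma norm_of_coords_le: "(norm (of_coords a b))\<^sup>2 \<le> (cmod a)\<^sup>2 + (cmod b)\<^sup>2"
  using square_sum_le[of a b] square_sum_le[of a "- b"]
  by (simp add: norm_vec2 norm_divide norm_mult power_divide)

lemma cmod_of_coords_nth_le: "cmod (of_coords a b $ i) \<le> cmod a + cmod b"
proof -
  have "cmod (a + b) \<le> cmod a * 2 + cmod b * 2" "cmod (a - b) \<le> cmod a * 2 + cmod b * 2"
    by (rule order_trans[OF norm_triangle_ineq], simp, rule order_trans[OF norm_triangle_ineq4], simp)
  thus ?thesis using exhaust_2[of i] by (auto simp: norm_divide norm_mult)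
qed

lemma cmod_eig2_le: "cmod (eig2 p q $ i $ j) \<le> cmod p + cmod q"
proof -
  have "cmod (p + q) \<le> cmod p * 2 + cmod q * 2" "cmod (p - q) \<le> cmod p * 2 + cmod q * 2"
    by (rule order_trans[OF norm_triangle_ineq], simp, rule order_trans[OF norm_triangle_ineq4], simp)
  thus ?thesis using exhaust_2[of i] exhaust_2[of j] by (auto simp: eig2_def norm_divide norm_mult)
qed

lemma cplx_nth [simp]: "cplx A $ i $ j = complex_of_real (A $ i $ j)"
  by (simp add: cplx_def)

lemma integrable_dominated:
  fixes F :: "real \<Rightarrow> complex" and h :: "real \<Rightarrow> real"
  assumes "integrable lborel h" "F \<in> borel_measurable lborel" "\<And>x. cmod (F x) \<le> h x"
  shows "integrable lborel F"
proof (rule Bochner_Integration.integrable_bound[OF assms(1,2)])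
  show "AE x in lborel. cmod (F x) \<le> norm (h x)"
    using assms(3) by (intro AE_I2) (metis abs_ge_self order_trans real_norm_def)
qed

section \<open>Decay of the weights and of the kernel\<close>

locale pulse =
  fixes D \<beta> \<delta> \<alpha> \<epsilon> \<gamma> \<mu> \<nu> :: real and \<psi> :: "real \<Rightarrow> complex" and lam r1 r2 :: complex and C a :: real
  assumes D\<beta>: "(D, \<beta>) \<noteq> (0, 0)"
    and psi_cont: "continuous_on UNIV \<psi>"
    and C_pos: "C > 0" and a_pos: "a > 0" and psi_le: "cmod (\<psi> x) \<le> C * exp (- a * \<bar>x\<bar>)"
    and r1: "(lam - Complex \<delta> \<alpha>) / Complex \<beta> (D/2) = r1\<^sup>2" "Re r1 > 0"
    and r2: "(lam - Complex \<delta> (- \<alpha>)) / Complex \<beta> (- D/2) = r2\<^sup>2" "Re r2 > 0"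
begin

definition Mx :: "real \<Rightarrow> real^2^2" where "Mx x = Mmat \<epsilon> \<gamma> \<mu> \<nu> \<psi> x"
definition Mc :: "real \<Rightarrow> complex^2^2" where "Mc x = cplx (Mx x)"
definition S :: "real \<Rightarrow> complex^2^2" where "S x = cplx (polar_right (Mx x))"
definition T :: "real \<Rightarrow> complex^2^2" where "T x = cplx (polar_left (Mx x))"
definition b1 :: complex where "b1 = Complex \<beta> (D/2)"
definition b2 :: complex where "b2 = Complex \<beta> (- D/2)"
definition K :: "real \<Rightarrow> real \<Rightarrow> complex^idx4^idx4" where "K = Kker D \<beta> \<delta> \<alpha> \<epsilon> \<gamma> \<mu> \<nu> \<psi> lam"
definition k1 :: "real \<Rightarrow> real \<Rightarrow> complex" where "k1 x y = exp (- r1 * \<bar>x - y\<bar>) / (2 * r1) / b1"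
definition k2 :: "real \<Rightarrow> real \<Rightarrow> complex" where "k2 x y = exp (- r2 * \<bar>x - y\<bar>) / (2 * r2) / b2"

lemma b_nonzero: "b1 \<noteq> 0" "b2 \<noteq> 0" "r1 \<noteq> 0" "r2 \<noteq> 0"
  using D\<beta> r1(2) r2(2) by (auto simp: b1_def b2_def complex_eq_iff)

lemma b_r: "b1 * r1\<^sup>2 = lam - Complex \<delta> \<alpha>" "b2 * r2\<^sup>2 = lam - Complex \<delta> (- \<alpha>)"
  using r1(1) r2(1) b_nonzero(1,2) unfolding b1_def[symmetric] b2_def[symmetric] by (auto simp: field_simps)

lemma K_eq: "K x y = blockm (- (S x ** eig2 (k1 x y) (k2 x y) ** T y)) 0 0 0"
  unfolding K_def Kker_eq[OF D\<beta> r1(1) r2(1) r1(2) r2(2)]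
  by (simp add: S_def T_def polar_right_def polar_left_def Mx_def k1_def k2_def b1_def b2_def)

lemma TS: "T x ** S x = Mc x"
  unfolding T_def S_def Mc_def cplx_mult[symmetric] polar_left_right ..

lemma norm_psivec: "norm (psivec \<psi> x) = cmod (\<psi> x)"
  by (simp add: psivec_def norm_vec_def L2_set_def sum_2 cmod_def)

lemma Mx_nth: "Mx x $ i $ j = (cmod (\<psi> x))\<^sup>2 * rc \<epsilon> \<gamma> $ i $ j + (cmod (\<psi> x))^4 * rc \<mu> \<nu> $ i $ j
   + ((2 * rc \<epsilon> \<gamma> $ i $ 1 + 4 * (cmod (\<psi> x))\<^sup>2 * rc \<mu> \<nu> $ i $ 1) * (psivec \<psi> x $ 1 * psivec \<psi> x $ j)
    + (2 * rc \<epsilon> \<gamma> $ i $ 2 + 4 * (cmod (\<psi> x))\<^sup>2 * rc \<mu> \<nu> $ i $ 2) * (psivec \<psi> x $ 2 * psivec \<psi> x $ j))"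
  unfolding Mx_def Mmat_def norm_psivec by (simp add: mult2_nth outer_def)

lemma Mx_continuous: "continuous_on UNIV (\<lambda>x. Mx x $ i $ j)"
proof -
  have c: "continuous_on UNIV (\<lambda>x. psivec \<psi> x $ k)" for k
    unfolding psivec_def using psi_cont by (cases "k = 1") (auto intro!: continuous_intros)
  show ?thesis unfolding Mx_nth
    by (intro continuous_on_add continuous_on_mult continuous_on_power continuous_on_norm continuous_on_const c psi_cont)
qed

lemma Mx_measurable: "(\<lambda>x. Mx x $ i $ j) \<in> borel_measurable lborel"
  by (rule borel_measurable_cont[OF Mx_continuous])

text \<open>In M the cubic matrix occurs once directly and, with factor 2, in each of the two
  products of a row with the outer product, giving 5 = 1 + 2 * 2; the quintic one gives 9 = 1 + 2 *
  4, its extra power |psi|^2 being bounded by C^2.\<close>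

definition C1 :: real where
  "C1 = C\<^sup>2 * (5 * (\<bar>\<epsilon>\<bar> + \<bar>\<gamma>\<bar>) + 9 * C\<^sup>2 * (\<bar>\<mu>\<bar> + \<bar>\<nu>\<bar>))"

lemma exp_sq: "exp (- a * \<bar>x\<bar>) * exp (- a * \<bar>x\<bar>) = exp (- (2 * a) * \<bar>x\<bar>)"
  by (simp add: exp_add[symmetric])

lemma Mx_le: "\<bar>Mx x $ i $ j\<bar> \<le> C1 * exp (- (2 * a) * \<bar>x\<bar>)"
proof -
  define n where "n = cmod (\<psi> x)"
  define A B where "A = \<bar>\<epsilon>\<bar> + \<bar>\<gamma>\<bar>" and "B = \<bar>\<mu>\<bar> + \<bar>\<nu>\<bar>"
  have A: "A \<ge> 0" "B \<ge> 0" by (auto simp: A_def B_def)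
  have rc: "\<bar>rc \<epsilon> \<gamma> $ i $ j\<bar> \<le> A" "\<bar>rc \<mu> \<nu> $ i $ j\<bar> \<le> B" for i j
    by (auto simp: rc_def A_def B_def)
  have v: "\<bar>psivec \<psi> x $ k\<bar> \<le> n" for k
    using component_le_norm_cart[of "psivec \<psi> x" k] by (simp add: norm_psivec n_def)
  have n0: "n \<ge> 0" by (simp add: n_def)
  have vv: "\<bar>psivec \<psi> x $ k * psivec \<psi> x $ j\<bar> \<le> n\<^sup>2" for k
    unfolding abs_mult power2_eq_square by (intro mult_mono v) (auto simp: n0)
  have t: "\<bar>(2 * rc \<epsilon> \<gamma> $ i $ k + 4 * n\<^sup>2 * rc \<mu> \<nu> $ i $ k) * (psivec \<psi> x $ k * psivec \<psi> x $ j)\<bar> \<le> (2 * A + 4 * n\<^sup>2 * B) * n\<^sup>2" for k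
  proof -
    have "\<bar>2 * rc \<epsilon> \<gamma> $ i $ k + 4 * n\<^sup>2 * rc \<mu> \<nu> $ i $ k\<bar> \<le> \<bar>2 * rc \<epsilon> \<gamma> $ i $ k\<bar> + \<bar>4 * n\<^sup>2 * rc \<mu> \<nu> $ i $ k\<bar>"
      by (rule abs_triangle_ineq)
    also have "\<dots> \<le> 2 * A + 4 * n\<^sup>2 * B"
      by (intro add_mono) (use rc[of i k] in \<open>auto simp: abs_mult intro!: mult_left_mono\<close>)
    finally show ?thesis unfolding abs_mult[of "2 * rc \<epsilon> \<gamma> $ i $ k + 4 * n\<^sup>2 * rc \<mu> \<nu> $ i $ k"]
      by (intro mult_mono vv) (use A in auto)
  qed
  have p: "\<bar>n\<^sup>2 * rc \<epsilon> \<gamma> $ i $ j\<bar> \<le> n\<^sup>2 * A" "\<bar>n^4 * rc \<mu> \<nu> $ i $ j\<bar> \<le> n^4 * B"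
    using rc[of i j] by (auto simp: abs_mult intro!: mult_left_mono)
  have "\<bar>Mx x $ i $ j\<bar> \<le> n\<^sup>2 * A + n^4 * B + ((2 * A + 4 * n\<^sup>2 * B) * n\<^sup>2 + (2 * A + 4 * n\<^sup>2 * B) * n\<^sup>2)"
    unfolding Mx_nth n_def[symmetric]
    by (intro order_trans[OF abs_triangle_ineq] add_mono p t)
  also have "\<dots> = n\<^sup>2 * (5 * A + 9 * n\<^sup>2 * B)" by (simp add: algebra_simps power2_eq_square power4_eq_xxxx)
  also have "\<dots> \<le> n\<^sup>2 * (5 * A + 9 * C\<^sup>2 * B)"
  proof -
    have "n \<le> C * exp (- a * \<bar>x\<bar>)" unfolding n_def by (rule psi_le)
    also have "\<dots> \<le> C * 1" using C_pos a_pos by (intro mult_left_mono) auto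
    finally have "n\<^sup>2 \<le> C\<^sup>2" using n0 by (intro power_mono) auto
    thus ?thesis using A by (intro mult_left_mono add_left_mono mult_right_mono) auto
  qed
  also have "\<dots> \<le> (C * exp (- a * \<bar>x\<bar>))\<^sup>2 * (5 * A + 9 * C\<^sup>2 * B)"
    using A n0 psi_le[of x] by (intro mult_right_mono power_mono) (auto simp: n_def)
  also have "\<dots> = C1 * exp (- (2 * a) * \<bar>x\<bar>)"
    unfolding exp_sq[symmetric] by (simp add: C1_def A_def B_def power2_eq_square)
  finally show ?thesis .
qed

text \<open>The squared entries of the weights are at most twice the sum of the four entries of |M
  x| taken in modulus, whence 8 = 2 * 4.\<close>

definition C2 :: real where "C2 = sqrt (8 * C1)"

lemma C1_nonneg: "C1 \<ge> 0" by (simp add: C1_def)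

lemma ST_le: "cmod (S x $ i $ j) \<le> C2 * exp (- a * \<bar>x\<bar>)" "cmod (T x $ i $ j) \<le> C2 * exp (- a * \<bar>x\<bar>)"
proof -
  have e: "2 * (\<bar>Mx x$1$1\<bar> + \<bar>Mx x$1$2\<bar> + \<bar>Mx x$2$1\<bar> + \<bar>Mx x$2$2\<bar>) \<le> (C2 * exp (- a * \<bar>x\<bar>))\<^sup>2"
  proof -
    have "(C2 * exp (- a * \<bar>x\<bar>))\<^sup>2 = 8 * (C1 * exp (- (2 * a) * \<bar>x\<bar>))"
      unfolding exp_sq[symmetric] using C1_nonneg by (simp add: C2_def power_mult_distrib power2_eq_square[of "exp _"])
    thus ?thesis using Mx_le[of x 1 1] Mx_le[of x 1 2] Mx_le[of x 2 1] Mx_le[of x 2 2] by argo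
  qed
  have p: "0 \<le> C2 * exp (- a * \<bar>x\<bar>)" using C1_nonneg by (simp add: C2_def)
  show "cmod (S x $ i $ j) \<le> C2 * exp (- a * \<bar>x\<bar>)"
    using order_trans[OF polar_right_le e] p by (simp add: S_def abs_le_square_iff[symmetric])
  show "cmod (T x $ i $ j) \<le> C2 * exp (- a * \<bar>x\<bar>)"
    using order_trans[OF polar_left_le e] p by (simp add: T_def abs_le_square_iff[symmetric])
qed

lemma C2_nonneg: "C2 \<ge> 0" using C1_nonneg by (simp add: C2_def)

lemma ST_measurable: "(\<lambda>x. S x $ i $ j) \<in> borel_measurable lborel" "(\<lambda>x. T x $ i $ j) \<in> borel_measurable lborel"
  using borel_measurable_polar[OF Mx_measurable, of i j] unfolding S_def T_def cplx_nth by measurable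

lemma Mc_continuous: "continuous_on UNIV (\<lambda>x. Mc x $ i $ j)"
  unfolding Mc_def cplx_nth by (intro continuous_intros Mx_continuous)

lemma Mc_le: "cmod (Mc x $ i $ j) \<le> C1 * exp (- (2 * a) * \<bar>x\<bar>)"
  using Mx_le by (simp add: Mc_def)

definition c3 :: real where "c3 = 1 / (2 * cmod r1 * cmod b1) + 1 / (2 * cmod r2 * cmod b2)"
text \<open>An entry of a product of three 2x2 matrices has four terms, each at most C2 c3 C2 times
  the two exponentials. The added 1 keeps \<open>g\<close> positive when M vanishes and makes it
  dominate the bare exponential.\<close>

definition c4 :: real where "c4 = 4 * C2 * c3 * C2 + 1"
definition g :: "real \<Rightarrow> real" where "g x = sqrt c4 * exp (- a * \<bar>x\<bar>)"

lemma c3_nonneg: "c3 \<ge> 0" by (simp add: c3_def)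
lemma c4_ge_1: "c4 \<ge> 1" using c3_nonneg C2_nonneg by (simp add: c4_def)

lemma exp_le_g: "exp (- a * \<bar>x\<bar>) \<le> g x"
  using c4_ge_1 by (simp add: g_def)

sublocale weighted_line g
proof
  show "g \<in> borel_measurable lborel" unfolding g_def by measurable
  show "g x > 0" for x using c4_ge_1 by (simp add: g_def)
  have "(\<lambda>x. (g x)\<^sup>2) = (\<lambda>x. c4 * exp (- (2 * a) * \<bar>x\<bar>))"
    unfolding exp_sq[symmetric] using c4_ge_1 by (auto simp: g_def power_mult_distrib power2_eq_square[of "exp _"])
  thus "integrable lborel (\<lambda>x. (g x)\<^sup>2)"
    using integrable_exp_neg_abs[of "2 * a"] a_pos by simp
qed

lemma k_le: "cmod (k1 x y) + cmod (k2 x y) \<le> c3"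
proof -
  have "exp (- Re r1 * \<bar>x - y\<bar>) \<le> 1" "exp (- Re r2 * \<bar>x - y\<bar>) \<le> 1" using r1(2) r2(2) by auto
  thus ?thesis unfolding k1_def k2_def c3_def norm_divide norm_mult norm_kernel
    by (intro add_mono) (auto simp: divide_divide_eq_left intro!: divide_right_mono)
qed

lemma SKT_nth: "(S x ** Q ** T y) $ i $ j = S x$i$1 * Q$1$1 * T y$1$j + S x$i$2 * Q$2$1 * T y$1$j
    + (S x$i$1 * Q$1$2 * T y$2$j + S x$i$2 * Q$2$2 * T y$2$j)"
  by (simp add: mult2_nth algebra_simps)

lemma K_le: "cmod (K x y $ i $ j) \<le> g x * g y"
proof -
  have gg: "g x * g y = c4 * (exp (- a * \<bar>x\<bar>) * exp (- a * \<bar>y\<bar>))"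
    using c4_ge_1 by (simp add: g_def)
  have pos: "0 \<le> g x * g y" using g_pos by (simp add: less_imp_le)
  have "cmod ((S x ** eig2 (k1 x y) (k2 x y) ** T y) $ i $ j) \<le> g x * g y" for i j
  proof -
    have t: "cmod (S x$i$l * eig2 (k1 x y) (k2 x y)$l$m * T y$m$j) \<le> C2 * exp (- a * \<bar>x\<bar>) * c3 * (C2 * exp (- a * \<bar>y\<bar>))" for l m
      unfolding norm_mult
      by (intro mult_mono ST_le order_trans[OF cmod_eig2_le k_le]) (use C2_nonneg c3_nonneg in auto)
    have "cmod ((S x ** eig2 (k1 x y) (k2 x y) ** T y) $ i $ j) \<le>
       (C2 * exp (- a * \<bar>x\<bar>) * c3 * (C2 * exp (- a * \<bar>y\<bar>)) + C2 * exp (- a * \<bar>x\<bar>) * c3 * (C2 * exp (- a * \<bar>y\<bar>))) +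
       (C2 * exp (- a * \<bar>x\<bar>) * c3 * (C2 * exp (- a * \<bar>y\<bar>)) + C2 * exp (- a * \<bar>x\<bar>) * c3 * (C2 * exp (- a * \<bar>y\<bar>)))"
      unfolding SKT_nth by (intro norm_triangle_le add_mono t)
    also have "\<dots> = (c4 - 1) * (exp (- a * \<bar>x\<bar>) * exp (- a * \<bar>y\<bar>))" by (simp add: c4_def)
    also have "\<dots> \<le> g x * g y" unfolding gg by (intro mult_right_mono) auto
    finally show ?thesis .
  qed
  thus ?thesis unfolding K_eq using pos by (cases i; cases j) auto
qed

lemma K_measurable: "(\<lambda>p. K (fst p) (snd p) $ i $ j) \<in> borel_measurable (lborel \<Otimes>\<^sub>M lborel)"
proof -
  have S: "(\<lambda>p. S (fst p) $ i $ j) \<in> borel_measurable (lborel \<Otimes>\<^sub>M lborel)" 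
    and T: "(\<lambda>p. T (snd p) $ i $ j) \<in> borel_measurable (lborel \<Otimes>\<^sub>M lborel)" for i j
    by (rule measurable_compose[OF measurable_fst ST_measurable(1)], rule measurable_compose[OF measurable_snd ST_measurable(2)])
  have k: "(\<lambda>p. k1 (fst p) (snd p)) \<in> borel_measurable (lborel \<Otimes>\<^sub>M lborel)"
    "(\<lambda>p. k2 (fst p) (snd p)) \<in> borel_measurable (lborel \<Otimes>\<^sub>M lborel)"
    unfolding k1_def k2_def by measurable
  have c: "(\<lambda>p. eig2 (k1 (fst p) (snd p)) (k2 (fst p) (snd p)) $ i $ j) \<in> borel_measurable (lborel \<Otimes>\<^sub>M lborel)" for i j
    unfolding eig2_def using k by (cases "i = j"; cases "i = 1") simp_all
  have "(\<lambda>p. (S (fst p) ** eig2 (k1 (fst p) (snd p)) (k2 (fst p) (snd p)) ** T (snd p)) $ i $ j) \<in> borel_measurable (lborel \<Otimes>\<^sub>M lborel)" for i j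
    unfolding SKT_nth using S T c by (intro borel_measurable_add borel_measurable_times) auto
  thus ?thesis unfolding K_eq by (cases i; cases j) simp_all
qed

section \<open>The unperturbed resolvent and the action of the kernel\<close>

definition source1 :: "(real \<Rightarrow> complex^2) \<Rightarrow> real \<Rightarrow> complex" where "source1 f y = coord1 (f y) / b1"
definition source2 :: "(real \<Rightarrow> complex^2) \<Rightarrow> real \<Rightarrow> complex" where "source2 f y = coord2 (f y) / b2"
text \<open>Inverse of lam - N0 - B d^2/dx^2 in the eigenvector coordinates: there the equation for
  u reads u'' = r^2 u - f / b, with the root r and the eigenvalue b of B for the coordinate
  concerned.\<close>

definition resolvent :: "(real \<Rightarrow> complex^2) \<Rightarrow> real \<Rightarrow> complex^2" where
  "resolvent f x = of_coords (green r1 (source1 f) x) (green r2 (source2 f) x)"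

lemma source_measurable:
  assumes "\<And>i. (\<lambda>y. f y $ i) \<in> borel_measurable lborel"
  shows "source1 f \<in> borel_measurable lborel" "source2 f \<in> borel_measurable lborel"
  unfolding source1_def source2_def coord1_def coord2_def using assms by measurable

lemma source_le:
  assumes "\<And>i. cmod (f y $ i) \<le> B"
  shows "cmod (source1 f y) \<le> 2 / cmod b1 * B" "cmod (source2 f y) \<le> 2 / cmod b2 * B"
  using order_trans[OF cmod_coord_le(1) add_mono[OF assms assms]] order_trans[OF cmod_coord_le(2) add_mono[OF assms assms]]
    b_nonzero by (auto simp: source1_def source2_def norm_divide field_simps)

text \<open>The factorisation of K as -S R T on the upper components; on the lower ones it gives 0.
  The source f = T w decays at the double rate, one factor coming from T and one from w.\<close>

lemma kernel_action:
  fixes w :: "idx4 \<Rightarrow> real \<Rightarrow> complex"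
  assumes w: "\<And>i. w i \<in> borel_measurable lborel" "\<And>i x. cmod (w i x) \<le> B * g x"
    and f_eq: "\<And>y. f y = T y *v (\<chi> j. w (Inl j) y)"
  shows "integrable lborel (source1 f)" "integrable lborel (source2 f)"
    and "\<And>i. (\<lambda>y. f y $ i) \<in> borel_measurable lborel"
    and "\<And>i y. cmod (f y $ i) \<le> 2 * C2 * B * sqrt c4 * exp (- (2 * a) * \<bar>y\<bar>)"
    and "(\<Sum>j\<in>UNIV. \<integral>y. K x y $ i $ j * w j y \<partial>lborel) = (case i of Inl i \<Rightarrow> - ((S x *v resolvent f x) $ i) | Inr _ \<Rightarrow> 0)"
proof -
  have fn: "f y $ i = T y $ i $ 1 * w (Inl 1) y + T y $ i $ 2 * w (Inl 2) y" for y i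
    by (simp add: f_eq matvec2_nth)
  show fm: "(\<lambda>y. f y $ i) \<in> borel_measurable lborel" for i
    unfolding fn using ST_measurable w(1) by (intro borel_measurable_add borel_measurable_times)
  show fle: "cmod (f y $ i) \<le> 2 * C2 * B * sqrt c4 * exp (- (2 * a) * \<bar>y\<bar>)" for i y
  proof -
    have t: "cmod (T y $ i $ j * w l y) \<le> C2 * exp (- a * \<bar>y\<bar>) * (B * g y)" for j l
      unfolding norm_mult by (intro mult_mono ST_le w) (auto simp: C2_nonneg)
    have "cmod (f y $ i) \<le> C2 * exp (- a * \<bar>y\<bar>) * (B * g y) + C2 * exp (- a * \<bar>y\<bar>) * (B * g y)"
      unfolding fn by (intro norm_triangle_le add_mono t)
    also have "\<dots> = 2 * C2 * B * sqrt c4 * (exp (- a * \<bar>y\<bar>) * exp (- a * \<bar>y\<bar>))" by (simp add: g_def)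
    finally show ?thesis unfolding exp_sq .
  qed
  have e: "integrable lborel (\<lambda>y. exp (- (2 * a) * \<bar>y\<bar>))" by (rule integrable_exp_neg_abs) (use a_pos in simp)
  show I1: "integrable lborel (source1 f)"
    by (rule integrable_dominated[OF _ source_measurable(1)[OF fm] source_le(1)[OF fle]]) (intro integrable_mult_right e)
  show I2: "integrable lborel (source2 f)"
    by (rule integrable_dominated[OF _ source_measurable(2)[OF fm] source_le(2)[OF fle]]) (intro integrable_mult_right e)
  have Ki: "integrable lborel (\<lambda>y. K x y $ i $ j * w j y)" for i j
  proof (rule Bochner_Integration.integrable_bound)
    show "integrable lborel (\<lambda>y. g x * B * (g y)\<^sup>2)" using g2_integrable by simp
    have "(\<lambda>y. K x y $ i $ j) \<in> borel_measurable lborel"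
      using measurable_compose[OF measurable_Pair1' K_measurable[of i j], of x] by simp
    thus "(\<lambda>y. K x y $ i $ j * w j y) \<in> borel_measurable lborel" using w(1) by (intro borel_measurable_times)
    have "cmod (K x y $ i $ j * w j y) \<le> g x * g y * (B * g y)" for y
      unfolding norm_mult by (intro mult_mono K_le w) (use g_pos in \<open>auto simp: less_imp_le\<close>)
    moreover have "g x * g y * (B * g y) = g x * B * (g y)\<^sup>2" for y by (simp add: power2_eq_square mult_ac)
    ultimately have "cmod (K x y $ i $ j * w j y) \<le> g x * B * (g y)\<^sup>2" for y by (simp only:)
    thus "AE y in lborel. cmod (K x y $ i $ j * w j y) \<le> norm (g x * B * (g y)\<^sup>2)"
      by (intro AE_I2) (metis abs_ge_self order_trans real_norm_def)
  qed
  show "(\<Sum>j\<in>UNIV. \<integral>y. K x y $ i $ j * w j y \<partial>lborel) = (case i of Inl i \<Rightarrow> - ((S x *v resolvent f x) $ i) | Inr _ \<Rightarrow> 0)"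
  proof (cases i)
    case (Inr i')
    thus ?thesis by (simp add: sum_UNIV_Plus K_eq)
  next
    case (Inl i')
    have p: "k1 x y * coord1 (f y) = exp (- r1 * \<bar>x - y\<bar>) / (2 * r1) * source1 f y"
      "k2 x y * coord2 (f y) = exp (- r2 * \<bar>x - y\<bar>) / (2 * r2) * source2 f y" for y
      by (simp_all add: k1_def k2_def source1_def source2_def)
    note i1 = kernel_integrable[OF r1(2) I1, of x, folded p]
    note i2 = kernel_integrable[OF r2(2) I2, of x, folded p]
    have "(\<Sum>j\<in>UNIV. K x y $ i $ j * w j y) = - (S x $ i' $ 1 * ((k1 x y * coord1 (f y) + k2 x y * coord2 (f y)) / 2)
         + S x $ i' $ 2 * (- \<i> * (k1 x y * coord1 (f y) - k2 x y * coord2 (f y)) / 2))" for y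
    proof -
      have "(\<Sum>j\<in>UNIV. K x y $ i $ j * w j y) = - (((S x ** eig2 (k1 x y) (k2 x y) ** T y) *v (\<chi> j. w (Inl j) y)) $ i')"
        by (simp add: sum_UNIV_Plus K_eq Inl matvec2_nth sum_2 algebra_simps)
      also have "(S x ** eig2 (k1 x y) (k2 x y) ** T y) *v (\<chi> j. w (Inl j) y) = S x *v (eig2 (k1 x y) (k2 x y) *v f y)"
        by (simp add: f_eq matrix_vector_mul_assoc matrix_mul_assoc)
      also have "eig2 (k1 x y) (k2 x y) *v f y = of_coords (k1 x y * coord1 (f y)) (k2 x y * coord2 (f y))"
        by (simp add: vec2_eq_iff coord_eig2)
      finally show ?thesis by (simp add: matvec2_nth)
    qed
    hence "(\<Sum>j\<in>UNIV. \<integral>y. K x y $ i $ j * w j y \<partial>lborel) = (\<integral>y. - (S x $ i' $ 1 * ((k1 x y * coord1 (f y) + k2 x y * coord2 (f y)) / 2)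
         + S x $ i' $ 2 * (- \<i> * (k1 x y * coord1 (f y) - k2 x y * coord2 (f y)) / 2)) \<partial>lborel)"
      using Bochner_Integration.integral_sum[of UNIV lborel "\<lambda>j y. K x y $ i $ j * w j y"] Ki by simp
    also have "\<dots> = - (S x $ i' $ 1 * (((\<integral>y. k1 x y * coord1 (f y) \<partial>lborel) + (\<integral>y. k2 x y * coord2 (f y) \<partial>lborel)) / 2)
         + S x $ i' $ 2 * (- \<i> * ((\<integral>y. k1 x y * coord1 (f y) \<partial>lborel) - (\<integral>y. k2 x y * coord2 (f y) \<partial>lborel)) / 2))"
      using i1 i2 by simp
    also have "(\<integral>y. k1 x y * coord1 (f y) \<partial>lborel) = green r1 (source1 f) x" unfolding p green_def ..
    also have "(\<integral>y. k2 x y * coord2 (f y) \<partial>lborel) = green r2 (source2 f) x" unfolding p green_def ..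
    finally show ?thesis by (simp add: Inl resolvent_def matvec2_nth)
  qed
qed

lemma Mcv_nth: "(Mc x *v u) $ i = Mc x $ i $ 1 * u $ 1 + Mc x $ i $ 2 * u $ 2"
  by (rule matvec2_nth)

text \<open>Multiplication by B and N0 is diagonal in the eigenvector coordinates, where b r^2 = lam
  - d with d the matching eigenvalue of N0; dividing by b solves for the second derivative.\<close>

lemma eigen_equation_iff:
  "cplx (rc \<beta> (D/2)) *v u2 + cplx (rc \<delta> \<alpha> + Mmat \<epsilon> \<gamma> \<mu> \<nu> \<psi> x) *v u = lam *s u
   \<longleftrightarrow> u2 = of_coords (r1\<^sup>2 * coord1 u - coord1 (Mc x *v u) / b1) (r2\<^sup>2 * coord2 u - coord2 (Mc x *v u) / b2)"
proof -
  have 1: "cplx (rc \<beta> (D/2)) = eig2 b1 b2" by (simp add: cplx_rc b1_def b2_def)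
  have 2: "cplx (rc \<delta> \<alpha> + Mmat \<epsilon> \<gamma> \<mu> \<nu> \<psi> x) *v u = eig2 (Complex \<delta> \<alpha>) (Complex \<delta> (- \<alpha>)) *v u + Mc x *v u"
    by (simp add: cplx_add cplx_rc Mc_def Mx_def matrix_vector_mult_add_rdistrib)
  have "b1 * u1 + (d * v + m) = lam * v \<longleftrightarrow> u1 = r1\<^sup>2 * v - m / b1" if "d = Complex \<delta> \<alpha>" for u1 d v m
  proof -
    have "b1 * u1 + (d * v + m) = lam * v \<longleftrightarrow> b1 * u1 = (lam - d) * v - m" by (auto simp: algebra_simps)
    also have "\<dots> \<longleftrightarrow> b1 * u1 = b1 * (r1\<^sup>2 * v - m / b1)" 
      unfolding that b_r(1)[symmetric] using b_nonzero by (simp add: algebra_simps)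
    finally show ?thesis using b_nonzero by simp
  qed
  moreover have "b2 * u1 + (d * v + m) = lam * v \<longleftrightarrow> u1 = r2\<^sup>2 * v - m / b2" if "d = Complex \<delta> (- \<alpha>)" for u1 d v m
  proof -
    have "b2 * u1 + (d * v + m) = lam * v \<longleftrightarrow> b2 * u1 = (lam - d) * v - m" by (auto simp: algebra_simps)
    also have "\<dots> \<longleftrightarrow> b2 * u1 = b2 * (r2\<^sup>2 * v - m / b2)" 
      unfolding that b_r(2)[symmetric] using b_nonzero by (simp add: algebra_simps)
    finally show ?thesis using b_nonzero by simp
  qed
  ultimately show ?thesis unfolding 1 2 vec2_eq_iff by (simp add: coord_add coord_eig2 coord_scale)
qed

lemma square_integrable_of_coords:
  assumes c: "continuous_on UNIV p" "continuous_on UNIV q"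
    and i: "integrable lborel (\<lambda>x. (cmod (p x))\<^sup>2)" "integrable lborel (\<lambda>x. (cmod (q x))\<^sup>2)"
  shows "square_integrable (\<lambda>x. of_coords (p x) (q x))" "continuous_on UNIV (\<lambda>x. of_coords (p x) (q x))"
proof -
  show cm: "continuous_on UNIV (\<lambda>x. of_coords (p x) (q x))" by (rule continuous_on_of_coords[OF c])
  have m: "(\<lambda>x. of_coords (p x) (q x)) \<in> borel_measurable lborel" by (rule borel_measurable_cont[OF cm])
  have "integrable lborel (\<lambda>x. (norm (of_coords (p x) (q x)))\<^sup>2)"
    by (rule Bochner_Integration.integrable_bound[OF Bochner_Integration.integrable_add[OF i]])
       (use m norm_of_coords_le in auto)
  thus "square_integrable (\<lambda>x. of_coords (p x) (q x))" using m by (simp add: square_integrable_def)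
qed

lemma has_vector_derivative_of_coords:
  assumes "(p has_vector_derivative p') (at x)" "(q has_vector_derivative q') (at x)"
  shows "((\<lambda>x. of_coords (p x) (q x)) has_vector_derivative of_coords p' q') (at x)"
  using bounded_linear.has_vector_derivative[OF bounded_linear_of_coords has_vector_derivative_Pair[OF assms]] by simp

lemma antiderivative_of_deriv:
  fixes f f' :: "real \<Rightarrow> complex^2"
  assumes "\<And>x. (f has_vector_derivative f' x) (at x)" "continuous_on UNIV f'"
  shows "f x = f 0 + interval_lebesgue_integral lborel (ereal 0) (ereal x) f'"
  using interval_integral_FTC_finite[of 0 x f' f] assms
  by (simp add: continuous_on_subset has_vector_derivative_at_within)

theorem det2_zero_iff_point_spectrum:
  "lam \<in> point_spectrum D \<beta> \<delta> \<alpha> \<epsilon> \<gamma> \<mu> \<nu> \<psi> \<longleftrightarrow> det2_kernel (Kker D \<beta> \<delta> \<alpha> \<epsilon> \<gamma> \<mu> \<nu> \<psi> lam) = 0"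
proof
  assume "det2_kernel (Kker D \<beta> \<delta> \<alpha> \<epsilon> \<gamma> \<mu> \<nu> \<psi> lam) = 0"
  then obtain w :: "idx4 \<Rightarrow> real \<Rightarrow> complex" and B i0 where
    w: "\<And>i. w i \<in> borel_measurable lborel" "\<And>i x. cmod (w i x) \<le> B * g x"
    and w0: "\<not> (AE x in lborel. w i0 x = 0)"
    and weq: "\<And>i x. w i x = - (\<Sum>j\<in>UNIV. \<integral>y. K x y $ i $ j * w j y \<partial>lborel)"
    unfolding K_def[symmetric] det2_kernel_eq_0_iff[OF K_measurable K_le] by blast
  define f where "f = (\<lambda>y. T y *v (\<chi> j. w (Inl j) y))"
  have f_eq: "f y = T y *v (\<chi> j. w (Inl j) y)" for y by (simp add: f_def)
  note ka = kernel_action[OF w f_eq]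
  define u where "u = resolvent f"
  have wS: "w (Inl i) x = (S x *v u x) $ i" and wI: "w (Inr i) x = 0" for i x
    using weq[of "Inl i" x] weq[of "Inr i" x] unfolding ka(5) by (auto simp: u_def)
  \<comment> \<open>From w = S u and T S = M: the source T w is M u, so u = R M u, the eigenvalue
    equation in integrated form.\<close>
  have fu: "f y = Mc y *v u y" for y
  proof -
    have "(\<chi> j. w (Inl j) y) = S y *v u y" by (simp add: vec_eq_iff wS)
    thus ?thesis unfolding f_def by (simp add: matrix_vector_mul_assoc TS)
  qed
  have Gc: "continuous_on UNIV (green r1 (source1 f))" "continuous_on UNIV (green r2 (source2 f))"
    by (rule green_continuous[OF r1(2) ka(1)], rule green_continuous[OF r2(2) ka(2)])
  have uc: "continuous_on UNIV (\<lambda>x. u x $ i)" for i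
    unfolding u_def resolvent_def by (rule continuous_on_component[OF continuous_on_of_coords[OF Gc]])
  \<comment> \<open>The weights and \<open>w\<close> are only known to be measurable, but their
    combination M u is continuous, and continuity of the source makes the Green function a classical
    solution.\<close>
  have fc: "continuous_on UNIV (\<lambda>y. f y $ i)" for i
    unfolding fu Mcv_nth by (intro continuous_intros Mc_continuous uc)
  have Fc: "continuous_on UNIV (source1 f)" "continuous_on UNIV (source2 f)"
    unfolding source1_def source2_def coord1_def coord2_def using b_nonzero by (auto intro!: continuous_intros fc)
  \<comment> \<open>The second derivative is r^2 times the Green function minus the source, so
    membership of u in H^2 also asks for a square integrable source.\<close>
  have Fsq: "integrable lborel (\<lambda>x. (cmod (source1 f x))\<^sup>2)" "integrable lborel (\<lambda>x. (cmod (source2 f x))\<^sup>2)"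
  proof -
    have e: "integrable lborel (\<lambda>y. exp (- (4 * a) * \<bar>y\<bar>))" by (rule integrable_exp_neg_abs) (use a_pos in simp)
    have gen: "integrable lborel (\<lambda>x. (cmod (F x))\<^sup>2)" if m: "F \<in> borel_measurable lborel" 
      and le: "\<And>y. cmod (F y) \<le> c * (2 * C2 * B * sqrt c4 * exp (- (2 * a) * \<bar>y\<bar>))" for F :: "real \<Rightarrow> complex" and c
    proof (rule Bochner_Integration.integrable_bound[OF integrable_mult_right[OF e, of "(c * (2 * C2 * B * sqrt c4))\<^sup>2"]])
      show "(\<lambda>x. (cmod (F x))\<^sup>2) \<in> borel_measurable lborel" using m by measurable
      have "(cmod (F y))\<^sup>2 \<le> (c * (2 * C2 * B * sqrt c4))\<^sup>2 * exp (- (4 * a) * \<bar>y\<bar>)" for y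
      proof -
        have "(cmod (F y))\<^sup>2 \<le> (c * (2 * C2 * B * sqrt c4 * exp (- (2 * a) * \<bar>y\<bar>)))\<^sup>2"
          using le by (intro power_mono) auto
        also have "\<dots> = (c * (2 * C2 * B * sqrt c4))\<^sup>2 * (exp (- (2 * a) * \<bar>y\<bar>))\<^sup>2"
          by (simp only: power_mult_distrib mult.assoc)
        also have "(exp (- (2 * a) * \<bar>y\<bar>))\<^sup>2 = exp (- (4 * a) * \<bar>y\<bar>)" by (simp flip: exp_double)
        finally show ?thesis .
      qed
      thus "AE y in lborel. norm ((cmod (F y))\<^sup>2) \<le> norm ((c * (2 * C2 * B * sqrt c4))\<^sup>2 * exp (- (4 * a) * \<bar>y\<bar>))"
        by (intro AE_I2) (simp add: abs_mult)
    qed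
    show "integrable lborel (\<lambda>x. (cmod (source1 f x))\<^sup>2)" "integrable lborel (\<lambda>x. (cmod (source2 f x))\<^sup>2)"
      by (rule gen[OF source_measurable(1)[OF ka(3)] source_le(1)[OF ka(4)]], rule gen[OF source_measurable(2)[OF ka(3)] source_le(2)[OF ka(4)]])
  qed
  note d1 = green_has_vector_derivative[OF r1(2) ka(1) Fc(1)] green_deriv_has_vector_derivative[OF r1(2) ka(1) Fc(1)]
  note d2 = green_has_vector_derivative[OF r2(2) ka(2) Fc(2)] green_deriv_has_vector_derivative[OF r2(2) ka(2) Fc(2)]
  note G1c = vector_derivative_continuous[OF d1(2)] vector_derivative_continuous[OF d2(2)]
  note sq1 = green_square_integrable[OF r1(2) ka(1) Fc(1)] and sq2 = green_square_integrable[OF r2(2) ka(2) Fc(2)]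
  define u1 where "u1 x = of_coords (green_deriv r1 (source1 f) x) (green_deriv r2 (source2 f) x)" for x
  define u2 where "u2 x = of_coords (r1\<^sup>2 * green r1 (source1 f) x - source1 f x) (r2\<^sup>2 * green r2 (source2 f) x - source2 f x)" for x
  have su: "square_integrable u"
    unfolding u_def resolvent_def[abs_def] by (rule square_integrable_of_coords[OF Gc sq1(1) sq2(1)])
  have su1: "square_integrable u1" "continuous_on UNIV u1"
    unfolding u1_def[abs_def] by (rule square_integrable_of_coords[OF G1c sq1(2) sq2(2)])+
  have su2: "square_integrable u2" "continuous_on UNIV u2"
  proof -
    have c: "continuous_on UNIV (\<lambda>x. r1\<^sup>2 * green r1 (source1 f) x - source1 f x)" "continuous_on UNIV (\<lambda>x. r2\<^sup>2 * green r2 (source2 f) x - source2 f x)"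
      by (intro continuous_intros Gc Fc)+
    have i: "integrable lborel (\<lambda>x. (cmod (r1\<^sup>2 * green r1 (source1 f) x - source1 f x))\<^sup>2)" "integrable lborel (\<lambda>x. (cmod (r2\<^sup>2 * green r2 (source2 f) x - source2 f x))\<^sup>2)"
      using integrable_square_add[OF borel_measurable_cont[OF Gc(1)] borel_measurable_cont[OF Fc(1)] sq1(1) Fsq(1), of "r1\<^sup>2" "-1"]
        integrable_square_add[OF borel_measurable_cont[OF Gc(2)] borel_measurable_cont[OF Fc(2)] sq2(1) Fsq(2), of "r2\<^sup>2" "-1"] by simp_all
    show "square_integrable u2" "continuous_on UNIV u2"
      unfolding u2_def[abs_def] by (rule square_integrable_of_coords[OF c i])+
  qed
  have du: "(u has_vector_derivative u1 x) (at x)" for x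
    unfolding u_def resolvent_def[abs_def] u1_def by (rule has_vector_derivative_of_coords[OF d1(1) d2(1)])
  have du1: "(u1 has_vector_derivative u2 x) (at x)" for x
    unfolding u1_def[abs_def] u2_def by (rule has_vector_derivative_of_coords[OF d1(2) d2(2)])
  have si: "set_integrable lborel {a..b} h" if "continuous_on UNIV h" for h :: "real \<Rightarrow> complex^2" and a b
    by (rule borel_integrable_atLeastAtMost') (rule continuous_on_subset[OF that], simp)
  have H2: "H2_with u u1 u2"
    unfolding H2_with_def
    using su su1(1) su2(1) si[OF su1(2)] si[OF su2(2)] antiderivative_of_deriv[OF du su1(2)] antiderivative_of_deriv[OF du1 su2(2)]
    by blast
  have eq: "cplx (rc \<beta> (D/2)) *v u2 x + cplx (rc \<delta> \<alpha> + Mmat \<epsilon> \<gamma> \<mu> \<nu> \<psi> x) *v u x = lam *s u x" for x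
    unfolding eigen_equation_iff fu[symmetric] unfolding u2_def u_def resolvent_def by (simp add: source1_def source2_def)
  have "\<not> (AE x in lborel. u x = 0)"
  proof
    assume "AE x in lborel. u x = 0"
    hence "AE x in lborel. w i0 x = 0"
      by eventually_elim (cases i0; simp add: wS wI)
    thus False using w0 by blast
  qed
  thus "lam \<in> point_spectrum D \<beta> \<delta> \<alpha> \<epsilon> \<gamma> \<mu> \<nu> \<psi>"
    unfolding point_spectrum_def using H2 eq by blast
next
  assume "lam \<in> point_spectrum D \<beta> \<delta> \<alpha> \<epsilon> \<gamma> \<mu> \<nu> \<psi>"
  then obtain u u1 u2 where H2: "H2_with u u1 u2" and u0: "\<not> (AE x in lborel. u x = 0)"
    and eq: "AE x in lborel. cplx (rc \<beta> (D/2)) *v u2 x + cplx (rc \<delta> \<alpha> + Mmat \<epsilon> \<gamma> \<mu> \<nu> \<psi> x) *v u x = lam *s u x"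
    unfolding point_spectrum_def by blast
  have si: "\<And>a b. set_integrable lborel {a..b} u1" "\<And>a b. set_integrable lborel {a..b} u2"
    and ui: "\<And>x. u x = u 0 + interval_lebesgue_integral lborel (ereal 0) (ereal x) u1"
      "\<And>x. u1 x = u1 0 + interval_lebesgue_integral lborel (ereal 0) (ereal x) u2"
    and sq: "square_integrable u" "square_integrable u1"
    using H2 unfolding H2_with_def by blast+
  have u1c: "continuous_on UNIV u1" by (rule antiderivative_continuous[OF si(2) ui(2)])
  have du: "(u has_vector_derivative u1 x) (at x)" for x
    by (rule antiderivative_deriv[OF si(1) ui(1) u1c]) simp
  have uc: "continuous_on UNIV u" by (rule vector_derivative_continuous[OF du])
  have uic: "continuous_on UNIV (\<lambda>x. u x $ i)" for i by (intro continuous_intros uc)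
  define f where "f y = Mc y *v u y" for y
  have fc: "continuous_on UNIV (\<lambda>y. f y $ i)" for i
    unfolding f_def Mcv_nth by (intro continuous_intros Mc_continuous uic)
  have Fc: "continuous_on UNIV (source1 f)" "continuous_on UNIV (source2 f)"
    unfolding source1_def source2_def coord1_def coord2_def using b_nonzero by (auto intro!: continuous_intros fc)
  have ec: "continuous_on UNIV (\<lambda>x. coord1 (u x))" "continuous_on UNIV (\<lambda>x. coord2 (u x))"
    using bounded_linear.continuous_on[OF bounded_linear_coord(1) uc] bounded_linear.continuous_on[OF bounded_linear_coord(2) uc] by auto
  have kc: "continuous_on UNIV (\<lambda>x. of_coords (r1\<^sup>2 * coord1 (u x) - source1 f x) (r2\<^sup>2 * coord2 (u x) - source2 f x))"
    by (intro continuous_on_of_coords continuous_intros ec Fc)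
  \<comment> \<open>The weak second derivative agrees almost everywhere with a continuous function,
    so u is a classical solution.\<close>
  have "AE x in lborel. u2 x = of_coords (r1\<^sup>2 * coord1 (u x) - source1 f x) (r2\<^sup>2 * coord2 (u x) - source2 f x)"
    using eq unfolding eigen_equation_iff by (simp add: source1_def source2_def f_def)
  from antiderivative_deriv[OF si(2) ui(2) kc this]
  have du1: "(u1 has_vector_derivative of_coords (r1\<^sup>2 * coord1 (u x) - source1 f x) (r2\<^sup>2 * coord2 (u x) - source2 f x)) (at x)" for x .
  have n2: "integrable lborel (\<lambda>x. (norm (u x))\<^sup>2)" "integrable lborel (\<lambda>x. (norm (u1 x))\<^sup>2)"
    using sq by (auto simp: square_integrable_def)
  have ell_sq: "integrable lborel (\<lambda>x. (cmod (l (v x)))\<^sup>2)"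
    if "integrable lborel (\<lambda>x. (norm (v x))\<^sup>2)" "continuous_on UNIV v" "bounded_linear l" "\<And>z. (cmod (l z))\<^sup>2 \<le> 2 * (norm z)\<^sup>2"
    for l :: "complex^2 \<Rightarrow> complex" and v :: "real \<Rightarrow> complex^2"
  proof (rule Bochner_Integration.integrable_bound[OF integrable_mult_right[OF that(1), of 2]])
    have "(\<lambda>x. l (v x)) \<in> borel_measurable lborel"
      by (rule borel_measurable_cont[OF bounded_linear.continuous_on[OF that(3,2)]])
    thus "(\<lambda>x. (cmod (l (v x)))\<^sup>2) \<in> borel_measurable lborel" by measurable
    show "AE x in lborel. norm ((cmod (l (v x)))\<^sup>2) \<le> norm (2 * (norm (v x))\<^sup>2)" using that(4) by auto
  qed
  have fm: "(\<lambda>y. f y $ i) \<in> borel_measurable lborel" for i by (rule borel_measurable_cont[OF fc])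
  \<comment> \<open>At this stage u is only square integrable. With the decay of M, the inequality 2
    x y <= x^2 + y^2 still bounds the source M u by an integrable function.\<close>
  have fle: "cmod (f y $ i) \<le> C1 * (exp (- (4 * a) * \<bar>y\<bar>) + (norm (u y))\<^sup>2)" for y i
  proof -
    have un: "cmod (u y $ i) \<le> norm (u y)" for i by (rule Finite_Cartesian_Product.norm_nth_le)
    have t: "cmod (Mc y $ i $ j * u y $ l) \<le> C1 * exp (- (2 * a) * \<bar>y\<bar>) * norm (u y)" for j l
      unfolding norm_mult by (intro mult_mono Mc_le un) (auto simp: C1_nonneg)
    have "cmod (f y $ i) \<le> C1 * exp (- (2 * a) * \<bar>y\<bar>) * norm (u y) + C1 * exp (- (2 * a) * \<bar>y\<bar>) * norm (u y)"
      unfolding f_def Mcv_nth by (intro norm_triangle_le add_mono t)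
    also have "\<dots> = C1 * (2 * exp (- (2 * a) * \<bar>y\<bar>) * norm (u y))" by simp
    also have "2 * exp (- (2 * a) * \<bar>y\<bar>) * norm (u y) \<le> (exp (- (2 * a) * \<bar>y\<bar>))\<^sup>2 + (norm (u y))\<^sup>2"
      by (rule sum_squares_bound)
    also have "(exp (- (2 * a) * \<bar>y\<bar>))\<^sup>2 = exp (- (4 * a) * \<bar>y\<bar>)" by (simp flip: exp_double)
    finally show ?thesis using C1_nonneg by (simp add: mult_left_mono)
  qed
  have ei: "integrable lborel (\<lambda>y. C1 * (exp (- (4 * a) * \<bar>y\<bar>) + (norm (u y))\<^sup>2))"
    using n2(1) integrable_exp_neg_abs[of "4 * a"] a_pos by simp
  have Fi: "integrable lborel (source1 f)" "integrable lborel (source2 f)"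
    by (rule integrable_dominated[OF _ source_measurable(1)[OF fm] source_le(1)[OF fle]], rule integrable_mult_right[OF ei])
       (rule integrable_dominated[OF _ source_measurable(2)[OF fm] source_le(2)[OF fle]], rule integrable_mult_right[OF ei])
  have green_deriv: "coord1 (u x) = green r1 (source1 f) x" for x
  proof (rule green_unique[OF r1(2) Fi(1) Fc(1)])
    show "((\<lambda>x. coord1 (u x)) has_vector_derivative coord1 (u1 x)) (at x)" for x
      by (rule bounded_linear.has_vector_derivative[OF bounded_linear_coord(1) du])
    show "((\<lambda>x. coord1 (u1 x)) has_vector_derivative r1\<^sup>2 * coord1 (u x) - source1 f x) (at x)" for x
      using bounded_linear.has_vector_derivative[OF bounded_linear_coord(1) du1] by simp
    show "integrable lborel (\<lambda>x. (cmod (coord1 (u x)))\<^sup>2)"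
      by (rule ell_sq[OF n2(1) uc bounded_linear_coord(1) norm_coord_le(1)])
    show "integrable lborel (\<lambda>x. (cmod (coord1 (u1 x)))\<^sup>2)"
      by (rule ell_sq[OF n2(2) u1c bounded_linear_coord(1) norm_coord_le(1)])
  qed
  have G2: "coord2 (u x) = green r2 (source2 f) x" for x
  proof (rule green_unique[OF r2(2) Fi(2) Fc(2)])
    show "((\<lambda>x. coord2 (u x)) has_vector_derivative coord2 (u1 x)) (at x)" for x
      by (rule bounded_linear.has_vector_derivative[OF bounded_linear_coord(2) du])
    show "((\<lambda>x. coord2 (u1 x)) has_vector_derivative r2\<^sup>2 * coord2 (u x) - source2 f x) (at x)" for x
      using bounded_linear.has_vector_derivative[OF bounded_linear_coord(2) du1] by simp
    show "integrable lborel (\<lambda>x. (cmod (coord2 (u x)))\<^sup>2)"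
      by (rule ell_sq[OF n2(1) uc bounded_linear_coord(2) norm_coord_le(2)])
    show "integrable lborel (\<lambda>x. (cmod (coord2 (u1 x)))\<^sup>2)"
      by (rule ell_sq[OF n2(2) u1c bounded_linear_coord(2) norm_coord_le(2)])
  qed
  have uV: "u x = resolvent f x" for x by (simp add: resolvent_def vec2_eq_iff green_deriv G2)
  define B where "B = 1 / (2 * cmod r1) * (\<integral>y. cmod (source1 f y) \<partial>lborel) + 1 / (2 * cmod r2) * (\<integral>y. cmod (source2 f y) \<partial>lborel)"
  \<comment> \<open>Boundedness of u comes from its Green representation; it is what makes w = S u
    dominated by \<open>g\<close>.\<close>
  have uB: "cmod (u x $ i) \<le> B" for x i
    unfolding uV resolvent_def B_def
    by (rule order_trans[OF cmod_of_coords_nth_le]) (intro add_mono green_bounded r1(2) r2(2) Fi)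
  have B0: "B \<ge> 0" using uB norm_ge_zero order_trans by blast
  define w :: "idx4 \<Rightarrow> real \<Rightarrow> complex" where "w i x = (case i of Inl i \<Rightarrow> (S x *v u x) $ i | Inr _ \<Rightarrow> 0)" for i x
  have wm: "w i \<in> borel_measurable lborel" for i
    using ST_measurable(1) borel_measurable_cont[OF uic]
    by (cases i) (auto simp: w_def[abs_def] matvec2_nth simp del: measurable_lborel1 intro!: borel_measurable_add borel_measurable_times)
  have wB: "cmod (w i x) \<le> (2 * C2 * B) * g x" for i x
  proof (cases i)
    case (Inr j)
    thus ?thesis using g_pos[of x] C2_nonneg B0 by (simp add: w_def less_imp_le)
  next
    case (Inl j)
    have t: "cmod (S x $ j $ l * u x $ m) \<le> C2 * exp (- a * \<bar>x\<bar>) * B" for l m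
      unfolding norm_mult by (intro mult_mono ST_le uB) (auto simp: C2_nonneg)
    have "cmod (w i x) \<le> C2 * exp (- a * \<bar>x\<bar>) * B + C2 * exp (- a * \<bar>x\<bar>) * B"
      unfolding w_def Inl sum.case matvec2_nth
      by (intro norm_triangle_le add_mono t)
    also have "\<dots> = 2 * C2 * B * exp (- a * \<bar>x\<bar>)" by simp
    also have "\<dots> \<le> 2 * C2 * B * g x" by (rule mult_left_mono[OF exp_le_g]) (use C2_nonneg B0 in simp)
    finally show ?thesis .
  qed
  have Tw: "T y *v (\<chi> j. w (Inl j) y) = f y" for y
  proof -
    have "(\<chi> j. w (Inl j) y) = S y *v u y" by (simp add: vec_eq_iff w_def)
    thus ?thesis unfolding f_def by (simp add: matrix_vector_mul_assoc TS)
  qed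
  have weq: "w i x = - (\<Sum>j\<in>UNIV. \<integral>y. K x y $ i $ j * w j y \<partial>lborel)" for i x
    unfolding kernel_action(5)[OF wm wB Tw[symmetric]] by (cases i) (simp_all add: w_def uV[symmetric])
  \<comment> \<open>S may be singular, so w = 0 does not give u = 0 pointwise. It does give T w = 0,
    and u = R T w then vanishes everywhere.\<close>
  have "\<exists>i. \<not> (AE x in lborel. w i x = 0)"
  proof (rule ccontr)
    assume "\<not> ?thesis"
    hence "AE x in lborel. w (Inl 1) x = 0" "AE x in lborel. w (Inl 2) x = 0" by blast+
    hence "AE y in lborel. f y = 0"
      by eventually_elim (simp add: Tw[symmetric] vec_eq_iff matvec2_nth)
    hence ae: "AE y in lborel. exp (- r1 * \<bar>x - y\<bar>) / (2 * r1) * source1 f y = 0"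
      "AE y in lborel. exp (- r2 * \<bar>x - y\<bar>) / (2 * r2) * source2 f y = 0" for x :: real
      by (eventually_elim, simp add: source1_def source2_def coord1_def coord2_def)+
    have "u x = 0" for x
    proof -
      have "green r1 (source1 f) x = 0" "green r2 (source2 f) x = 0"
        unfolding green_def by (rule integral_eq_zero_AE[OF ae(1)], rule integral_eq_zero_AE[OF ae(2)])
      thus ?thesis unfolding uV resolvent_def by (simp add: vec_eq_iff forall_2)
    qed
    thus False using u0 by simp
  qed
  thus "det2_kernel (Kker D \<beta> \<delta> \<alpha> \<epsilon> \<gamma> \<mu> \<nu> \<psi> lam) = 0"
    unfolding K_def[symmetric] det2_kernel_eq_0_iff[OF K_measurable K_le]
    using wm wB weq by blast
qed

end

section \<open>Decay rates off the essential spectrum\<close>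

lemma sqrt_right_half_plane:
  assumes "\<not> (\<exists>s::real. z = - complex_of_real (s\<^sup>2))"
  obtains r where "r\<^sup>2 = z" "Re r > 0"
proof -
  have "Re (csqrt z) \<noteq> 0"
  proof
    assume "Re (csqrt z) = 0"
    hence "csqrt z = \<i> * complex_of_real (Im (csqrt z))" by (simp add: complex_eq_iff)
    hence "(csqrt z)\<^sup>2 = (\<i> * complex_of_real (Im (csqrt z)))\<^sup>2" by simp
    hence "z = - complex_of_real ((Im (csqrt z))\<^sup>2)" by (simp add: power_mult_distrib)
    thus False using assms by blast
  qed
  moreover have "Re (csqrt z) \<ge> 0" using csqrt_principal[of z] by auto
  ultimately show ?thesis by (intro that[of "csqrt z"]) auto
qed

theorem theorem6p4:
  fixes D \<beta> \<delta> \<alpha> \<epsilon> \<gamma> \<mu> \<nu> :: real and \<psi> :: "real \<Rightarrow> complex" and lam :: complex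
  assumes "\<beta> \<ge> 0" and "(D, \<beta>) \<noteq> (0, 0)"
    and "stationary_pulse D \<beta> \<delta> \<alpha> \<epsilon> \<gamma> \<mu> \<nu> \<psi>"
    and "\<exists>C a. C > 0 \<and> a > 0 \<and> (\<forall>x. cmod (\<psi> x) \<le> C * exp (- a * \<bar>x\<bar>))"
    and "lam \<notin> ess_spectrum D \<beta> \<delta> \<alpha>"
  shows "lam \<in> point_spectrum D \<beta> \<delta> \<alpha> \<epsilon> \<gamma> \<mu> \<nu> \<psi> \<longleftrightarrow>
         det2_kernel (Kker D \<beta> \<delta> \<alpha> \<epsilon> \<gamma> \<mu> \<nu> \<psi> lam) = 0"
proof -
  obtain C a where Ca: "C > 0" "a > 0" "\<And>x. cmod (\<psi> x) \<le> C * exp (- a * \<bar>x\<bar>)" using assms(4) by blast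
  have nz: "Complex \<beta> (D/2) \<noteq> 0" "Complex \<beta> (- D/2) \<noteq> 0" using assms(2) by (auto simp: complex_eq_iff)
  \<comment> \<open>A quotient of the form -s^2 would place \<open>lam\<close> on the first branch
    of the essential spectrum; the second root is obtained from the other branch.\<close>
  have "\<not> (\<exists>s::real. (lam - Complex \<delta> \<alpha>) / Complex \<beta> (D/2) = - complex_of_real (s\<^sup>2))"
  proof
    assume "\<exists>s::real. (lam - Complex \<delta> \<alpha>) / Complex \<beta> (D/2) = - complex_of_real (s\<^sup>2)"
    then obtain s :: real where "(lam - Complex \<delta> \<alpha>) / Complex \<beta> (D/2) = - complex_of_real (s\<^sup>2)" by blast
    hence "lam = Complex \<delta> \<alpha> - complex_of_real (s\<^sup>2) * Complex \<beta> (D/2)"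
      using nz(1) by (simp add: divide_eq_eq algebra_simps)
    thus False using assms(5) unfolding ess_spectrum_def by blast
  qed
  then obtain r1 where r1: "r1\<^sup>2 = (lam - Complex \<delta> \<alpha>) / Complex \<beta> (D/2)" "Re r1 > 0"
    by (rule sqrt_right_half_plane)
  have "\<not> (\<exists>s::real. (lam - Complex \<delta> (- \<alpha>)) / Complex \<beta> (- D/2) = - complex_of_real (s\<^sup>2))"
  proof
    assume "\<exists>s::real. (lam - Complex \<delta> (- \<alpha>)) / Complex \<beta> (- D/2) = - complex_of_real (s\<^sup>2)"
    then obtain s :: real where "(lam - Complex \<delta> (- \<alpha>)) / Complex \<beta> (- D/2) = - complex_of_real (s\<^sup>2)" by blast
    hence "lam = Complex \<delta> (- \<alpha>) - complex_of_real (s\<^sup>2) * Complex \<beta> (- D/2)"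
      using nz(2) by (simp add: divide_eq_eq algebra_simps)
    thus False using assms(5) unfolding ess_spectrum_def by blast
  qed
  then obtain r2 where r2: "r2\<^sup>2 = (lam - Complex \<delta> (- \<alpha>)) / Complex \<beta> (- D/2)" "Re r2 > 0"
    by (rule sqrt_right_half_plane)
  have "continuous_on UNIV \<psi>"
    using assms(3) unfolding stationary_pulse_def by (auto intro: vector_derivative_continuous)
  then interpret pulse D \<beta> \<delta> \<alpha> \<epsilon> \<gamma> \<mu> \<nu> \<psi> lam r1 r2 C a
    using assms(2) Ca r1 r2 by unfold_locales auto
  show ?thesis by (rule det2_zero_iff_point_spectrum)
qed

end
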